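(* Let $\rho_d$ denote the smallest efficiency of all triangulations of the cube $I^d=[0,1]^d$. Then $$\lim_{i\to\infty}\rho_i\;\le\;\sqrt[3]{\frac{44/3}{27}}\approx 0.8159 .$$
   Context: A triangulation of a $d$-dimensional polytope $P$ is a decomposition of $P$ into $d$-simplices that use as vertices only vertices of $P$ and that intersect face to face (i.e., they form a geometric simplicial complex). The size $|T|$ of a triangulation $T$ is its number of $d$-simplices. The efficiency of a triangulation $T$ of the $d$-cube $I^d=[0,1]^d$ is $(|T|/d!)^{1/d}$. For $d\ge 1$, $\phi_d$ denotes the smallest size of a triangulation of $I^d$, and $\rho_d=(\phi_d/d!)^{1/d}$ the smallest efficiency. The sequence $(\rho_i)_{i\ge 1}$ converges. *)

theory Defs
  imports "HOL-Analysis.Analysis" "HOL-Analysis.Finite_Function_Topology"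
begin

text \<open>
  The dimension varies along the sequence, so it cannot be a type. All the spaces of real
  d-tuples are taken inside one real vector space, that of finitely supported sequences, as the
  subspaces of sequences vanishing from index d on. The library notions \<open>convex hull\<close>,
  \<open>affine_dependent\<close>, \<open>extreme_point_of\<close> and \<open>face_of\<close> are available in any real vector space,
  whereas \<open>simplex\<close> and \<open>triangulation\<close> are restricted to Euclidean spaces; this is why
  triangulations are defined anew.
\<close>

definition unit_cube :: "nat \<Rightarrow> (nat \<Rightarrow>\<^sub>0 real) set" where
  "unit_cube d = {x. (\<forall>i<d. 0 \<le> Poly_Mapping.lookup x i \<and> Poly_Mapping.lookup x i \<le> 1) \<and>
                     (\<forall>i\<ge>d. Poly_Mapping.lookup x i = 0)}"

definition simplex_on :: "nat \<Rightarrow> 'a::real_vector set \<Rightarrow> 'a set \<Rightarrow> bool" where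
  "simplex_on d C S \<longleftrightarrow>
     finite C \<and> card C = d + 1 \<and> \<not> affine_dependent C \<and> S = convex hull C"

text \<open>
  A triangulation is represented by its set of d-simplices, where d is the dimension of P.
\<close>

definition triangulation_of :: "nat \<Rightarrow> 'a::real_vector set \<Rightarrow> 'a set set \<Rightarrow> bool" where
  "triangulation_of d P \<T> \<longleftrightarrow>
     finite \<T> \<and> \<Union>\<T> = P \<and>
     (\<forall>S\<in>\<T>. \<exists>C. C \<subseteq> {v. v extreme_point_of P} \<and> simplex_on d C S) \<and>
     (\<forall>S\<in>\<T>. \<forall>S'\<in>\<T>. (S \<inter> S') face_of S \<and> (S \<inter> S') face_of S')"

definition efficiency :: "nat \<Rightarrow> 'a set set \<Rightarrow> real" where
  "efficiency d \<T> = root d (real (card \<T>) / fact d)"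

definition phi :: "nat \<Rightarrow> nat" where
  "phi d = (LEAST n. \<exists>\<T>. triangulation_of d (unit_cube d) \<T> \<and> card \<T> = n)"

definition rho :: "nat \<Rightarrow> real" where
  "rho d = root d (real (phi d) / fact d)"

lemma rho_le_efficiency:
  assumes "d \<ge> 1" and "triangulation_of d (unit_cube d) \<T>"
  shows "rho d \<le> efficiency d \<T>"
proof -
  have "phi d \<le> card \<T>"
    unfolding phi_def by (rule Least_le) (use assms(2) in blast)
  then show ?thesis
    using assms(1) by (simp add: rho_def efficiency_def divide_right_mono)
qed

lemma rho_attained:
  assumes "triangulation_of d (unit_cube d) \<T>"
  shows "\<exists>\<T>'. triangulation_of d (unit_cube d) \<T>' \<and> rho d = efficiency d \<T>'"
proof -
  have "\<exists>\<T>'. triangulation_of d (unit_cube d) \<T>' \<and> card \<T>' = phi d"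
    unfolding phi_def by (rule LeastI_ex) (use assms in blast)
  then show ?thesis
    by (metis rho_def efficiency_def)
qed

end

theory Submission
  imports Defs "HOL-Real_Asymp.Real_Asymp"
begin

text \<open>
  Idea. Let \<open>T\<close> be a triangulation of the product of the \<open>k\<close>-cube and a simplex with \<open>m\<close> vertices,
  and let the vertices of a triangulation of the \<open>n\<close>-cube be coloured with \<open>m\<close> colours. On every
  simplex \<open>\<sigma>\<close> of the latter, \<open>T\<close> pulls back to a subdivision of the product of the \<open>k\<close>-cube and \<open>\<sigma>\<close>,
  which is refined, colour by colour, by staircase triangulations of products of two simplices.
  Points of the \<open>(k+n)\<close>-cube get unique weights on the resulting cells because a coupling of
  two measures on chains that is supported on a chain is unique and always exists.

  With one colour this makes \<open>phi d / fact d\<close> submultiplicative, so that \<open>rho\<close> converges (Fekete).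
  For \<open>k = m = 3\<close> a colouring that is balanced on average yields
  \<open>phi (n + 3) \<le> W (n/3)^3 (1 + O(1/n)) phi n\<close>, where \<open>W\<close> sums over the cells of \<open>T\<close> the reciprocals of
  \<open>(t\<^sub>0 - 1)! (t\<^sub>1 - 1)! (t\<^sub>2 - 1)!\<close>, with \<open>t\<^sub>i\<close> vertices of colour \<open>i\<close>. Hence the limit is at most
  the cube root of \<open>W / 27\<close>, and an explicit regular triangulation with 38 cells has \<open>W = 44/3\<close>.
\<close>

section \<open>Triangulations in terms of barycentric weights\<close>

text \<open>With one colour and k = 3 the same count only gives the factor
  \<open>phi 3 / fact 3\<close> per three dimensions, the efficiency of the 3-cube itself. Several
  colours help because \<open>t\<close> vertices of a colour in a cell combine with \<open>s\<close>
  vertices of that colour in a simplex to about \<open>s^(t-1) / (t-1)!\<close> staircases, where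
  \<open>s\<close> is on average only a third of the dimension; three more dimensions multiply
  \<open>fact n\<close> by about \<open>n^3\<close>, which leaves \<open>W / 27\<close>. A colouring
  need not be balanced on any given simplex. But the degrees \<open>t - 1\<close> of a cell add up
  to 3, so the inequality of arithmetic and geometric means turns its monomial into cubes, and only
  third moments of the colour counts must be controlled, which random colours do on average. Unique
  weights are the form of a triangulation that survives the product: they express affine
  independence and face-to-face intersection at once. Geometry enters only in the translation to and
  from \<open>triangulation_of\<close>.\<close>

text \<open>
  The vertices of the \<open>d\<close>-cube are encoded as the numbers below \<open>2 ^ d\<close>, with the binary digits as
  coordinates. A triangulation is a family of vertex sets such that every point has exactly one
  system of weights supported on a member of the family.
\<close>

definition weights :: "nat \<Rightarrow> (nat \<Rightarrow> real) \<Rightarrow> (nat \<Rightarrow> real) \<Rightarrow> bool" where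
  "weights d p w \<longleftrightarrow> (\<forall>v. 0 \<le> w v) \<and> (\<forall>v\<ge>2^d. w v = 0) \<and> (\<Sum>v<2^d. w v) = 1 \<and>
     (\<forall>j<d. (\<Sum>v<2^d. w v * of_bool (bit v j)) = p j)"

definition cube_complex :: "nat \<Rightarrow> nat set set \<Rightarrow> bool" where
  "cube_complex d F \<longleftrightarrow> finite F \<and> (\<forall>C\<in>F. C \<subseteq> {..<2^d} \<and> card C = d + 1) \<and>
     (\<forall>p. (\<forall>j<d. 0 \<le> p j \<and> p j \<le> 1) \<longrightarrow> (\<exists>C\<in>F. \<exists>w. weights d p w \<and> {v. w v \<noteq> 0} \<subseteq> C)) \<and>
     (\<forall>C\<in>F. \<forall>C'\<in>F. \<forall>p w w'. weights d p w \<longrightarrow> weights d p w' \<longrightarrow>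
        {v. w v \<noteq> 0} \<subseteq> C \<longrightarrow> {v. w' v \<noteq> 0} \<subseteq> C' \<longrightarrow> w = w')"

definition prism_vertices :: "nat \<Rightarrow> nat \<Rightarrow> (nat \<times> nat) set" where
  "prism_vertices k m = {..<2^k} \<times> {..<m}"

text \<open>\<open>p\<close> is the position in the cube and \<open>\<mu>\<close> the barycentric
  position in the simplex. Total weight 1 is not imposed separately: the total is the sum of the
  \<open>\<mu> i\<close>.\<close>

definition prism_weights ::
  "nat \<Rightarrow> nat \<Rightarrow> (nat \<Rightarrow> real) \<Rightarrow> (nat \<Rightarrow> real) \<Rightarrow> (nat \<times> nat \<Rightarrow> real) \<Rightarrow> bool" where
  "prism_weights k m p \<mu> w \<longleftrightarrow> (\<forall>a. 0 \<le> w a) \<and> (\<forall>a. a \<notin> prism_vertices k m \<longrightarrow> w a = 0) \<and>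
     (\<forall>i<m. (\<Sum>v<2^k. w (v, i)) = \<mu> i) \<and>
     (\<forall>j<k. (\<Sum>a\<in>prism_vertices k m. w a * of_bool (bit (fst a) j)) = p j)"

definition colour_class :: "('a \<times> nat) set \<Rightarrow> nat \<Rightarrow> 'a set" where
  "colour_class C i = {v. (v, i) \<in> C}"

text \<open>
  The condition on \<open>card (colour_class C i)\<close> says that the complex restricts to complexes of the
  products of the cube with the faces of the simplex. It is needed where the coloured
  triangulation has simplices that miss a colour.
\<close>

definition prism_complex :: "nat \<Rightarrow> nat \<Rightarrow> (nat \<times> nat) set set \<Rightarrow> bool" where
  "prism_complex k m F \<longleftrightarrow> finite F \<and>
     (\<forall>C\<in>F. C \<subseteq> prism_vertices k m \<and> card C = k + m \<and> (\<forall>i<m. colour_class C i \<noteq> {})) \<and>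
     (\<forall>p \<mu>. (\<forall>j<k. 0 \<le> p j \<and> p j \<le> 1) \<longrightarrow> (\<forall>i<m. 0 \<le> \<mu> i) \<longrightarrow> (\<Sum>i<m. \<mu> i) = 1 \<longrightarrow>
        (\<exists>C\<in>F. \<exists>w. prism_weights k m p \<mu> w \<and> {a. w a \<noteq> 0} \<subseteq> C \<and>
           (\<forall>i<m. \<mu> i = 0 \<longrightarrow> card (colour_class C i) = 1))) \<and>
     (\<forall>C\<in>F. \<forall>C'\<in>F. \<forall>p \<mu> w w'. prism_weights k m p \<mu> w \<longrightarrow> prism_weights k m p \<mu> w' \<longrightarrow>
        (\<Sum>i<m. \<mu> i) = 1 \<longrightarrow> {a. w a \<noteq> 0} \<subseteq> C \<longrightarrow> {a. w' a \<noteq> 0} \<subseteq> C' \<longrightarrow> w = w')"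

section \<open>Staircases and chain couplings\<close>

text \<open>Monotone lattice paths from the first pair to the last, the cells of the staircase
  triangulation of a product of two simplices. The clause for \<open>[x] []\<close> ends a path
  after its last pair. It also settles the case of a colour that a simplex lacks: one vertex of that
  colour in the prism cell gives the empty path, several give no path at all.\<close>

fun staircases :: "'a list \<Rightarrow> 'b list \<Rightarrow> ('a \<times> 'b) set set" where
  "staircases [] ys = {}"
| "staircases [x] [] = {{}}"
| "staircases (x # x' # xs) [] = {}"
| "staircases (x # xs) (y # ys) =
     insert (x, y) ` (staircases xs (y # ys) \<union> staircases (x # xs) ys)"

fun staircase_count :: "nat \<Rightarrow> nat \<Rightarrow> nat" where
  "staircase_count 0 s = 0"
| "staircase_count (Suc 0) 0 = 1"
| "staircase_count (Suc (Suc t)) 0 = 0"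
| "staircase_count (Suc t) (Suc s) = staircase_count t (Suc s) + staircase_count (Suc t) s"

lemma staircase_count_1: "staircase_count (Suc 0) s = 1"
  by (induction s) auto

lemma staircase_count_Suc_Suc: "staircase_count (Suc t) (Suc s) = (t + s) choose t"
proof (induction "Suc t" "Suc s" arbitrary: t s rule: staircase_count.induct)
  case (4 t s)
  show ?case
  proof (cases t)
    case t: 0
    then show ?thesis by (simp add: staircase_count_1)
  next
    case t: (Suc t')
    then show ?thesis
    proof (cases s)
      case 0
      then show ?thesis using 4(1)[of t'] t by simp
    next
      case (Suc s')
      then show ?thesis using 4(1)[of t'] 4(2)[of s'] t by simp
    qed
  qed
qed

lemma finite_staircases: "finite (staircases xs ys)"
  by (induction xs ys rule: staircases.induct) auto

lemma card_staircases_le: "card (staircases xs ys) \<le> staircase_count (length xs) (length ys)"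
proof (induction xs ys rule: staircases.induct)
  case (4 x xs y ys)
  have "card (staircases (x # xs) (y # ys)) \<le> card (staircases xs (y # ys) \<union> staircases (x # xs) ys)"
    unfolding staircases.simps by (intro card_image_le finite_UnI finite_staircases)
  also have "\<dots> \<le> card (staircases xs (y # ys)) + card (staircases (x # xs) ys)"
    by (rule card_Un_le)
  finally show ?case using 4 by simp
qed auto

lemma staircase_subset: "P \<in> staircases xs ys \<Longrightarrow> P \<subseteq> set xs \<times> set ys"
  by (induction xs ys arbitrary: P rule: staircases.induct) fastforce+

lemma card_staircase:
  assumes "distinct xs" "distinct ys" "P \<in> staircases xs ys"
  shows "card P + 1 = length xs + length ys"
  using assms
proof (induction xs ys arbitrary: P rule: staircases.induct)
  case (4 x xs y ys)
  then obtain P' where P: "P = insert (x, y) P'"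
    and P': "P' \<in> staircases xs (y # ys) \<or> P' \<in> staircases (x # xs) ys" by auto
  have "(x, y) \<notin> P'"
    using P' staircase_subset[of P' xs "y # ys"] staircase_subset[of P' "x # xs" ys] 4(3,4) by auto
  moreover have "finite P'"
    using P' staircase_subset[of P' xs "y # ys"] staircase_subset[of P' "x # xs" ys]
    by (metis List.finite_set finite_cartesian_product finite_subset)
  ultimately show ?case using P' 4 P by auto
qed auto

definition is_chain :: "('a::linorder \<times> 'b::linorder) set \<Rightarrow> bool" where
  "is_chain P \<longleftrightarrow> (\<forall>(a, b)\<in>P. \<forall>(a', b')\<in>P. a \<le> a' \<and> b \<le> b' \<or> a' \<le> a \<and> b' \<le> b)"

lemma is_chain_staircase:
  assumes "sorted xs" "sorted ys" "P \<in> staircases xs ys"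
  shows "is_chain P"
  using assms
proof (induction xs ys arbitrary: P rule: staircases.induct)
  case (4 x xs y ys)
  then obtain P' where P: "P = insert (x, y) P'"
    and P': "P' \<in> staircases xs (y # ys) \<or> P' \<in> staircases (x # xs) ys" by auto
  have "is_chain P'" using P' 4 by auto
  moreover have "x \<le> a \<and> y \<le> b" if "(a, b) \<in> P'" for a b
    using P' staircase_subset[of P' xs "y # ys"] staircase_subset[of P' "x # xs" ys] 4(3,4) that by auto
  ultimately show ?case unfolding P is_chain_def by blast
qed (auto simp: is_chain_def)

text \<open>The north-west corner rule.\<close>

lemma staircase_coupling:
  fixes \<alpha> :: "'a \<Rightarrow> real" and \<beta> :: "'b \<Rightarrow> real"
  assumes "distinct xs" "distinct ys" "\<forall>x\<in>set xs. 0 \<le> \<alpha> x" "\<forall>y\<in>set ys. 0 \<le> \<beta> y"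
    and "sum \<alpha> (set xs) = sum \<beta> (set ys)" "xs \<noteq> []" "ys \<noteq> [] \<or> length xs = 1"
  shows "\<exists>P\<in>staircases xs ys. \<exists>\<pi>. (\<forall>a. 0 \<le> \<pi> a) \<and> {a. \<pi> a \<noteq> 0} \<subseteq> P \<and>
    (\<forall>x\<in>set xs. (\<Sum>y\<in>set ys. \<pi> (x, y)) = \<alpha> x) \<and> (\<forall>y\<in>set ys. (\<Sum>x\<in>set xs. \<pi> (x, y)) = \<beta> y)"
  using assms
proof (induction xs ys arbitrary: \<alpha> \<beta> rule: staircases.induct)
  case (2 x)
  then show ?case by (auto intro!: exI[of _ "\<lambda>_. 0"])
next
  case (4 x xs y ys)
  note prems = 4(3-)
  have nn: "0 \<le> \<alpha> x" "0 \<le> \<beta> y" "0 \<le> sum \<alpha> (set xs)" "0 \<le> sum \<beta> (set ys)"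
    using prems by (auto intro!: sum_nonneg)
  have tot: "\<alpha> x + sum \<alpha> (set xs) = \<beta> y + sum \<beta> (set ys)"
    using prems by simp
  have xn: "x \<notin> set xs" and yn: "y \<notin> set ys" using prems by auto
  show ?case
  \<comment> \<open>The pair \<open>(x, y)\<close> receives the smaller of the two masses, and the
    line that is used up is dropped. The last \<open>x\<close> is never dropped, since a path has to
    end with exactly one \<open>x\<close> left; equality of the totals makes this
    consistent.\<close>
  proof (cases "xs \<noteq> [] \<and> \<alpha> x \<le> \<beta> y")
    case True
    define \<beta>' where "\<beta>' = \<beta>(y := \<beta> y - \<alpha> x)"
    have "sum \<beta>' (set ys) = sum \<beta> (set ys)" using yn by (intro sum.cong) (auto simp: \<beta>'_def)
    then have "sum \<alpha> (set xs) = sum \<beta>' (set (y # ys))" using tot yn by (simp add: \<beta>'_def)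
    moreover have "\<forall>y\<in>set (y # ys). 0 \<le> \<beta>' y" using prems True by (auto simp: \<beta>'_def)
    ultimately have "\<exists>P\<in>staircases xs (y # ys). \<exists>\<pi>. (\<forall>a. 0 \<le> \<pi> a) \<and> {a. \<pi> a \<noteq> 0} \<subseteq> P \<and>
        (\<forall>x\<in>set xs. (\<Sum>y\<in>set (y # ys). \<pi> (x, y)) = \<alpha> x) \<and>
        (\<forall>b\<in>set (y # ys). (\<Sum>x\<in>set xs. \<pi> (x, b)) = \<beta>' b)"
      using prems True by (intro 4(1)) auto
    then obtain P \<pi> where P: "P \<in> staircases xs (y # ys)" and \<pi>: "\<And>a. 0 \<le> \<pi> a" "{a. \<pi> a \<noteq> 0} \<subseteq> P"
      "\<And>x. x \<in> set xs \<Longrightarrow> (\<Sum>y\<in>set (y # ys). \<pi> (x, y)) = \<alpha> x"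
      "\<And>b. b \<in> set (y # ys) \<Longrightarrow> (\<Sum>x\<in>set xs. \<pi> (x, b)) = \<beta>' b"
      by blast
    have zero: "\<pi> (x, b) = 0" for b
      using \<pi>(2) staircase_subset[OF P] xn by auto
    define \<pi>' where "\<pi>' = \<pi>((x, y) := \<alpha> x)"
    show ?thesis
    proof (intro bexI exI conjI)
      show "insert (x, y) P \<in> staircases (x # xs) (y # ys)" using P by simp
      show "\<forall>a. 0 \<le> \<pi>' a" using \<pi>(1) nn by (simp add: \<pi>'_def)
      show "{a. \<pi>' a \<noteq> 0} \<subseteq> insert (x, y) P" using \<pi>(2) by (auto simp: \<pi>'_def)
      show "\<forall>a\<in>set (x # xs). (\<Sum>b\<in>set (y # ys). \<pi>' (a, b)) = \<alpha> a"
      proof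
        fix a assume a: "a \<in> set (x # xs)"
        show "(\<Sum>b\<in>set (y # ys). \<pi>' (a, b)) = \<alpha> a"
        proof (cases "a = x")
          case True
          have "(\<Sum>b\<in>set ys. \<pi>' (x, b)) = 0" using zero yn by (intro sum.neutral) (auto simp: \<pi>'_def)
          then show ?thesis using True yn by (simp add: \<pi>'_def)
        next
          case False
          then show ?thesis using a \<pi>(3)[of a] by (simp add: \<pi>'_def)
        qed
      qed
      show "\<forall>b\<in>set (y # ys). (\<Sum>a\<in>set (x # xs). \<pi>' (a, b)) = \<beta> b"
      proof
        fix b assume b: "b \<in> set (y # ys)"
        have "(\<Sum>a\<in>set xs. \<pi>' (a, b)) = (\<Sum>a\<in>set xs. \<pi> (a, b))"
          using xn by (intro sum.cong) (auto simp: \<pi>'_def)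
        also have "\<dots> = \<beta>' b" using \<pi>(4)[OF b] .
        finally show "(\<Sum>a\<in>set (x # xs). \<pi>' (a, b)) = \<beta> b"
          using xn zero by (simp add: \<pi>'_def \<beta>'_def)
      qed
    qed
  next
    case False
    have le: "\<beta> y \<le> \<alpha> x" using False tot nn by auto
    have len: "ys \<noteq> [] \<or> length (x # xs) = 1"
    proof (rule ccontr)
      assume "\<not> ?thesis"
      then have "ys = []" "xs \<noteq> []" by auto
      then show False using False tot nn by auto
    qed
    define \<alpha>' where "\<alpha>' = \<alpha>(x := \<alpha> x - \<beta> y)"
    have "sum \<alpha>' (set xs) = sum \<alpha> (set xs)" using xn by (intro sum.cong) (auto simp: \<alpha>'_def)
    then have "sum \<alpha>' (set (x # xs)) = sum \<beta> (set ys)" using tot xn by (simp add: \<alpha>'_def)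
    moreover have "\<forall>a\<in>set (x # xs). 0 \<le> \<alpha>' a" using prems le by (auto simp: \<alpha>'_def)
    ultimately have "\<exists>P\<in>staircases (x # xs) ys. \<exists>\<pi>. (\<forall>a. 0 \<le> \<pi> a) \<and> {a. \<pi> a \<noteq> 0} \<subseteq> P \<and>
        (\<forall>a\<in>set (x # xs). (\<Sum>y\<in>set ys. \<pi> (a, y)) = \<alpha>' a) \<and>
        (\<forall>b\<in>set ys. (\<Sum>x\<in>set (x # xs). \<pi> (x, b)) = \<beta> b)"
      using prems len by (intro 4(2)) auto
    then obtain P \<pi> where P: "P \<in> staircases (x # xs) ys" and \<pi>: "\<And>a. 0 \<le> \<pi> a" "{a. \<pi> a \<noteq> 0} \<subseteq> P"
      "\<And>a. a \<in> set (x # xs) \<Longrightarrow> (\<Sum>y\<in>set ys. \<pi> (a, y)) = \<alpha>' a"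
      "\<And>b. b \<in> set ys \<Longrightarrow> (\<Sum>x\<in>set (x # xs). \<pi> (x, b)) = \<beta> b"
      by blast
    have zero: "\<pi> (a, y) = 0" for a
      using \<pi>(2) staircase_subset[OF P] yn by auto
    define \<pi>' where "\<pi>' = \<pi>((x, y) := \<beta> y)"
    show ?thesis
    proof (intro bexI exI conjI)
      show "insert (x, y) P \<in> staircases (x # xs) (y # ys)" using P by simp
      show "\<forall>a. 0 \<le> \<pi>' a" using \<pi>(1) nn by (simp add: \<pi>'_def)
      show "{a. \<pi>' a \<noteq> 0} \<subseteq> insert (x, y) P" using \<pi>(2) by (auto simp: \<pi>'_def)
      show "\<forall>b\<in>set (y # ys). (\<Sum>a\<in>set (x # xs). \<pi>' (a, b)) = \<beta> b"
      proof
        fix b assume b: "b \<in> set (y # ys)"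
        show "(\<Sum>a\<in>set (x # xs). \<pi>' (a, b)) = \<beta> b"
        proof (cases "b = y")
          case True
          have "(\<Sum>a\<in>set xs. \<pi>' (a, y)) = 0" using zero xn by (intro sum.neutral) (auto simp: \<pi>'_def)
          then show ?thesis using True xn by (simp add: \<pi>'_def)
        next
          case False
          then show ?thesis using b \<pi>(4)[of b] by (simp add: \<pi>'_def)
        qed
      qed
      show "\<forall>a\<in>set (x # xs). (\<Sum>b\<in>set (y # ys). \<pi>' (a, b)) = \<alpha> a"
      proof
        fix a assume a: "a \<in> set (x # xs)"
        have "(\<Sum>b\<in>set ys. \<pi>' (a, b)) = (\<Sum>b\<in>set ys. \<pi> (a, b))"
          using yn by (intro sum.cong) (auto simp: \<pi>'_def)
        also have "\<dots> = \<alpha>' a" using \<pi>(3)[OF a] .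
        finally show "(\<Sum>b\<in>set (y # ys). \<pi>' (a, b)) = \<alpha> a"
          using yn zero by (simp add: \<pi>'_def \<alpha>'_def)
      qed
    qed
  qed
qed auto

text \<open>The joint distribution function of a comonotone coupling is the minimum of the marginal
  ones. If the row sum and the column sum both exceeded \<open>?H\<close>, there would be mass at
  some \<open>(a, b)\<close> with \<open>a \<le> x\<close>, \<open>b > y\<close> and at some
  \<open>(a', b')\<close> with \<open>a' > x\<close>, \<open>b' \<le> y\<close>, and these two pairs
  are incomparable.\<close>

lemma chain_coupling_cumulative:
  fixes \<pi> :: "'a::linorder \<times> 'b::linorder \<Rightarrow> real"
  assumes fin: "finite A" "finite B" and nn: "\<And>a. 0 \<le> \<pi> a" and chain: "is_chain {a. \<pi> a \<noteq> 0}"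
  shows "(\<Sum>a\<in>{a\<in>A. a \<le> x}. \<Sum>b\<in>{b\<in>B. b \<le> y}. \<pi> (a, b)) =
    min (\<Sum>a\<in>{a\<in>A. a \<le> x}. \<Sum>b\<in>B. \<pi> (a, b)) (\<Sum>b\<in>{b\<in>B. b \<le> y}. \<Sum>a\<in>A. \<pi> (a, b))"
    (is "?H = min ?R ?S")
proof -
  have "?H \<le> ?R" using fin nn by (intro sum_mono sum_mono2) auto
  moreover have "?H \<le> ?S"
    by (subst sum.swap) (use fin nn in \<open>intro sum_mono sum_mono2; auto\<close>)
  moreover have "?R = ?H \<or> ?S = ?H"
  proof (cases "\<exists>a b. \<pi> (a, b) \<noteq> 0 \<and> a \<le> x \<and> \<not> b \<le> y")
    case True
    then obtain a b where ab: "\<pi> (a, b) \<noteq> 0" "a \<le> x" "\<not> b \<le> y" by blast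
    have "\<pi> (a', b') = 0" if "b' \<le> y" "\<not> a' \<le> x" for a' b'
      using chain ab that unfolding is_chain_def by fastforce
    then have "?S = (\<Sum>b\<in>{b\<in>B. b \<le> y}. \<Sum>a\<in>{a\<in>A. a \<le> x}. \<pi> (a, b))"
      using fin by (intro sum.cong sum.mono_neutral_right) auto
    then show ?thesis by (subst (asm) sum.swap) simp
  next
    case False
    then have "?R = ?H"
      using fin by (intro sum.cong sum.mono_neutral_right) auto
    then show ?thesis ..
  qed
  ultimately show ?thesis by linarith
qed

text \<open>Equal marginals give equal joint distribution functions. At the lexicographically least
  pair where the couplings differ, all other terms of the two cumulative sums agree, so the terms at
  that pair agree as well.\<close>

lemma chain_coupling_unique:
  fixes \<pi> \<pi>' :: "'a::linorder \<times> 'b::linorder \<Rightarrow> real"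
  assumes fin: "finite A" "finite B"
    and nn: "\<And>a. 0 \<le> \<pi> a" "\<And>a. 0 \<le> \<pi>' a"
    and chain: "is_chain {a. \<pi> a \<noteq> 0}" "is_chain {a. \<pi>' a \<noteq> 0}"
    and supp: "{a. \<pi> a \<noteq> 0} \<subseteq> A \<times> B" "{a. \<pi>' a \<noteq> 0} \<subseteq> A \<times> B"
    and row: "\<And>a. a \<in> A \<Longrightarrow> (\<Sum>b\<in>B. \<pi> (a, b)) = (\<Sum>b\<in>B. \<pi>' (a, b))"
    and col: "\<And>b. b \<in> B \<Longrightarrow> (\<Sum>a\<in>A. \<pi> (a, b)) = (\<Sum>a\<in>A. \<pi>' (a, b))"
  shows "\<pi> = \<pi>'"
proof (rule ccontr)
  assume "\<pi> \<noteq> \<pi>'"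
  define S where "S = {a. \<pi> a \<noteq> \<pi>' a}"
  have SAB: "S \<subseteq> A \<times> B"
  proof
    fix a assume "a \<in> S"
    then have "\<pi> a \<noteq> 0 \<or> \<pi>' a \<noteq> 0" by (auto simp: S_def)
    then show "a \<in> A \<times> B" using supp by blast
  qed
  have S: "finite S" "S \<noteq> {}"
    using SAB fin \<open>\<pi> \<noteq> \<pi>'\<close> finite_subset by (blast, auto simp: S_def fun_eq_iff)
  define x where "x = Min (fst ` S)"
  have xS: "x \<in> fst ` S" and xmin: "\<And>s. s \<in> S \<Longrightarrow> x \<le> fst s"
    using S by (auto simp: x_def)
  define Y where "Y = {b. (x, b) \<in> S}"
  have Y: "finite Y" "Y \<noteq> {}"
  proof -
    show "finite Y" using SAB fin(2) by (rule_tac finite_subset[of Y B]) (auto simp: Y_def)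
    show "Y \<noteq> {}" using xS by (auto simp: Y_def)
  qed
  define y where "y = Min Y"
  have yY: "y \<in> Y" and ymin: "\<And>b. b \<in> Y \<Longrightarrow> y \<le> b" using Y by (auto simp: y_def)
  have xy: "(x, y) \<in> S" "x \<in> A" "y \<in> B" using yY SAB by (auto simp: Y_def)
  let ?A = "{a\<in>A. a \<le> x}" and ?B = "{b\<in>B. b \<le> y}"
  have "(\<Sum>a\<in>?A. \<Sum>b\<in>?B. \<pi> (a, b)) = (\<Sum>a\<in>?A. \<Sum>b\<in>?B. \<pi>' (a, b))"
    using row col by (simp add: chain_coupling_cumulative[OF fin nn(1) chain(1)]
        chain_coupling_cumulative[OF fin nn(2) chain(2)])
  then have "(\<Sum>a\<in>?A. \<Sum>b\<in>?B. \<pi> (a, b) - \<pi>' (a, b)) = 0"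
    by (simp add: sum_subtractf)
  moreover have "(\<Sum>a\<in>?A. \<Sum>b\<in>?B. \<pi> (a, b) - \<pi>' (a, b)) = (\<Sum>a\<in>?A. if a = x then \<pi> (x, y) - \<pi>' (x, y) else 0)"
  proof (rule sum.cong[OF refl])
    fix a assume a: "a \<in> ?A"
    show "(\<Sum>b\<in>?B. \<pi> (a, b) - \<pi>' (a, b)) = (if a = x then \<pi> (x, y) - \<pi>' (x, y) else 0)"
    proof (cases "a = x")
      case True
      have "(\<Sum>b\<in>?B. \<pi> (a, b) - \<pi>' (a, b)) = (\<Sum>b\<in>?B. if b = y then \<pi> (x, y) - \<pi>' (x, y) else 0)"
        using ymin True by (intro sum.cong) (force simp: Y_def S_def)+
      then show ?thesis using True fin xy by simp
    next
      case False
      have "\<pi> (a, b) = \<pi>' (a, b)" for b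
      proof (rule ccontr)
        assume "\<pi> (a, b) \<noteq> \<pi>' (a, b)"
        then have "x \<le> a" using xmin[of "(a, b)"] by (simp add: S_def)
        then show False using False a by simp
      qed
      then show ?thesis using False by simp
    qed
  qed
  ultimately show False using fin xy by (simp add: S_def)
qed

section \<open>The product construction\<close>

lemma cube_complex_cover:
  assumes "cube_complex d F" and p: "\<forall>j<d. 0 \<le> p j \<and> p j \<le> 1"
  shows "\<exists>C\<in>F. \<exists>w. weights d p w \<and> {v. w v \<noteq> 0} \<subseteq> C"
  by (rule assms(1)[unfolded cube_complex_def, THEN conjunct2, THEN conjunct2, THEN conjunct1, THEN spec, THEN mp, OF p])

lemma cube_complex_unique:
  assumes "cube_complex d F" "C \<in> F" "C' \<in> F" "weights d p w" "weights d p w'"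
    "{v. w v \<noteq> 0} \<subseteq> C" "{v. w' v \<noteq> 0} \<subseteq> C'"
  shows "w = w'"
  by (rule assms(1)[unfolded cube_complex_def, THEN conjunct2, THEN conjunct2, THEN conjunct2, rule_format, OF assms(2-)])

lemma prism_complex_cover:
  assumes "prism_complex k m F"
    and p: "\<forall>j<k. 0 \<le> p j \<and> p j \<le> 1" and \<mu>: "\<forall>i<m. 0 \<le> \<mu> i" "(\<Sum>i<m. \<mu> i) = 1"
  shows "\<exists>C\<in>F. \<exists>w. prism_weights k m p \<mu> w \<and> {a. w a \<noteq> 0} \<subseteq> C \<and>
    (\<forall>i<m. \<mu> i = 0 \<longrightarrow> card (colour_class C i) = 1)"
  by (rule assms(1)[unfolded prism_complex_def, THEN conjunct2, THEN conjunct2, THEN conjunct1,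
        THEN spec, THEN spec, THEN mp, THEN mp, THEN mp, OF p \<mu>])

lemma prism_complex_unique:
  assumes "prism_complex k m F" "C \<in> F" "C' \<in> F" "prism_weights k m p \<mu> w" "prism_weights k m p \<mu> w'"
    "(\<Sum>i<m. \<mu> i) = 1" "{a. w a \<noteq> 0} \<subseteq> C" "{a. w' a \<noteq> 0} \<subseteq> C'"
  shows "w = w'"
  by (rule assms(1)[unfolded prism_complex_def, THEN conjunct2, THEN conjunct2, THEN conjunct2, rule_format, OF assms(2-)])

text \<open>The binary digits of \<open>v\<close> become the first \<open>k\<close> coordinates and
  those of \<open>u\<close> the following ones, so that \<open>glue k\<close> identifies pairs of
  vertices of two cubes with the vertices of their product.\<close>

definition glue :: "nat \<Rightarrow> nat \<times> nat \<Rightarrow> nat" where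
  "glue k a = fst a + 2 ^ k * snd a"

lemma glue_simps [simp]: "v < 2 ^ k \<Longrightarrow> glue k (v, u) mod 2 ^ k = v" "v < 2 ^ k \<Longrightarrow> glue k (v, u) div 2 ^ k = u"
  by (simp_all add: glue_def)

lemma bit_glue: "v < 2 ^ k \<Longrightarrow> bit (glue k (v, u)) j = (if j < k then bit v j else bit u (j - k))"
proof -
  assume v: "v < 2 ^ k"
  have "bit (glue k (v, u)) j = bit (concat_bit k (int v) (int u)) j"
  proof -
    have "concat_bit k (int v) (int u) = int (glue k (v, u))"
      using v by (simp add: concat_bit_eq take_bit_eq_mod push_bit_eq_mult glue_def mult.commute)
    then show ?thesis by (simp add: bit_of_nat_iff)
  qed
  then show ?thesis by (simp add: bit_concat_bit_iff bit_of_nat_iff)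
qed

lemma bij_betw_glue: "bij_betw (glue k) ({..<2 ^ k} \<times> {..<2 ^ n}) {..<2 ^ (k + n)}"
proof (rule bij_betw_byWitness[where f' = "\<lambda>x::nat. (x mod 2 ^ k, x div 2 ^ k)"])
  show "glue k ` ({..<2 ^ k} \<times> {..<2 ^ n}) \<subseteq> {..<2 ^ (k + n)}"
  proof
    fix x assume "x \<in> glue k ` ({..<2 ^ k} \<times> {..<2 ^ n})"
    then obtain v u where "v < 2 ^ k" "u < 2 ^ n" and x: "x = glue k (v, u)" by auto
    then have "Suc u \<le> 2 ^ n" by simp
    from \<open>v < 2 ^ k\<close>
    have "v + 2 ^ k * u < 2 ^ k * Suc u" by simp
    also have "\<dots> \<le> 2 ^ k * 2 ^ n" using \<open>Suc u \<le> 2 ^ n\<close> by (intro mult_left_mono) auto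
    finally show "x \<in> {..<2 ^ (k + n)}" by (simp add: x glue_def power_add)
  qed
  show "(\<lambda>x::nat. (x mod 2 ^ k, x div 2 ^ k)) ` {..<2 ^ (k + n)} \<subseteq> {..<2 ^ k} \<times> {..<2 ^ n}"
    by (auto simp: power_add less_mult_imp_div_less mult.commute)
qed (auto simp: glue_def)

lemma sum_glue: "(\<Sum>x<2 ^ (k + n). f x) = (\<Sum>v<2 ^ k. \<Sum>u<2 ^ n. f (glue k (v, u)))"
  using sum.reindex_bij_betw[OF bij_betw_glue[of k n], of f]
  by (simp add: sum.cartesian_product split_def)

lemma sum_colour_split:
  fixes f :: "nat \<Rightarrow> real" and c :: "nat \<Rightarrow> nat"
  assumes "\<forall>u<N. c u < m"
  shows "(\<Sum>u<N. f u) = (\<Sum>i<m. \<Sum>u\<in>{u. u < N \<and> c u = i}. f u)"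
proof -
  have "c ` {..<N} \<subseteq> {..<m}" using assms by auto
  from sum.group[OF finite_lessThan finite_lessThan this, of f] show ?thesis by simp
qed

section \<open>The cells of the product and their number\<close>

definition colour_staircases :: "(nat \<times> nat) set \<Rightarrow> nat set \<Rightarrow> (nat \<Rightarrow> nat) \<Rightarrow> nat \<Rightarrow> (nat \<times> nat) set set" where
  "colour_staircases \<tau> \<sigma> c i =
     staircases (sorted_list_of_set (colour_class \<tau> i)) (sorted_list_of_set {u\<in>\<sigma>. c u = i})"

text \<open>The colouring extends to an affine map from \<sigma> to the simplex of colours. The
  preimage of a prism cell \<tau> in the product of the k-cube and \<sigma> is spanned by the pairs
  \<open>(v, u)\<close> with \<open>(v, c u) \<in> \<tau>\<close>, that is, by one product of two
  simplices for each colour. Each of these is triangulated by staircases, independently of the other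
  colours.\<close>

definition product_cells :: "nat \<Rightarrow> nat \<Rightarrow> (nat \<times> nat) set set \<Rightarrow> nat set set \<Rightarrow> (nat \<Rightarrow> nat) \<Rightarrow> nat set set" where
  "product_cells k m T F c = (\<lambda>(\<sigma>, \<tau>, f). glue k ` (\<Union>i<m. f i)) `
     (SIGMA \<sigma>:F. SIGMA \<tau>:T. PiE {..<m} (colour_staircases \<tau> \<sigma> c))"

context
  fixes k m n :: nat and T :: "(nat \<times> nat) set set" and F :: "nat set set" and c :: "nat \<Rightarrow> nat"
  assumes T: "prism_complex k m T" and F: "cube_complex n F" and c: "\<forall>u<2 ^ n. c u < m"
begin

lemma finite_TF: "finite T" "finite F"
  using T F by (auto simp: prism_complex_def cube_complex_def)

lemma T_cell:
  assumes "\<tau> \<in> T"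
  shows "\<tau> \<subseteq> {..<2 ^ k} \<times> {..<m}" "card \<tau> = k + m" "finite \<tau>"
    "i < m \<Longrightarrow> colour_class \<tau> i \<noteq> {}" "colour_class \<tau> i \<subseteq> {..<2 ^ k}" "finite (colour_class \<tau> i)"
proof -
  show 1: "\<tau> \<subseteq> {..<2 ^ k} \<times> {..<m}" "card \<tau> = k + m"  "i < m \<Longrightarrow> colour_class \<tau> i \<noteq> {}"
    using T assms by (auto simp: prism_complex_def prism_vertices_def)
  show "finite \<tau>" using 1(1) finite_subset by blast
  show "colour_class \<tau> i \<subseteq> {..<2 ^ k}" using 1(1) by (auto simp: colour_class_def)
  then show "finite (colour_class \<tau> i)" using finite_subset by blast
qed

lemma F_cell:
  assumes "\<sigma> \<in> F"
  shows "\<sigma> \<subseteq> {..<2 ^ n}" "card \<sigma> = n + 1" "finite \<sigma>"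
  using F assms finite_subset by (auto simp: cube_complex_def)

lemma colour_staircases_subset:
  assumes "\<tau> \<in> T" "\<sigma> \<in> F" "P \<in> colour_staircases \<tau> \<sigma> c i"
  shows "P \<subseteq> colour_class \<tau> i \<times> {u\<in>\<sigma>. c u = i}"
  using staircase_subset[OF assms(3)[unfolded colour_staircases_def]] T_cell(6)[OF assms(1)] F_cell(3)[OF assms(2)]
  by simp

lemma finite_product_cells: "finite (product_cells k m T F c)"
  unfolding product_cells_def
  by (intro finite_imageI finite_SigmaI finite_TF finite_PiE) (auto simp: colour_staircases_def finite_staircases)

lemma card_product_cells:
  "card (product_cells k m T F c) \<le>
    (\<Sum>\<sigma>\<in>F. \<Sum>\<tau>\<in>T. \<Prod>i<m. staircase_count (card (colour_class \<tau> i)) (card {u\<in>\<sigma>. c u = i}))"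
proof -
  let ?S = "SIGMA \<sigma>:F. SIGMA \<tau>:T. PiE {..<m} (colour_staircases \<tau> \<sigma> c)"
  have fin: "finite (PiE {..<m} (colour_staircases \<tau> \<sigma> c))" for \<tau> \<sigma>
    by (intro finite_PiE) (auto simp: colour_staircases_def finite_staircases)
  have "card (product_cells k m T F c) \<le> card ?S"
    unfolding product_cells_def by (intro card_image_le finite_SigmaI finite_TF fin)
  also have "card ?S = (\<Sum>\<sigma>\<in>F. \<Sum>\<tau>\<in>T. card (PiE {..<m} (colour_staircases \<tau> \<sigma> c)))"
    using finite_TF fin by (simp add: card_SigmaI finite_SigmaI)
  also have "\<dots> \<le> (\<Sum>\<sigma>\<in>F. \<Sum>\<tau>\<in>T. \<Prod>i<m. staircase_count (card (colour_class \<tau> i)) (card {u\<in>\<sigma>. c u = i}))"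
  proof (intro sum_mono)
    fix \<sigma> \<tau>
    have "card (PiE {..<m} (colour_staircases \<tau> \<sigma> c)) = (\<Prod>i<m. card (colour_staircases \<tau> \<sigma> c i))"
      by (simp add: card_PiE)
    also have "\<dots> \<le> (\<Prod>i<m. staircase_count (card (colour_class \<tau> i)) (card {u\<in>\<sigma>. c u = i}))"
    proof (intro prod_mono conjI)
      fix i
      show "card (colour_staircases \<tau> \<sigma> c i) \<le> staircase_count (card (colour_class \<tau> i)) (card {u\<in>\<sigma>. c u = i})"
        using card_staircases_le[of "sorted_list_of_set (colour_class \<tau> i)" "sorted_list_of_set {u\<in>\<sigma>. c u = i}"]
        by (simp add: colour_staircases_def)
    qed simp
    finally show "card (PiE {..<m} (colour_staircases \<tau> \<sigma> c)) \<le> \<dots>" .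
  qed
  finally show ?thesis .
qed

lemma sum_card_colour:
  assumes "\<tau> \<in> T" "\<sigma> \<in> F"
  shows "(\<Sum>i<m. card (colour_class \<tau> i)) = k + m" "(\<Sum>i<m. card {u\<in>\<sigma>. c u = i}) = n + 1"
proof -
  have "card \<tau> = (\<Sum>i<m. card {a\<in>\<tau>. snd a = i})"
    using sum.group[of \<tau> "{..<m}" snd "\<lambda>_. 1::nat"] T_cell(1,3)[OF assms(1)] by fastforce
  moreover have "card {a\<in>\<tau>. snd a = i} = card (colour_class \<tau> i)" for i
    by (rule bij_betw_same_card[of fst]) (auto simp: bij_betw_def inj_on_def colour_class_def image_iff)
  ultimately show "(\<Sum>i<m. card (colour_class \<tau> i)) = k + m" using T_cell(2)[OF assms(1)] by simp
  have "c ` \<sigma> \<subseteq> {..<m}" using c F_cell(1)[OF assms(2)] by auto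
  then have "card \<sigma> = (\<Sum>i<m. card {u\<in>\<sigma>. c u = i})"
    using sum.group[of \<sigma> "{..<m}" c "\<lambda>_. 1::nat"] F_cell(3)[OF assms(2)] by simp
  then show "(\<Sum>i<m. card {u\<in>\<sigma>. c u = i}) = n + 1" using F_cell(2)[OF assms(2)] by simp
qed

lemma product_cell:
  assumes "C \<in> product_cells k m T F c"
  shows "C \<subseteq> {..<2 ^ (k + n)} \<and> card C = k + n + 1"
proof -
  obtain \<sigma> \<tau> f where \<sigma>: "\<sigma> \<in> F" and \<tau>: "\<tau> \<in> T" and f: "\<And>i. i < m \<Longrightarrow> f i \<in> colour_staircases \<tau> \<sigma> c i"
    and C: "C = glue k ` (\<Union>i<m. f i)"
    using assms by (auto simp: product_cells_def PiE_def)
  have fsub: "f i \<subseteq> colour_class \<tau> i \<times> {u\<in>\<sigma>. c u = i}" if "i < m" for i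
    using colour_staircases_subset[OF \<tau> \<sigma> f[OF that]] .
  have sub: "(\<Union>i<m. f i) \<subseteq> {..<2 ^ k} \<times> {..<2 ^ n}"
    using fsub T_cell(5)[OF \<tau>] F_cell(1)[OF \<sigma>] by fastforce
  have fin: "finite (f i)" if "i < m" for i
    using fsub[OF that] T_cell(6)[OF \<tau>, of i] F_cell(3)[OF \<sigma>]
    by (auto intro: finite_subset)
  have inj: "inj_on (glue k) (\<Union>i<m. f i)" using bij_betw_glue sub by (meson bij_betw_def inj_on_subset)
  have cf: "card (f i) + 1 = card (colour_class \<tau> i) + card {u\<in>\<sigma>. c u = i}" if "i < m" for i
    using card_staircase[OF _ _ f[OF that, unfolded colour_staircases_def]] by simp
  have "card C = card (\<Union>i<m. f i)" using C inj card_image by blast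
  also have "\<dots> = (\<Sum>i<m. card (f i))"
    using fin fsub by (intro card_UN_disjoint) (auto, blast)
  \<comment> \<open>A staircase has one pair less than its two vertex lists have entries together,
    so one is lost for each of the \<open>m\<close> colours. This turns
    \<open>(k + m) + (n + 1)\<close> into \<open>k + n + 1\<close>.\<close>
  finally have "card C + m = (\<Sum>i<m. card (f i) + 1)" by (subst sum.distrib) simp
  also have "\<dots> = (\<Sum>i<m. card (colour_class \<tau> i) + card {u\<in>\<sigma>. c u = i})"
    using cf by simp
  also have "\<dots> = (k + m) + (n + 1)" using sum_card_colour[OF \<tau> \<sigma>] by (simp add: sum.distrib)
  finally have "card C = k + n + 1" by simp
  moreover have "C \<subseteq> {..<2 ^ (k + n)}"
    using C sub bij_betw_glue[of k n] by (auto simp: bij_betw_def)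
  ultimately show ?thesis by simp
qed

text \<open>The last \<open>n\<close> coordinates select \<sigma> with weights \<open>l\<close>. The
  mass of \<open>l\<close> on each colour is a point \<mu> of the simplex, and \<open>p\<close>
  together with \<mu> selects \<tau> with weights \<open>w\<close>. For every colour
  \<open>i\<close>, the weights \<open>w (v, i)\<close> and the part of \<open>l\<close> of colour
  \<open>i\<close> have the same total \<open>\<mu> i\<close> and can therefore be coupled along a
  staircase.\<close>

lemma product_cells_cover:
  assumes p: "\<forall>j<k+n. 0 \<le> p j \<and> p j \<le> 1"
  shows "\<exists>C\<in>product_cells k m T F c. \<exists>w. weights (k + n) p w \<and> {v. w v \<noteq> 0} \<subseteq> C"
proof -
  define q where "q j = p (k + j)" for j
  have "\<forall>j<n. 0 \<le> q j \<and> q j \<le> 1" using p by (auto simp: q_def)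
  then obtain \<sigma> l where \<sigma>: "\<sigma> \<in> F" and l: "weights n q l" and lsub: "{u. l u \<noteq> 0} \<subseteq> \<sigma>"
    using cube_complex_cover[OF F, of q] by blast
  have l0: "0 \<le> l u" for u using l by (simp add: weights_def)
  define \<mu> where "\<mu> i = (\<Sum>u\<in>{u. u < 2 ^ n \<and> c u = i}. l u)" for i
  have "(\<Sum>i<m. \<mu> i) = 1" using sum_colour_split[OF c, of l] l by (simp add: \<mu>_def weights_def)
  moreover have "\<forall>i<m. 0 \<le> \<mu> i" using l0 by (auto simp: \<mu>_def intro: sum_nonneg)
  moreover have "\<forall>j<k. 0 \<le> p j \<and> p j \<le> 1" using p by auto
  ultimately obtain \<tau> w where \<tau>: "\<tau> \<in> T" and w: "prism_weights k m p \<mu> w" and wsub: "{a. w a \<noteq> 0} \<subseteq> \<tau>"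
    and one: "\<forall>i<m. \<mu> i = 0 \<longrightarrow> card (colour_class \<tau> i) = 1"
    using prism_complex_cover[OF T, of p \<mu>] by blast
  have w0: "0 \<le> w a" for a using w unfolding prism_weights_def by blast
  define coupling where "coupling i P \<pi> \<longleftrightarrow> P \<in> colour_staircases \<tau> \<sigma> c i \<and>
      (\<forall>a. 0 \<le> \<pi> a) \<and> {a. \<pi> a \<noteq> 0} \<subseteq> P \<and>
      (\<forall>v\<in>colour_class \<tau> i. (\<Sum>u\<in>{u\<in>\<sigma>. c u = i}. \<pi> (v, u)) = w (v, i)) \<and>
      (\<forall>u\<in>{u\<in>\<sigma>. c u = i}. (\<Sum>v\<in>colour_class \<tau> i. \<pi> (v, u)) = l u)" for i P \<pi>
  have "\<exists>P \<pi>. coupling i P \<pi>" if i: "i < m" for i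
  proof -
    let ?xs = "sorted_list_of_set (colour_class \<tau> i)" and ?ys = "sorted_list_of_set {u\<in>\<sigma>. c u = i}"
    have set: "set ?xs = colour_class \<tau> i" "set ?ys = {u\<in>\<sigma>. c u = i}"
      using T_cell(6)[OF \<tau>] F_cell(3)[OF \<sigma>] by auto
    have "(\<Sum>v\<in>colour_class \<tau> i. w (v, i)) = (\<Sum>v<2 ^ k. w (v, i))"
      using T_cell(5)[OF \<tau>] wsub by (intro sum.mono_neutral_left) (auto simp: colour_class_def)
    also have "\<dots> = \<mu> i" using w i by (simp add: prism_weights_def)
    finally have 1: "(\<Sum>v\<in>colour_class \<tau> i. w (v, i)) = \<mu> i" .
    have 2: "\<mu> i = (\<Sum>u\<in>{u\<in>\<sigma>. c u = i}. l u)"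
      unfolding \<mu>_def using F_cell[OF \<sigma>] lsub by (intro sum.mono_neutral_right) auto
    have 3: "?xs \<noteq> []" using T_cell(4,6)[OF \<tau>] i by simp
    \<comment> \<open>If \<sigma> lacks the colour \<open>i\<close>, then
      \<open>\<mu> i = 0\<close>, and the restriction clause of \<open>prism_complex\<close> leaves
      a single vertex of that colour in \<tau>. The empty path is then available.\<close>
    have 4: "?ys \<noteq> [] \<or> length ?xs = 1"
    proof (cases "?ys = []")
      case True
      then have "{u\<in>\<sigma>. c u = i} = {}" using set(2) unfolding True by simp
      then have "\<mu> i = 0" using 2 by (simp only: sum.empty)
      then show ?thesis using one i by simp
    qed simp
    have sums: "(\<Sum>v\<in>set ?xs. w (v, i)) = sum l (set ?ys)" using 1 2 set by simp
    show ?thesis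
      using staircase_coupling[OF distinct_sorted_list_of_set distinct_sorted_list_of_set _ _ sums 3 4]
      unfolding coupling_def colour_staircases_def set by (simp add: w0 l0 Bex_def)
  qed
  then obtain P \<pi> where "\<And>i. i < m \<Longrightarrow> coupling i (P i) (\<pi> i)" by metis
  then have P: "\<And>i. i < m \<Longrightarrow> P i \<in> colour_staircases \<tau> \<sigma> c i"
    and \<pi>0: "\<And>i a. i < m \<Longrightarrow> 0 \<le> \<pi> i a" and \<pi>P: "\<And>i. i < m \<Longrightarrow> {a. \<pi> i a \<noteq> 0} \<subseteq> P i"
    and row: "\<And>i v. i < m \<Longrightarrow> v \<in> colour_class \<tau> i \<Longrightarrow> (\<Sum>u\<in>{u\<in>\<sigma>. c u = i}. \<pi> i (v, u)) = w (v, i)"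
    and col: "\<And>i u. i < m \<Longrightarrow> u \<in> {u\<in>\<sigma>. c u = i} \<Longrightarrow> (\<Sum>v\<in>colour_class \<tau> i. \<pi> i (v, u)) = l u"
    unfolding coupling_def by blast+
  have \<pi>sub: "v \<in> colour_class \<tau> i \<and> u \<in> \<sigma> \<and> c u = i" if "i < m" "\<pi> i (v, u) \<noteq> 0" for i v u
    using \<pi>P[OF that(1)] that(2) colour_staircases_subset[OF \<tau> \<sigma> P[OF that(1)]] by blast
  \<comment> \<open>The joint weight of the pair \<open>(v, u)\<close>. Summing over
    \<open>v\<close> returns \<open>l\<close>, and summing over the \<open>u\<close> of one colour
    returns \<open>w\<close>; hence the first \<open>k\<close> coordinates are computed through
    \<open>w\<close> and the others through \<open>l\<close>.\<close>
  define W where "W v u = (if u < 2 ^ n then \<pi> (c u) (v, u) else 0)" for v u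
  have W0: "0 \<le> W v u" for v u using \<pi>0 c by (auto simp: W_def)
  have Wu: "(\<Sum>v<2 ^ k. W v u) = l u" if u: "u < 2 ^ n" for u
  proof (cases "u \<in> \<sigma>")
    case True
    have "(\<Sum>v<2 ^ k. W v u) = (\<Sum>v\<in>colour_class \<tau> (c u). \<pi> (c u) (v, u))"
      using T_cell(5)[OF \<tau>, of "c u"] \<pi>sub[of "c u" _ u] c u by (intro sum.mono_neutral_cong_right) (auto simp: W_def)
    then show ?thesis using col[of "c u" u] True c u by simp
  next
    case False
    have "(\<Sum>v<2 ^ k. W v u) = 0"
      using \<pi>sub[of "c u" _ u] c u False by (intro sum.neutral) (auto simp: W_def)
    then show ?thesis using False lsub by auto
  qed
  have Wv: "(\<Sum>u\<in>{u. u < 2 ^ n \<and> c u = i}. W v u) = w (v, i)" if i: "i < m" for v i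
  proof (cases "v \<in> colour_class \<tau> i")
    case True
    have "(\<Sum>u\<in>{u. u < 2 ^ n \<and> c u = i}. W v u) = (\<Sum>u\<in>{u\<in>\<sigma>. c u = i}. \<pi> i (v, u))"
      using F_cell(1)[OF \<sigma>] \<pi>sub[OF i] by (intro sum.mono_neutral_cong_right) (auto simp: W_def)
    then show ?thesis using row[OF i True] by simp
  next
    case False
    have "(\<Sum>u\<in>{u. u < 2 ^ n \<and> c u = i}. W v u) = 0"
      using \<pi>sub[OF i] False by (intro sum.neutral) (auto simp: W_def)
    then show ?thesis using False wsub by (auto simp: colour_class_def)
  qed
  define \<omega> where "\<omega> x = W (x mod 2 ^ k) (x div 2 ^ k)" for x
  have \<omega>_glue: "\<omega> (glue k (v, u)) = W v u" if "v < 2 ^ k" for v u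
    using that by (simp add: \<omega>_def)
  have sum\<omega>: "(\<Sum>x<2 ^ (k + n). \<omega> x * g x) = (\<Sum>v<2 ^ k. \<Sum>u<2 ^ n. W v u * g (glue k (v, u)))" for g :: "nat \<Rightarrow> real"
    unfolding sum_glue by (intro sum.cong) (auto simp: \<omega>_glue)
  have "weights (k + n) p \<omega>"
    unfolding weights_def
  proof (intro conjI allI impI)
    show "0 \<le> \<omega> x" for x using W0 by (simp add: \<omega>_def)
    show "\<omega> x = 0" if "2 ^ (k + n) \<le> x" for x
    proof -
      have "2 ^ n \<le> x div 2 ^ k" using that by (simp add: less_eq_div_iff_mult_less_eq power_add mult.commute)
      then show ?thesis by (simp add: \<omega>_def W_def)
    qed
    have "(\<Sum>x<2 ^ (k + n). \<omega> x) = (\<Sum>u<2 ^ n. \<Sum>v<2 ^ k. W v u)"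
      using sum\<omega>[of "\<lambda>_. 1"] by (subst sum.swap) simp
    also have "\<dots> = 1" using Wu l by (simp add: weights_def)
    finally show "(\<Sum>x<2 ^ (k + n). \<omega> x) = 1" .
    fix j assume j: "j < k + n"
    show "(\<Sum>x<2 ^ (k + n). \<omega> x * of_bool (bit x j)) = p j"
    proof (cases "j < k")
      case True
      have "(\<Sum>x<2 ^ (k + n). \<omega> x * of_bool (bit x j)) = (\<Sum>v<2 ^ k. (\<Sum>u<2 ^ n. W v u) * of_bool (bit v j))"
        unfolding sum\<omega> using True by (intro sum.cong refl) (simp add: bit_glue sum_distrib_right del: sum_mult_of_bool_eq)
      also have "\<dots> = (\<Sum>v<2 ^ k. (\<Sum>i<m. w (v, i)) * of_bool (bit v j))"
        using Wv by (simp add: sum_colour_split[OF c] del: sum_mult_of_bool_eq)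
      also have "\<dots> = (\<Sum>a\<in>prism_vertices k m. w a * of_bool (bit (fst a) j))"
        unfolding prism_vertices_def
        by (simp add: sum.cartesian_product split_def sum_distrib_right del: sum_mult_of_bool_eq)
      also have "\<dots> = p j" using w True unfolding prism_weights_def by blast
      finally show ?thesis .
    next
      case False
      have "(\<Sum>x<2 ^ (k + n). \<omega> x * of_bool (bit x j)) = (\<Sum>v<2 ^ k. \<Sum>u<2 ^ n. W v u * of_bool (bit u (j - k)))"
        unfolding sum\<omega> using False by (intro sum.cong refl) (simp add: bit_glue del: sum_mult_of_bool_eq)
      also have "\<dots> = (\<Sum>u<2 ^ n. (\<Sum>v<2 ^ k. W v u) * of_bool (bit u (j - k)))"
        by (subst sum.swap) (simp add: sum_distrib_right del: sum_mult_of_bool_eq)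
      also have "\<dots> = q (j - k)" using l j False by (simp add: Wu weights_def del: sum_mult_of_bool_eq)
      finally show ?thesis using False by (simp add: q_def)
    qed
  qed
  moreover have "{x. \<omega> x \<noteq> 0} \<subseteq> glue k ` (\<Union>i<m. restrict P {..<m} i)"
  proof
    fix x assume "x \<in> {x. \<omega> x \<noteq> 0}"
    then have x: "W (x mod 2 ^ k) (x div 2 ^ k) \<noteq> 0" by (simp add: \<omega>_def)
    then have u: "x div 2 ^ k < 2 ^ n" "\<pi> (c (x div 2 ^ k)) (x mod 2 ^ k, x div 2 ^ k) \<noteq> 0"
      by (auto simp: W_def split: if_splits)
    then have "(x mod 2 ^ k, x div 2 ^ k) \<in> P (c (x div 2 ^ k))" "c (x div 2 ^ k) < m" using \<pi>P c by blast+
    moreover have "x = glue k (x mod 2 ^ k, x div 2 ^ k)" by (simp add: glue_def)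
    ultimately show "x \<in> glue k ` (\<Union>i<m. restrict P {..<m} i)" by auto
  qed
  moreover have "glue k ` (\<Union>i<m. restrict P {..<m} i) \<in> product_cells k m T F c"
    unfolding product_cells_def using \<sigma> \<tau> P by (intro image_eqI[of _ _ "(\<sigma>, \<tau>, restrict P {..<m})"]) auto
  ultimately show ?thesis by blast
qed

text \<open>Two projections of the weights are determined by the point: \<open>lw\<close>, onto the
  vertices of the n-cube, and \<open>tw\<close>, onto the vertices of the prism, where
  \<open>u\<close> is replaced by its colour. The pairs of one colour then form a coupling with
  known marginals that is supported on a chain, and such a coupling is unique. Pairs of different
  colours need not be comparable, which is why the argument runs colour by colour.\<close>

lemma product_cells_unique:
  assumes C: "C \<in> product_cells k m T F c" and C': "C' \<in> product_cells k m T F c"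
    and w: "weights (k + n) p w" and w': "weights (k + n) p w'"
    and sub: "{v. w v \<noteq> 0} \<subseteq> C" and sub': "{v. w' v \<noteq> 0} \<subseteq> C'"
  shows "w = w'"
proof -
  define W where "W w a = (if fst a < 2 ^ k \<and> snd a < 2 ^ n then w (glue k a) else 0)" for w :: "nat \<Rightarrow> real" and a
  define lw where "lw w u = (\<Sum>v<2 ^ k. W w (v, u))" for w u
  define \<mu> where "\<mu> w i = (\<Sum>u\<in>{u. u < 2 ^ n \<and> c u = i}. lw w u)" for w i
  define tw where "tw w a = (if snd a < m then \<Sum>u\<in>{u. u < 2 ^ n \<and> c u = snd a}. W w (fst a, u) else 0)" for w a
  define q where "q j = p (k + j)" for j
  have sumW: "(\<Sum>x<2 ^ (k + n). w x * g x) = (\<Sum>v<2 ^ k. \<Sum>u<2 ^ n. W w (v, u) * g (glue k (v, u)))"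
    for w g :: "nat \<Rightarrow> real"
    unfolding sum_glue by (intro sum.cong) (auto simp: W_def)
  have W0: "0 \<le> W w a" if "weights (k + n) p w" for w a
    using that by (simp add: W_def weights_def)
  have lw: "weights n q (lw w)" if w: "weights (k + n) p w" for w
    unfolding weights_def
  proof (intro conjI allI impI)
    show "0 \<le> lw w u" for u using W0[OF w] by (auto simp: lw_def intro: sum_nonneg)
    show "lw w u = 0" if "2 ^ n \<le> u" for u using that by (simp add: lw_def W_def)
    have "(\<Sum>u<2 ^ n. lw w u) = (\<Sum>x<2 ^ (k + n). w x)"
      using sumW[of w "\<lambda>_. 1"] sum.swap[of "\<lambda>u v. W w (v, u)" "{..<2 ^ k}" "{..<2 ^ n}"]
      by (simp add: lw_def)
    then show "(\<Sum>u<2 ^ n. lw w u) = 1" using w by (simp add: weights_def)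
    fix j assume j: "j < n"
    have "(\<Sum>u<2 ^ n. lw w u * of_bool (bit u j)) = (\<Sum>u<2 ^ n. \<Sum>v<2 ^ k. W w (v, u) * of_bool (bit u j))"
      unfolding lw_def by (simp only: sum_distrib_right)
    also have "\<dots> = (\<Sum>v<2 ^ k. \<Sum>u<2 ^ n. W w (v, u) * of_bool (bit u j))"
      by (rule sum.swap)
    also have "\<dots> = (\<Sum>x<2 ^ (k + n). w x * of_bool (bit x (k + j)))"
      unfolding sumW by (intro sum.cong refl) (simp add: bit_glue del: sum_mult_of_bool_eq)
    also have "\<dots> = q j" using w j unfolding q_def weights_def by simp
    finally show "(\<Sum>u<2 ^ n. lw w u * of_bool (bit u j)) = q j" .
  qed
  have tw: "prism_weights k m p (\<mu> w) (tw w)" if w: "weights (k + n) p w" for w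
    unfolding prism_weights_def
  proof (intro conjI allI impI)
    show "0 \<le> tw w a" for a using W0[OF w] by (auto simp: tw_def intro: sum_nonneg)
    show "tw w a = 0" if "a \<notin> prism_vertices k m" for a
      using that by (cases a) (auto simp: tw_def W_def prism_vertices_def)
    show "(\<Sum>v<2 ^ k. tw w (v, i)) = \<mu> w i" if "i < m" for i
      unfolding \<mu>_def lw_def tw_def using that by (subst sum.swap) simp
    fix j assume j: "j < k"
    have "(\<Sum>a\<in>prism_vertices k m. tw w a * of_bool (bit (fst a) j))
      = (\<Sum>v<2 ^ k. (\<Sum>i<m. tw w (v, i)) * of_bool (bit v j))"
      unfolding prism_vertices_def
      by (simp add: sum.cartesian_product split_def sum_distrib_right del: sum_mult_of_bool_eq)
    also have "\<dots> = (\<Sum>v<2 ^ k. \<Sum>u<2 ^ n. W w (v, u) * of_bool (bit v j))"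
      by (simp add: sum_colour_split[OF c] tw_def sum_distrib_right del: sum_mult_of_bool_eq)
    also have "\<dots> = (\<Sum>x<2 ^ (k + n). w x * of_bool (bit x j))"
      unfolding sumW using j by (intro sum.cong refl) (simp add: bit_glue del: sum_mult_of_bool_eq)
    also have "\<dots> = p j" using w j unfolding weights_def by simp
    finally show "(\<Sum>a\<in>prism_vertices k m. tw w a * of_bool (bit (fst a) j)) = p j" .
  qed
  have cell: "\<exists>\<sigma>\<in>F. \<exists>\<tau>\<in>T. {u. lw w u \<noteq> 0} \<subseteq> \<sigma> \<and> {a. tw w a \<noteq> 0} \<subseteq> \<tau> \<and>
      (\<forall>i<m. is_chain {a. W w a \<noteq> 0 \<and> c (snd a) = i})"
    if C: "C \<in> product_cells k m T F c" and sub: "{v. w v \<noteq> 0} \<subseteq> C" for C and w :: "nat \<Rightarrow> real"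
  proof -
    obtain \<sigma> \<tau> f where \<sigma>: "\<sigma> \<in> F" and \<tau>: "\<tau> \<in> T" and f: "\<And>i. i < m \<Longrightarrow> f i \<in> colour_staircases \<tau> \<sigma> c i"
      and C: "C = glue k ` (\<Union>i<m. f i)"
      using C by (auto simp: product_cells_def PiE_def)
    have fsub: "f i \<subseteq> colour_class \<tau> i \<times> {u\<in>\<sigma>. c u = i}" if "i < m" for i
      using colour_staircases_subset[OF \<tau> \<sigma> f[OF that]] .
    have Wf: "a \<in> f (c (snd a)) \<and> c (snd a) < m" if "W w a \<noteq> 0" for a
    proof -
      have a: "fst a < 2 ^ k" "snd a < 2 ^ n" "w (glue k a) \<noteq> 0"
        using that by (auto simp: W_def split: if_splits)
      then obtain i b where b: "glue k a = glue k b" "i < m" "b \<in> f i" using sub C by auto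
      have "fst b < 2 ^ k" using fsub[OF b(2)] b(3) T_cell(5)[OF \<tau>] by fastforce
      then have "a = b" using b(1) a(1) glue_simps[of "fst a" k "snd a"] glue_simps[of "fst b" k "snd b"]
        by (metis prod.collapse)
      moreover have "c (snd b) = i" using fsub[OF b(2)] b(3) by auto
      ultimately show ?thesis using b by simp
    qed
    have "u \<in> \<sigma>" if "lw w u \<noteq> 0" for u
    proof -
      obtain v where "W w (v, u) \<noteq> 0" using \<open>lw w u \<noteq> 0\<close> unfolding lw_def by (meson sum.neutral)
      then show ?thesis using Wf[of "(v, u)"] fsub by fastforce
    qed
    moreover have "a \<in> \<tau>" if "tw w a \<noteq> 0" for a
    proof -
      have "snd a < m" "(\<Sum>u\<in>{u. u < 2 ^ n \<and> c u = snd a}. W w (fst a, u)) \<noteq> 0"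
        using that by (auto simp: tw_def split: if_splits)
      then obtain u where "c u = snd a" "W w (fst a, u) \<noteq> 0" by (metis (mono_tags, lifting) mem_Collect_eq sum.neutral)
      then show ?thesis using Wf[of "(fst a, u)"] fsub[of "snd a"] by (auto simp: colour_class_def)
    qed
    moreover have "is_chain {a. W w a \<noteq> 0 \<and> c (snd a) = i}" if "i < m" for i
    proof -
      have "is_chain (f i)" using f[OF that] unfolding colour_staircases_def
        by (intro is_chain_staircase[rotated 2]) auto
      moreover have "{a. W w a \<noteq> 0 \<and> c (snd a) = i} \<subseteq> f i" using Wf by auto
      ultimately show ?thesis unfolding is_chain_def by blast
    qed
    ultimately show ?thesis using \<sigma> \<tau> by blast
  qed
  obtain \<sigma> \<tau> \<sigma>' \<tau>' where
    st: "\<sigma> \<in> F" "\<tau> \<in> T" "{u. lw w u \<noteq> 0} \<subseteq> \<sigma>" "{a. tw w a \<noteq> 0} \<subseteq> \<tau>"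
      "\<And>i. i < m \<Longrightarrow> is_chain {a. W w a \<noteq> 0 \<and> c (snd a) = i}"
    and st': "\<sigma>' \<in> F" "\<tau>' \<in> T" "{u. lw w' u \<noteq> 0} \<subseteq> \<sigma>'" "{a. tw w' a \<noteq> 0} \<subseteq> \<tau>'"
      "\<And>i. i < m \<Longrightarrow> is_chain {a. W w' a \<noteq> 0 \<and> c (snd a) = i}"
    using cell[OF C sub] cell[OF C' sub'] by blast
  have lweq: "lw w = lw w'"
    using cube_complex_unique[OF F st(1) st'(1) lw[OF w] lw[OF w'] st(3) st'(3)] .
  then have "\<mu> w = \<mu> w'" by (simp add: \<mu>_def fun_eq_iff)
  moreover have "(\<Sum>i<m. \<mu> w i) = 1"
    using sum_colour_split[OF c, of "lw w"] lw[OF w] by (simp add: \<mu>_def weights_def)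
  ultimately have tweq: "tw w = tw w'"
    using prism_complex_unique[OF T st(2) st'(2) tw[OF w] _ _ st(4) st'(4)] tw[OF w'] by simp
  have Weq: "W w (v, u) = W w' (v, u)" if v: "v < 2 ^ k" and u: "u < 2 ^ n" for v u
  proof -
    define i where "i = c u"
    have i: "i < m" using c u by (simp add: i_def)
    let ?pi = "\<lambda>w a. if c (snd a) = i then W w a else 0"
    let ?B = "{u. u < 2 ^ n \<and> c u = i}"
    have row: "(\<Sum>b\<in>?B. ?pi w (a, b)) = tw w (a, i)" for w a
      using i by (simp add: tw_def)
    have col: "(\<Sum>a<2 ^ k. ?pi w (a, b)) = lw w b" if "b \<in> ?B" for w b
      using that by (simp add: lw_def)
    have ch: "{a. ?pi w a \<noteq> 0} = {a. W w a \<noteq> 0 \<and> c (snd a) = i}" for w by auto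
    have supp: "{a. ?pi w a \<noteq> 0} \<subseteq> {..<2 ^ k} \<times> ?B" for w
      by (auto simp: W_def split: if_splits)
    have "?pi w = ?pi w'"
    proof (rule chain_coupling_unique[where A = "{..<2 ^ k}" and B = ?B])
      show "is_chain {a. ?pi w a \<noteq> 0}" "is_chain {a. ?pi w' a \<noteq> 0}"
        unfolding ch using st(5) st'(5) i by auto
      show "(\<Sum>b\<in>?B. ?pi w (a, b)) = (\<Sum>b\<in>?B. ?pi w' (a, b))" for a
        unfolding row tweq ..
      show "(\<Sum>a<2 ^ k. ?pi w (a, b)) = (\<Sum>a<2 ^ k. ?pi w' (a, b))" if "b \<in> ?B" for b
        unfolding col[OF that] lweq ..
    qed (use W0[OF w] W0[OF w'] supp in auto)
    then have "?pi w (v, u) = ?pi w' (v, u)" by metis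
    then show ?thesis by (simp add: i_def)
  qed
  show ?thesis
  proof
    fix x
    show "w x = w' x"
    proof (cases "x < 2 ^ (k + n)")
      case True
      then obtain a where "a \<in> {..<2 ^ k} \<times> {..<2 ^ n}" "x = glue k a"
        using bij_betw_glue[of k n] unfolding bij_betw_def by blast
      then show ?thesis using Weq[of "fst a" "snd a"] by (auto simp: W_def)
    next
      case False
      then show ?thesis using w w' by (simp add: weights_def)
    qed
  qed
qed

lemma cube_complex_product: "cube_complex (k + n) (product_cells k m T F c)"
  unfolding cube_complex_def
proof (intro conjI[OF finite_product_cells] conjI ballI allI impI)
  fix C C' p w w'
  assume "C \<in> product_cells k m T F c" "C' \<in> product_cells k m T F c" "weights (k + n) p w"
    "weights (k + n) p w'" "{v. w v \<noteq> 0} \<subseteq> C" "{v. w' v \<noteq> 0} \<subseteq> C'"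
  then show "w = w'" by (rule product_cells_unique)
qed (use product_cell product_cells_cover in auto)

end

text \<open>The simplex with one vertex is a point, so a prism over it is the cube itself. This
  makes ordinary products of triangulations the one-colour case of the construction.\<close>

lemma prism_complex_one:
  assumes "cube_complex k F"
  shows "prism_complex k 1 ((\<lambda>C. C \<times> {0}) ` F)"
proof -
  have sw: "sum f (prism_vertices k 1) = (\<Sum>v<2 ^ k. f (v, 0))" for f :: "nat \<times> nat \<Rightarrow> real"
  proof -
    have "prism_vertices k 1 = (\<lambda>v. (v, 0)) ` {..<2 ^ k}" by (auto simp: prism_vertices_def)
    then show ?thesis by (simp add: sum.reindex inj_on_def)
  qed
  have cc: "colour_class (C \<times> {0}) 0 = C" for C :: "nat set" by (simp add: colour_class_def)
  have pw: "weights k p (\<lambda>v. w (v, 0))" if "prism_weights k 1 p \<mu> w" "\<mu> 0 = 1" for p \<mu> w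
    using that unfolding prism_weights_def weights_def sw by (auto simp: prism_vertices_def)
  have F: "finite F" "\<And>C. C \<in> F \<Longrightarrow> C \<subseteq> {..<2^k} \<and> card C = k + 1"
    using assms by (auto simp: cube_complex_def)
  show ?thesis
    unfolding prism_complex_def
  proof (intro conjI ballI allI impI)
    show "finite ((\<lambda>C. C \<times> {0::nat}) ` F)" using F by simp
  next
    fix C :: "(nat \<times> nat) set" and i :: nat assume C: "C \<in> (\<lambda>C. C \<times> {0::nat}) ` F"
    then obtain B where B: "B \<in> F" "C = B \<times> {0}" by blast
    show "C \<subseteq> prism_vertices k 1" using F(2)[OF B(1)] B by (auto simp: prism_vertices_def)
    show "card C = k + 1" using F(2)[OF B(1)] B by (simp add: card_cartesian_product)
    assume "i < 1"
    then show "colour_class C i \<noteq> {}" using F(2)[OF B(1)] B cc by auto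
  next
    fix p \<mu> :: "nat \<Rightarrow> real" assume p: "\<forall>j<k. 0 \<le> p j \<and> p j \<le> 1" and "(\<Sum>i<1. \<mu> i) = (1::real)"
    then have mu: "\<mu> 0 = 1" by simp
    obtain C w where C: "C \<in> F" and w: "weights k p w" "{v. w v \<noteq> 0} \<subseteq> C" using cube_complex_cover[OF assms p] by blast
    define w' where "w' a = (if snd a = 0 then w (fst a) else 0)" for a :: "nat \<times> nat"
    have "prism_weights k 1 p \<mu> w'"
      using w(1) mu unfolding prism_weights_def weights_def sw by (auto simp: w'_def prism_vertices_def)
    moreover have "{a. w' a \<noteq> 0} \<subseteq> C \<times> {0}" using w(2) by (auto simp: w'_def split: if_splits)
    ultimately have "prism_weights k 1 p \<mu> w' \<and> {a. w' a \<noteq> 0} \<subseteq> C \<times> {0} \<and>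
        (\<forall>i<1. \<mu> i = 0 \<longrightarrow> card (colour_class (C \<times> {0}) i) = 1)"
      using mu by simp
    then show "\<exists>C\<in>(\<lambda>C. C \<times> {0}) ` F. \<exists>w. prism_weights k 1 p \<mu> w \<and> {a. w a \<noteq> 0} \<subseteq> C \<and>
        (\<forall>i<1. \<mu> i = 0 \<longrightarrow> card (colour_class C i) = 1)"
      using C by (intro bexI[of _ "C \<times> {0}"] exI[of _ w']) auto
  next
    fix C C' :: "(nat \<times> nat) set" and p \<mu> :: "nat \<Rightarrow> real" and w w'
    assume C: "C \<in> (\<lambda>C. C \<times> {0::nat}) ` F" "C' \<in> (\<lambda>C. C \<times> {0::nat}) ` F"
      and w: "prism_weights k 1 p \<mu> w" "prism_weights k 1 p \<mu> w'"
      and "(\<Sum>i<1. \<mu> i) = 1" and sub: "{a. w a \<noteq> 0} \<subseteq> C" "{a. w' a \<noteq> 0} \<subseteq> C'"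
    then have mu: "\<mu> 0 = 1" by simp
    obtain B B' where B: "B \<in> F" "C = B \<times> {0}" and B': "B' \<in> F" "C' = B' \<times> {0}" using C by blast
    have "(\<lambda>v. w (v, 0)) = (\<lambda>v. w' (v, 0))"
      using sub B B' by (intro cube_complex_unique[OF assms B(1) B'(1) pw[OF w(1) mu] pw[OF w(2) mu]]) auto
    moreover have "w (v, i) = w' (v, i)" if "i \<noteq> 0" for v i
    proof -
      have "(v, i) \<notin> C" "(v, i) \<notin> C'" using B B' that by auto
      then have "w (v, i) = 0" "w' (v, i) = 0" using sub by auto
      then show ?thesis by simp
    qed
    ultimately have "w (v, i) = w' (v, i)" for v i by (cases "i = 0") (auto dest: fun_cong)
    then show "w = w'" by (simp add: fun_eq_iff)
  qed
qed

section \<open>Geometric triangulations of the cube\<close>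

lemma bit_less_of_less_power: "v < 2 ^ d \<Longrightarrow> bit v i \<Longrightarrow> i < d" for v :: nat
proof (rule ccontr)
  assume v: "v < 2 ^ d" and "bit v i" and "\<not> i < d"
  then have "(2::nat) ^ d \<le> 2 ^ i" by (intro power_increasing) auto
  then have "v < 2 ^ i" using v by linarith
  then have "v div 2 ^ i = 0" by simp
  then show False using \<open>bit v i\<close> by (simp add: bit_iff_odd)
qed

definition cube_vertex :: "nat \<Rightarrow> (nat \<Rightarrow>\<^sub>0 real)" where
  "cube_vertex v = Abs_poly_mapping (\<lambda>i. of_bool (bit v i))"

lemma lookup_cube_vertex [simp]: "Poly_Mapping.lookup (cube_vertex v) i = of_bool (bit v i)"
proof -
  have "{i. of_bool (bit v i) \<noteq> (0::real)} \<subseteq> {..<v}"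
    using bit_less_of_less_power[of v v] less_exp[of v] by auto
  then have "finite {i. of_bool (bit v i) \<noteq> (0::real)}" using finite_subset by blast
  then show ?thesis unfolding cube_vertex_def by (subst lookup_Abs_poly_mapping) auto
qed

lemma inj_cube_vertex: "inj cube_vertex"
proof (rule injI, rule bit_eqI)
  fix u v n assume "cube_vertex u = cube_vertex v"
  then have "Poly_Mapping.lookup (cube_vertex u) n = Poly_Mapping.lookup (cube_vertex v) n" by simp
  then show "bit u n \<longleftrightarrow> bit v n" by (cases "bit u n"; cases "bit v n") auto
qed

lemma lookup_scaleR [simp]: "Poly_Mapping.lookup (r *\<^sub>R x) i = r * Poly_Mapping.lookup x i" for x :: "nat \<Rightarrow>\<^sub>0 real"
proof -
  have "finite {i. r * Poly_Mapping.lookup x i \<noteq> 0}"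
    by (rule finite_subset[OF _ finite_lookup[of x]]) auto
  then show ?thesis by (simp add: scaleR_poly_mapping_def)
qed

lemma lookup_weighted_sum:
  "Poly_Mapping.lookup (\<Sum>v\<in>A. w v *\<^sub>R cube_vertex v) j = (\<Sum>v\<in>A. w v * of_bool (bit v j))"
  by (simp add: lookup_sum)

text \<open>The dictionary between the geometric cells and their weights. The vanishing of the
  coordinates from \<open>d\<close> on is stated separately because \<open>weights d\<close> only
  sees the first \<open>d\<close> coordinates.\<close>

lemma convex_hull_cube_vertices:
  assumes C: "C \<subseteq> {..<2 ^ d}"
  shows "x \<in> convex hull (cube_vertex ` C) \<longleftrightarrow>
    (\<forall>j\<ge>d. Poly_Mapping.lookup x j = 0) \<and> (\<exists>w. weights d (Poly_Mapping.lookup x) w \<and> {v. w v \<noteq> 0} \<subseteq> C)"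
proof
  have fin: "finite C" using C finite_subset by blast
  have inj: "inj_on cube_vertex C" using inj_cube_vertex inj_on_subset by blast
  {
    assume "x \<in> convex hull (cube_vertex ` C)"
    then obtain u where u: "\<forall>y\<in>cube_vertex ` C. 0 \<le> u y" "sum u (cube_vertex ` C) = 1"
      "(\<Sum>y\<in>cube_vertex ` C. u y *\<^sub>R y) = x"
      using convex_hull_finite[of "cube_vertex ` C"] fin by auto
    define w where "w v = (if v \<in> C then u (cube_vertex v) else 0)" for v
    have ext: "(\<Sum>v<2 ^ d. w v * g v) = (\<Sum>v\<in>C. u (cube_vertex v) * g v)" for g
      using C by (intro sum.mono_neutral_cong_right) (auto simp: w_def)
    have x: "x = (\<Sum>v\<in>C. u (cube_vertex v) *\<^sub>R cube_vertex v)"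
      using u(3) inj by (simp add: sum.reindex)
    have lx: "Poly_Mapping.lookup x j = (\<Sum>v\<in>C. u (cube_vertex v) * of_bool (bit v j))" for j
      unfolding x lookup_weighted_sum ..
    have "weights d (Poly_Mapping.lookup x) w"
      unfolding weights_def
    proof (intro conjI allI impI)
      show "0 \<le> w v" for v using u(1) by (simp add: w_def)
      show "w v = 0" if "2 ^ d \<le> v" for v using C that by (auto simp: w_def)
      show "(\<Sum>v<2 ^ d. w v) = 1" using ext[of "\<lambda>_. 1"] u(2) inj by (simp add: sum.reindex)
      show "(\<Sum>v<2 ^ d. w v * of_bool (bit v j)) = Poly_Mapping.lookup x j" for j
        unfolding lx ext ..
    qed
    moreover have "{v. w v \<noteq> 0} \<subseteq> C" by (auto simp: w_def)
    moreover have "Poly_Mapping.lookup x j = 0" if "d \<le> j" for j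
      unfolding lx using C bit_less_of_less_power[of _ d j] that by (intro sum.neutral) fastforce
    ultimately show "(\<forall>j\<ge>d. Poly_Mapping.lookup x j = 0) \<and>
      (\<exists>w. weights d (Poly_Mapping.lookup x) w \<and> {v. w v \<noteq> 0} \<subseteq> C)" by blast
  }
  {
    assume "(\<forall>j\<ge>d. Poly_Mapping.lookup x j = 0) \<and>
      (\<exists>w. weights d (Poly_Mapping.lookup x) w \<and> {v. w v \<noteq> 0} \<subseteq> C)"
    then obtain w where x0: "\<And>j. d \<le> j \<Longrightarrow> Poly_Mapping.lookup x j = 0"
      and w: "weights d (Poly_Mapping.lookup x) w" and wC: "{v. w v \<noteq> 0} \<subseteq> C" by blast
    have ext: "(\<Sum>v<2 ^ d. w v * g v) = (\<Sum>v\<in>C. w v * g v)" for g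
      using C wC by (intro sum.mono_neutral_right) auto
    have "x = (\<Sum>v\<in>C. w v *\<^sub>R cube_vertex v)"
    proof (rule poly_mapping_eqI)
      fix j
      show "Poly_Mapping.lookup x j = Poly_Mapping.lookup (\<Sum>v\<in>C. w v *\<^sub>R cube_vertex v) j"
      proof (cases "j < d")
        case True
        then show ?thesis using w unfolding lookup_weighted_sum weights_def ext[symmetric] by simp
      next
        case False
        then have "(\<Sum>v\<in>C. w v * of_bool (bit v j)) = 0"
          using C bit_less_of_less_power[of _ d j] by (intro sum.neutral) fastforce
        then show ?thesis unfolding lookup_weighted_sum using x0 False by simp
      qed
    qed
    then have "x = (\<Sum>y\<in>cube_vertex ` C. w (inv cube_vertex y) *\<^sub>R y)"
      using inj inj_cube_vertex by (simp add: sum.reindex inv_f_f)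
    moreover have "(\<Sum>y\<in>cube_vertex ` C. w (inv cube_vertex y)) = 1"
      using inj inj_cube_vertex w ext[of "\<lambda>_. 1"] by (simp add: sum.reindex inv_f_f weights_def)
    moreover have "\<forall>y\<in>cube_vertex ` C. 0 \<le> w (inv cube_vertex y)"
      using w by (simp add: weights_def)
    ultimately show "x \<in> convex hull (cube_vertex ` C)"
      using fin by (subst convex_hull_finite) (auto intro!: exI[of _ "\<lambda>y. w (inv cube_vertex y)"])
  }
qed

lemma weights_bounds:
  assumes "weights d p w" "j < d"
  shows "0 \<le> p j \<and> p j \<le> 1"
proof -
  have p: "p j = (\<Sum>v<2 ^ d. w v * of_bool (bit v j))" using assms by (simp add: weights_def)
  have "(\<Sum>v<2 ^ d. w v * of_bool (bit v j)) \<le> (\<Sum>v<2 ^ d. w v)"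
    using assms(1) by (intro sum_mono) (auto simp: weights_def)
  moreover have "0 \<le> (\<Sum>v<2 ^ d. w v * of_bool (bit v j))"
    using assms(1) by (intro sum_nonneg) (auto simp: weights_def)
  ultimately show ?thesis using assms(1) p by (simp add: weights_def)
qed

lemma convex_hull_subset_unit_cube:
  assumes "C \<subseteq> {..<2 ^ d}"
  shows "convex hull (cube_vertex ` C) \<subseteq> unit_cube d"
  using convex_hull_cube_vertices[OF assms] weights_bounds by (auto simp: unit_cube_def)

lemma cube_vertex_extreme:
  assumes "v < 2 ^ d"
  shows "cube_vertex v extreme_point_of unit_cube d"
  unfolding extreme_point_of_def
proof (intro conjI ballI notI)
  show "cube_vertex v \<in> unit_cube d"
    using bit_less_of_less_power[OF assms] by (force simp: unit_cube_def)
  fix a b assume a: "a \<in> unit_cube d" and b: "b \<in> unit_cube d" and "cube_vertex v \<in> open_segment a b"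
  then obtain u where u: "a \<noteq> b" "0 < u" "u < 1" "cube_vertex v = (1 - u) *\<^sub>R a + u *\<^sub>R b"
    by (auto simp: in_segment)
  have "a = b"
  proof (rule poly_mapping_eqI)
    fix j
    define s t where "s = Poly_Mapping.lookup a j" and "t = Poly_Mapping.lookup b j"
    have st: "0 \<le> s" "s \<le> 1" "0 \<le> t" "t \<le> 1"
      using a b unfolding s_def t_def unit_cube_def by (cases "j < d"; force)+
    have eq: "of_bool (bit v j) = (1 - u) * s + u * t"
      using arg_cong[OF u(4), of "\<lambda>x. Poly_Mapping.lookup x j"] by (simp add: lookup_add s_def t_def)
    have "s = t"
    proof (cases "bit v j")
      case True
      have "(1 - u) * (1 - s) + u * (1 - t) = 0" using eq True by (simp add: algebra_simps)
      moreover have "0 \<le> (1 - u) * (1 - s)" "0 \<le> u * (1 - t)" using u st by auto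
      ultimately have "(1 - u) * (1 - s) = 0 \<and> u * (1 - t) = 0" by linarith
      then show ?thesis using u by simp
    next
      case False
      have "(1 - u) * s + u * t = 0" using eq False by simp
      moreover have "0 \<le> (1 - u) * s" "0 \<le> u * t" using u st by auto
      ultimately have "(1 - u) * s = 0 \<and> u * t = 0" by linarith
      then show ?thesis using u by simp
    qed
    then show "Poly_Mapping.lookup a j = Poly_Mapping.lookup b j" by (simp add: s_def t_def)
  qed
  then show False using u by simp
qed

text \<open>A \<open>cube_complex\<close> provides weights for every point of the cube, which is
  just a representation as a convex combination of vertices.\<close>

lemma unit_cube_eq_convex_hull:
  assumes "cube_complex d F"
  shows "unit_cube d = convex hull (cube_vertex ` {..<2 ^ d})"
proof
  show "convex hull (cube_vertex ` {..<2 ^ d}) \<subseteq> unit_cube d" by (rule convex_hull_subset_unit_cube) simp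
  show "unit_cube d \<subseteq> convex hull (cube_vertex ` {..<2 ^ d})"
  proof
    fix x assume x: "x \<in> unit_cube d"
    then obtain w where "weights d (Poly_Mapping.lookup x) w"
      using cube_complex_cover[OF assms, of "Poly_Mapping.lookup x"] by (auto simp: unit_cube_def)
    moreover from this have "{v. w v \<noteq> 0} \<subseteq> {..<2 ^ d}"
      by (auto simp: weights_def not_le[symmetric])
    ultimately show "x \<in> convex hull (cube_vertex ` {..<2 ^ d})"
      using x by (subst convex_hull_cube_vertices) (auto simp: unit_cube_def)
  qed
qed

lemma extreme_points_unit_cube:
  assumes "cube_complex d F"
  shows "{x. x extreme_point_of unit_cube d} = cube_vertex ` {..<2 ^ d}"
proof
  show "{x. x extreme_point_of unit_cube d} \<subseteq> cube_vertex ` {..<2 ^ d}"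
    unfolding unit_cube_eq_convex_hull[OF assms] using extreme_point_of_convex_hull by blast
qed (use cube_vertex_extreme in auto)

text \<open>The barycentre of the cell has equal weights. A small multiple of an affine dependence
  could be added to them without moving the point or making a weight negative, which contradicts
  uniqueness.\<close>

lemma cube_complex_affine_independent:
  assumes F: "cube_complex d F" and C: "C \<in> F"
  shows "\<not> affine_dependent (cube_vertex ` C)"
proof
  have Cd: "C \<subseteq> {..<2 ^ d}" and card: "card C = d + 1" using F C by (auto simp: cube_complex_def)
  then have fin: "finite C" using finite_subset by blast
  have inj: "inj_on cube_vertex C" using inj_cube_vertex inj_on_subset by blast
  assume "affine_dependent (cube_vertex ` C)"
  then obtain U0 where U0: "sum U0 (cube_vertex ` C) = 0" "\<exists>y\<in>cube_vertex ` C. U0 y \<noteq> 0"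
    "(\<Sum>y\<in>cube_vertex ` C. U0 y *\<^sub>R y) = 0"
    using affine_dependent_explicit_finite[of "cube_vertex ` C"] fin by auto
  define U where "U v = U0 (cube_vertex v)" for v
  have U: "sum U C = 0" "\<exists>v\<in>C. U v \<noteq> 0" "(\<Sum>v\<in>C. U v *\<^sub>R cube_vertex v) = 0"
    using U0 inj by (auto simp: U_def sum.reindex)
  have Uj: "(\<Sum>v\<in>C. U v * of_bool (bit v j)) = 0" for j
    using U(3) lookup_weighted_sum[of U C j] by simp
  define M where "M = 1 + (\<Sum>v\<in>C. \<bar>U v\<bar>)"
  have M: "0 < M" "\<bar>U v\<bar> \<le> M" if "v \<in> C" for v
  proof -
    have "\<bar>U v\<bar> \<le> (\<Sum>v\<in>C. \<bar>U v\<bar>)" using that fin by (intro member_le_sum) auto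
    then show "0 < M" "\<bar>U v\<bar> \<le> M" by (auto simp: M_def)
  qed
  define D where "D = real d + 1"
  have D: "D > 0" by (simp add: D_def)
  \<comment> \<open>\<open>D\<close> is the number of vertices, so \<open>r = 0\<close> gives the
    barycentre; \<open>M\<close> is positive and bounds all \<open>\<bar>U v\<bar>\<close>, so the
    weights stay nonnegative for \<open>\<bar>r\<bar> \<le> 1\<close>. The values 0 and 1 of
    \<open>r\<close> are compared below.\<close>
  define w where "w r v = (if v \<in> C then 1 / D + r * U v / (D * M) else 0)" for r v
  define p where "p j = (\<Sum>v\<in>C. 1 / D * of_bool (bit v j))" for j
  have ext: "(\<Sum>v<2 ^ d. w r v * g v) = (\<Sum>v\<in>C. (1 / D + r * U v / (D * M)) * g v)" for r g
    using Cd by (intro sum.mono_neutral_cong_right) (auto simp: w_def)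
  have split: "(\<Sum>v\<in>C. (1 / D + r * U v / (D * M)) * g v) =
      (\<Sum>v\<in>C. 1 / D * g v) + r / (D * M) * (\<Sum>v\<in>C. U v * g v)" for r g
    by (simp add: sum.distrib sum_distrib_left algebra_simps)
  have W: "weights d p (w r)" if r: "\<bar>r\<bar> \<le> 1" for r
    unfolding weights_def
  proof (intro conjI allI impI)
    fix v
    show "0 \<le> w r v"
    proof (cases "v \<in> C")
      case True
      have "\<bar>r * U v\<bar> \<le> 1 * M" unfolding abs_mult using r M[OF True] by (intro mult_mono) auto
      then have "- M \<le> r * U v" by linarith
      then have "0 \<le> (M + r * U v) / (D * M)" using D M[OF True] by simp
      also have "\<dots> = w r v" using True D M[OF True] by (simp add: w_def add_divide_distrib)
      finally show ?thesis .
    qed (simp add: w_def)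
    show "w r v = 0" if "2 ^ d \<le> v" using Cd that by (auto simp: w_def)
    show "(\<Sum>v<2 ^ d. w r v) = 1"
      using ext[of r "\<lambda>_. 1"] split[of r "\<lambda>_. 1"] U(1) card D by (simp add: D_def)
    show "(\<Sum>v<2 ^ d. w r v * of_bool (bit v j)) = p j" for j
      unfolding ext split Uj by (simp add: p_def)
  qed
  have "w 0 = w 1"
    by (rule cube_complex_unique[OF F C C W W]) (auto simp: w_def)
  then have "w 0 v = w 1 v" for v by simp
  then have "U v = 0" if "v \<in> C" for v
    using M[OF that] D that by (auto simp: w_def dest: meta_spec[of _ v])
  then show False using U(2) by blast
qed

text \<open>Faces come from uniqueness: if a point of \<open>S'\<close> lies inside a segment of
  \<open>S\<close>, the same convex combination of the weights of the two ends must be its weights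
  in \<open>S'\<close>. Nonnegative weights cannot cancel, so both ends are supported on the
  vertices of \<open>S'\<close>.\<close>

lemma triangulation_of_cube_complex:
  assumes F: "cube_complex d F"
  shows "triangulation_of d (unit_cube d) ((\<lambda>C. convex hull (cube_vertex ` C)) ` F)"
  unfolding triangulation_of_def
proof (intro conjI)
  have Cd: "C \<subseteq> {..<2 ^ d}" "card C = d + 1" if "C \<in> F" for C using F that by (auto simp: cube_complex_def)
  show "finite ((\<lambda>C. convex hull (cube_vertex ` C)) ` F)" using F by (simp add: cube_complex_def)
  show "\<Union> ((\<lambda>C. convex hull (cube_vertex ` C)) ` F) = unit_cube d"
  proof
    show "\<Union> ((\<lambda>C. convex hull (cube_vertex ` C)) ` F) \<subseteq> unit_cube d"
      using convex_hull_subset_unit_cube Cd by blast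
    show "unit_cube d \<subseteq> \<Union> ((\<lambda>C. convex hull (cube_vertex ` C)) ` F)"
    proof
      fix x assume x: "x \<in> unit_cube d"
      then obtain C w where "C \<in> F" "weights d (Poly_Mapping.lookup x) w" "{v. w v \<noteq> 0} \<subseteq> C"
        using cube_complex_cover[OF F, of "Poly_Mapping.lookup x"] by (auto simp: unit_cube_def)
      then show "x \<in> \<Union> ((\<lambda>C. convex hull (cube_vertex ` C)) ` F)"
        using x convex_hull_cube_vertices[OF Cd(1)] by (auto simp: unit_cube_def)
    qed
  qed
  show "\<forall>S\<in>(\<lambda>C. convex hull (cube_vertex ` C)) ` F.
       \<exists>C\<subseteq>{v. v extreme_point_of unit_cube d}. simplex_on d C S"
  proof
    fix S assume "S \<in> (\<lambda>C. convex hull (cube_vertex ` C)) ` F"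
    then obtain C where C: "C \<in> F" "S = convex hull (cube_vertex ` C)" by blast
    have "card (cube_vertex ` C) = d + 1"
      using Cd(2)[OF C(1)] inj_cube_vertex by (simp add: card_image inj_on_subset)
    then have "simplex_on d (cube_vertex ` C) S"
      unfolding simplex_on_def using cube_complex_affine_independent[OF F C(1)] C(2)
      by (simp add: card_ge_0_finite)
    moreover have "cube_vertex ` C \<subseteq> {v. v extreme_point_of unit_cube d}"
      using cube_vertex_extreme Cd(1)[OF C(1)] by auto
    ultimately show "\<exists>C\<subseteq>{v. v extreme_point_of unit_cube d}. simplex_on d C S" by blast
  qed
  have face: "(S \<inter> S') face_of S"
    if SS: "S \<in> (\<lambda>C. convex hull (cube_vertex ` C)) ` F" "S' \<in> (\<lambda>C. convex hull (cube_vertex ` C)) ` F" for S S'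
  proof -
    obtain C where C: "C \<in> F" "S = convex hull (cube_vertex ` C)" using SS(1) by blast
    obtain C' where C': "C' \<in> F" "S' = convex hull (cube_vertex ` C')" using SS(2) by blast
    note hull = convex_hull_cube_vertices[OF Cd(1)[OF C(1)]] convex_hull_cube_vertices[OF Cd(1)[OF C'(1)]]
    have "a \<in> S' \<and> b \<in> S'"
      if a: "a \<in> S" and b: "b \<in> S" and x: "x \<in> S'" and ox: "x \<in> open_segment a b" for a b x
    proof -
      obtain u where u: "0 < u" "u < 1" "x = (1 - u) *\<^sub>R a + u *\<^sub>R b" using ox by (auto simp: in_segment)
      obtain wa where wa: "weights d (Poly_Mapping.lookup a) wa" "{v. wa v \<noteq> 0} \<subseteq> C"
        and a0: "\<forall>j\<ge>d. Poly_Mapping.lookup a j = 0"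
        using a C(2) hull(1) by blast
      obtain wb where wb: "weights d (Poly_Mapping.lookup b) wb" "{v. wb v \<noteq> 0} \<subseteq> C"
        and b0: "\<forall>j\<ge>d. Poly_Mapping.lookup b j = 0"
        using b C(2) hull(1) by blast
      obtain w' where w': "weights d (Poly_Mapping.lookup x) w'" "{v. w' v \<noteq> 0} \<subseteq> C'"
        using x C'(2) hull(2) by blast
      define w where "w v = (1 - u) * wa v + u * wb v" for v
      have sw: "(\<Sum>v<2 ^ d. w v * g v) = (1 - u) * (\<Sum>v<2 ^ d. wa v * g v) + u * (\<Sum>v<2 ^ d. wb v * g v)" for g
        by (simp add: w_def sum_distrib_left sum.distrib distrib_right mult.assoc)
      have "weights d (Poly_Mapping.lookup x) w"
        unfolding weights_def
      proof (intro conjI allI impI)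
        show "0 \<le> w v" for v using wa(1) wb(1) u by (simp add: w_def weights_def)
        show "w v = 0" if "2 ^ d \<le> v" for v using wa(1) wb(1) that by (simp add: w_def weights_def)
        show "(\<Sum>v<2 ^ d. w v) = 1" using sw[of "\<lambda>_. 1"] wa(1) wb(1) by (simp add: weights_def)
        show "(\<Sum>v<2 ^ d. w v * of_bool (bit v j)) = Poly_Mapping.lookup x j" if "j < d" for j
          unfolding sw u(3) using wa(1) wb(1) that by (simp add: weights_def lookup_add)
      qed
      moreover have "{v. w v \<noteq> 0} \<subseteq> C"
      proof
        fix v assume "v \<in> {v. w v \<noteq> 0}"
        then have "wa v \<noteq> 0 \<or> wb v \<noteq> 0" by (auto simp: w_def)
        then show "v \<in> C" using wa(2) wb(2) by blast
      qed
      ultimately have "w = w'" by (rule cube_complex_unique[OF F C(1) C'(1) _ w'(1) _ w'(2)])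
      have "wa v = 0 \<and> wb v = 0" if "v \<notin> C'" for v
      proof -
        have "(1 - u) * wa v + u * wb v = 0" using \<open>w = w'\<close> w'(2) that by (auto simp: w_def fun_eq_iff)
        moreover have "0 \<le> (1 - u) * wa v" "0 \<le> u * wb v" using wa(1) wb(1) u by (auto simp: weights_def)
        ultimately have "(1 - u) * wa v = 0 \<and> u * wb v = 0" by linarith
        then show ?thesis using u by simp
      qed
      then have "{v. wa v \<noteq> 0} \<subseteq> C'" "{v. wb v \<noteq> 0} \<subseteq> C'" by auto
      then have "a \<in> S'" "b \<in> S'" unfolding C'(2) hull(2) using wa(1) wb(1) a0 b0 by blast+
      then show ?thesis ..
    qed
    moreover have "convex (S \<inter> S')" using C(2) C'(2) by (simp add: convex_Int)
    ultimately show ?thesis unfolding face_of_def by blast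
  qed
  show "\<forall>S\<in>(\<lambda>C. convex hull (cube_vertex ` C)) ` F. \<forall>S'\<in>(\<lambda>C. convex hull (cube_vertex ` C)) ` F.
      S \<inter> S' face_of S \<and> S \<inter> S' face_of S'"
    using face by (metis Int_commute)
qed

text \<open>Once the weights that a point has in one simplex are known to be supported on every
  other simplex containing it, two systems of weights live on a common simplex. Their difference is
  then an affine dependence of its vertices and hence zero.\<close>

lemma cube_complex_of_triangulation:
  assumes ne: "cube_complex d F0" and T: "triangulation_of d (unit_cube d) T"
  shows "\<exists>F. cube_complex d F \<and> card F \<le> card T"
proof -
  note ext = extreme_points_unit_cube[OF ne]
  have finT: "finite T" and UT: "\<Union>T = unit_cube d"
    and cell: "\<And>S. S \<in> T \<Longrightarrow> \<exists>C. C \<subseteq> {v. v extreme_point_of unit_cube d} \<and> simplex_on d C S"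
    and face: "\<And>S S'. S \<in> T \<Longrightarrow> S' \<in> T \<Longrightarrow> (S \<inter> S') face_of S \<and> (S \<inter> S') face_of S'"
    using T by (auto simp: triangulation_of_def)
  have "\<exists>C. C \<subseteq> {..<2 ^ d} \<and> simplex_on d (cube_vertex ` C) S" if S: "S \<in> T" for S
  proof -
    obtain D where D: "D \<subseteq> cube_vertex ` {..<2 ^ d}" "simplex_on d D S" using cell[OF S] ext by auto
    then obtain C where "C \<subseteq> {..<2 ^ d}" "D = cube_vertex ` C" by (meson subset_imageE)
    then show ?thesis using D by blast
  qed
  then obtain V where Vd: "\<And>S. S \<in> T \<Longrightarrow> V S \<subseteq> {..<2 ^ d}"
    and V: "\<And>S. S \<in> T \<Longrightarrow> simplex_on d (cube_vertex ` V S) S" by metis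
  have hull: "S = convex hull (cube_vertex ` V S)" "\<not> affine_dependent (cube_vertex ` V S)"
    "finite (V S)" "card (V S) = d + 1" if "S \<in> T" for S
    using V[OF that] Vd[OF that] inj_cube_vertex finite_subset[OF Vd[OF that]]
    by (auto simp: simplex_on_def card_image inj_on_subset)
  have mem: "x \<in> S \<longleftrightarrow> (\<forall>j\<ge>d. Poly_Mapping.lookup x j = 0) \<and>
    (\<exists>w. weights d (Poly_Mapping.lookup x) w \<and> {v. w v \<noteq> 0} \<subseteq> V S)" if "S \<in> T" for S x
    using convex_hull_cube_vertices[OF Vd[OF that], of x] hull(1)[OF that] by simp
  define pt where "pt p = (\<Sum>i<d. Poly_Mapping.single i (p i))" for p :: "nat \<Rightarrow> real"
  have lookup_pt: "Poly_Mapping.lookup (pt p) j = (if j < d then p j else 0)" for p j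
    by (simp add: pt_def lookup_sum lookup_single when_def)
  have weights_pt: "weights d (Poly_Mapping.lookup (pt p)) w \<longleftrightarrow> weights d p w" for p w
    by (auto simp: weights_def lookup_pt)
  \<comment> \<open>A vertex \<open>v\<close> of positive weight belongs to the smallest face of
    \<open>S\<close> containing the point, so it lies in the face
    \<open>S \<inter> S'\<close>.\<close>
  have supp: "{v. w v \<noteq> 0} \<subseteq> V S'"
    if S: "S \<in> T" and S': "S' \<in> T" and w: "weights d p w" and wS: "{v. w v \<noteq> 0} \<subseteq> V S" and xS': "pt p \<in> S'"
    for S S' p w
  proof
    fix v assume "v \<in> {v. w v \<noteq> 0}"
    then have v: "w v > 0" "v \<in> V S" using w wS by (auto simp: weights_def less_le)
    then have vd: "v < 2 ^ d" using Vd[OF S] by auto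
    have xS: "pt p \<in> S" using w wS mem[OF S] by (auto simp: weights_pt lookup_pt)
    have vS: "cube_vertex v \<in> S" using v hull(1)[OF S] by (metis hull_inc imageI)
    have le1: "w v \<le> 1"
    proof -
      have "w v \<le> (\<Sum>v<2 ^ d. w v)" using vd w by (intro member_le_sum) (auto simp: weights_def)
      then show ?thesis using w by (simp add: weights_def)
    qed
    have "cube_vertex v \<in> S'"
    proof (cases "w v = 1")
      case True
      have z: "w u = 0" if "u \<noteq> v" for u
      proof (cases "u < 2 ^ d")
        case True
        have "(\<Sum>u<2 ^ d. w u) = w v + (\<Sum>u\<in>{..<2 ^ d} - {v}. w u)" using vd by (simp add: sum.remove)
        then have "(\<Sum>u\<in>{..<2 ^ d} - {v}. w u) = 0" using w \<open>w v = 1\<close> by (simp add: weights_def)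
        then show ?thesis using w that True by (subst (asm) sum_nonneg_eq_0_iff) (auto simp: weights_def)
      qed (use w in \<open>simp add: weights_def\<close>)
      have "pt p = cube_vertex v"
      proof (rule poly_mapping_eqI)
        fix j
        have "(\<Sum>u<2 ^ d. w u * of_bool (bit u j)) = (\<Sum>u<2 ^ d. if u = v then of_bool (bit v j) else 0)"
          using z True by (intro sum.cong) auto
        then have "(\<Sum>u<2 ^ d. w u * of_bool (bit u j)) = of_bool (bit v j)" using vd by simp
        then show "Poly_Mapping.lookup (pt p) j = Poly_Mapping.lookup (cube_vertex v) j"
          using w bit_less_of_less_power[OF vd, of j] by (auto simp: lookup_pt weights_def)
      qed
      then show ?thesis using xS' by simp
    next
      case False
      then have lt: "w v < 1" using le1 by simp
      \<comment> \<open>The point of \<open>S\<close> opposite to \<open>v\<close>: the weight of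
        \<open>v\<close> is removed and the others are rescaled to total 1. Unless it coincides with
        the vertex, the given point lies strictly between it and \<open>v\<close>, as the face
        property requires.\<close>
      define y where "y = (1 / (1 - w v)) *\<^sub>R (pt p - w v *\<^sub>R cube_vertex v)"
      have xy: "pt p = (1 - w v) *\<^sub>R y + w v *\<^sub>R cube_vertex v" using lt by (simp add: y_def)
      define w' where "w' u = (if u = v then 0 else w u / (1 - w v))" for u
      have sw': "(\<Sum>u<2 ^ d. w' u * g u) = ((\<Sum>u<2 ^ d. w u * g u) - w v * g v) / (1 - w v)" for g
      proof -
        have "(\<Sum>u<2 ^ d. w' u * g u) = (\<Sum>u\<in>{..<2 ^ d} - {v}. w u * g u / (1 - w v))"
          using vd by (intro sum.mono_neutral_cong_right) (auto simp: w'_def)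
        also have "\<dots> = ((\<Sum>u<2 ^ d. w u * g u) - w v * g v) / (1 - w v)"
          using vd by (simp add: sum_divide_distrib[symmetric] sum_diff1)
        finally show ?thesis .
      qed
      have "weights d (Poly_Mapping.lookup y) w'"
        unfolding weights_def
      proof (intro conjI allI impI)
        show "0 \<le> w' u" for u using w lt by (simp add: w'_def weights_def)
        show "w' u = 0" if "2 ^ d \<le> u" for u using w that by (simp add: w'_def weights_def)
        show "(\<Sum>u<2 ^ d. w' u) = 1" using sw'[of "\<lambda>_. 1"] w lt by (simp add: weights_def)
        show "(\<Sum>u<2 ^ d. w' u * of_bool (bit u j)) = Poly_Mapping.lookup y j" if "j < d" for j
          unfolding sw' y_def using w that by (simp add: weights_def lookup_minus lookup_pt)
      qed
      moreover have "{u. w' u \<noteq> 0} \<subseteq> V S" using wS by (auto simp: w'_def)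
      moreover have "Poly_Mapping.lookup y j = 0" if "j \<ge> d" for j
        using that bit_less_of_less_power[OF vd, of j] by (auto simp: y_def lookup_minus lookup_pt)
      ultimately have yS: "y \<in> S" using mem[OF S] by blast
      show ?thesis
      proof (cases "y = cube_vertex v")
        case True
        then have "pt p = cube_vertex v" using xy by (simp add: scaleR_left_diff_distrib)
        then show ?thesis using xS' by simp
      next
        case False
        then have "pt p \<in> open_segment y (cube_vertex v)" unfolding in_segment using v lt xy by blast
        moreover have "(S \<inter> S') face_of S" using face S S' by blast
        ultimately show ?thesis using face_ofD[of "S \<inter> S'" S "pt p" y "cube_vertex v"] yS vS xS xS' by blast
      qed
    qed
    moreover have "S' \<subseteq> unit_cube d" using UT S' by blast
    \<comment> \<open>Being extreme in the cube, the vertex is extreme in the smaller set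
      \<open>S'\<close> too, and the extreme points of a simplex are among its vertices.\<close>
    ultimately have "cube_vertex v extreme_point_of S'"
      using cube_vertex_extreme[OF vd] unfolding extreme_point_of_def by blast
    then have "cube_vertex v \<in> cube_vertex ` V S'"
      using extreme_point_of_convex_hull hull(1)[OF S'] by metis
    then show "v \<in> V S'" using inj_cube_vertex by (auto dest: injD)
  qed
  have "cube_complex d (V ` T)"
    unfolding cube_complex_def
  proof (intro conjI ballI allI impI)
    show "finite (V ` T)" using finT by simp
    show "C \<subseteq> {..<2 ^ d}" "card C = d + 1" if "C \<in> V ` T" for C using that Vd hull(4) by auto
    fix p assume p: "\<forall>j<d. 0 \<le> p j \<and> p j \<le> (1::real)"
    then have "pt p \<in> unit_cube d" by (simp add: unit_cube_def lookup_pt)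
    then obtain S where S: "S \<in> T" "pt p \<in> S" using UT by blast
    then obtain w where "weights d p w" "{v. w v \<noteq> 0} \<subseteq> V S"
      using mem[OF S(1)] by (auto simp: weights_pt)
    then show "\<exists>C\<in>V ` T. \<exists>w. weights d p w \<and> {v. w v \<noteq> 0} \<subseteq> C" using S(1) by blast
  next
    fix C C' p w w'
    assume C: "C \<in> V ` T" "C' \<in> V ` T" and w: "weights d p w" and w': "weights d p w'"
      and wC: "{v. w v \<noteq> 0} \<subseteq> C" and wC': "{v. w' v \<noteq> 0} \<subseteq> C'"
    obtain S S' where S: "S \<in> T" "C = V S" and S': "S' \<in> T" "C' = V S'" using C by blast
    have "pt p \<in> S" using mem[OF S(1)] w wC S(2) by (auto simp: weights_pt lookup_pt)
    then have w'C: "{v. w' v \<noteq> 0} \<subseteq> C" using supp[OF S'(1) S(1) w'] wC' S' S by blast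
    have Cd: "C \<subseteq> {..<2 ^ d}" using Vd S by simp
    have inj: "inj_on cube_vertex C" using inj_cube_vertex inj_on_subset by blast
    have off: "w v = 0 \<and> w' v = 0" if "v \<notin> C" for v using wC w'C that by auto
    define U where "U v = w v - w' v" for v
    have ext: "(\<Sum>v\<in>C. U v * g v) = (\<Sum>v<2 ^ d. w v * g v) - (\<Sum>v<2 ^ d. w' v * g v)" for g
    proof -
      have "(\<Sum>v\<in>C. U v * g v) = (\<Sum>v<2 ^ d. U v * g v)"
        using Cd by (intro sum.mono_neutral_left) (auto simp: U_def off)
      then show ?thesis by (simp add: U_def algebra_simps sum_subtractf)
    qed
    have U1: "sum U C = 0" using ext[of "\<lambda>_. 1"] w w' by (simp add: weights_def)
    have U2: "(\<Sum>v\<in>C. U v *\<^sub>R cube_vertex v) = 0"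
    proof (rule poly_mapping_eqI)
      fix j
      show "Poly_Mapping.lookup (\<Sum>v\<in>C. U v *\<^sub>R cube_vertex v) j = Poly_Mapping.lookup 0 j"
      proof (cases "j < d")
        case True
        then show ?thesis unfolding lookup_weighted_sum ext using w w' by (simp add: weights_def)
      next
        case False
        then have "(\<Sum>v\<in>C. U v * of_bool (bit v j)) = 0"
          using Cd bit_less_of_less_power[of _ d j] by (intro sum.neutral) fastforce
        then show ?thesis unfolding lookup_weighted_sum by simp
      qed
    qed
    have "U v = 0" if "v \<in> C" for v
    proof (rule ccontr)
      assume "U v \<noteq> 0"
      have "affine_dependent (cube_vertex ` C)"
      proof (subst affine_dependent_explicit_finite)
        show "finite (cube_vertex ` C)" using hull(3) S by simp
        show "\<exists>U. sum U (cube_vertex ` C) = 0 \<and> (\<exists>v\<in>cube_vertex ` C. U v \<noteq> 0) \<and>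
            (\<Sum>v\<in>cube_vertex ` C. U v *\<^sub>R v) = 0"
          using U1 U2 inj inj_cube_vertex \<open>U v \<noteq> 0\<close> that
          by (intro exI[of _ "\<lambda>y. U (inv cube_vertex y)"]) (auto simp: sum.reindex inv_f_f)
      qed
      then show False using hull(2) S by blast
    qed
    moreover have "w v = w' v" if "v \<notin> C" for v using off[OF that] by simp
    ultimately show "w = w'" by (metis U_def eq_iff_diff_eq_0 fun_eq_iff)
  qed
  then show ?thesis using finT card_image_le by blast
qed

section \<open>Bounds for the smallest triangulations\<close>

lemma cube_complex_0: "cube_complex 0 {{0}}"
  unfolding cube_complex_def
proof (intro conjI ballI allI impI)
  fix p :: "nat \<Rightarrow> real"
  show "\<exists>C\<in>{{0}}. \<exists>w. weights 0 p w \<and> {v. w v \<noteq> 0} \<subseteq> C"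
    by (auto simp: weights_def intro!: exI[of _ "\<lambda>v. of_bool (v = 0)"])
next
  fix C C' p w w' assume "weights 0 p w" "weights 0 p w'"
  then have w: "w 0 = 1" "\<And>v. v \<ge> 1 \<Longrightarrow> w v = 0" and w': "w' 0 = 1" "\<And>v. v \<ge> 1 \<Longrightarrow> w' v = 0"
    by (auto simp: weights_def)
  show "w = w'"
  proof
    fix v show "w v = w' v" using w w' by (cases "v = 0") auto
  qed
qed auto

lemma cube_complex_1: "cube_complex 1 {{0, 1}}"
  unfolding cube_complex_def
proof (intro conjI ballI allI impI)
  have two: "{..<2 ^ 1} = {0, 1 :: nat}" by auto
  {
    fix p :: "nat \<Rightarrow> real" assume p: "\<forall>j<1. 0 \<le> p j \<and> p j \<le> 1"
    define w where "w v = (if v = 0 then 1 - p 0 else if v = 1 then p 0 else 0)" for v :: nat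
    have "weights 1 p w"
      unfolding weights_def two using p by (auto simp: w_def bit_0 simp del: sum_mult_of_bool_eq)
    moreover have "{v. w v \<noteq> 0} \<subseteq> {0, 1}" by (auto simp: w_def)
    ultimately show "\<exists>C\<in>{{0, 1}}. \<exists>w. weights 1 p w \<and> {v. w v \<noteq> 0} \<subseteq> C" by blast
  }
  {
    fix C C' p w w' assume ww': "weights 1 p w" "weights 1 p w'"
    have *: "u 0 + u 1 = 1 \<and> u 1 = p 0 \<and> (\<forall>v\<ge>2. u v = 0)" if "weights 1 p u" for u
      using that unfolding weights_def two by (auto simp: bit_0 simp del: sum_mult_of_bool_eq)
    show "w = w'"
    proof
      fix v :: nat
      consider "v = 0" | "v = 1" | "v \<ge> 2" by linarith
      then show "w v = w' v"
        using *[OF ww'(1)] *[OF ww'(2)] by cases auto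
    qed
  }
  show "C \<subseteq> {..<2 ^ 1}" if "C \<in> {{0, 1}}" for C :: "nat set" using that by auto
qed auto

lemma cube_complex_mult:
  assumes A: "cube_complex k A" and B: "cube_complex n B"
  shows "\<exists>F. cube_complex (k + n) F \<and> card F \<le> card A * card B * ((k + n) choose k)"
proof -
  let ?T = "(\<lambda>C. C \<times> {0::nat}) ` A"
  have T: "prism_complex k 1 ?T" by (rule prism_complex_one[OF A])
  have c: "\<forall>u<2 ^ n. (0::nat) < 1" by simp
  have "card (product_cells k 1 ?T B (\<lambda>_. 0)) \<le>
    (\<Sum>\<sigma>\<in>B. \<Sum>\<tau>\<in>?T. \<Prod>i<1. staircase_count (card (colour_class \<tau> i)) (card {u\<in>\<sigma>. 0 = i}))"
    by (rule card_product_cells[OF T B c])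
  also have "\<dots> = (\<Sum>\<sigma>\<in>B. \<Sum>\<tau>\<in>?T. (k + n) choose k)"
  proof (intro sum.cong refl)
    fix \<sigma> \<tau> assume "\<sigma> \<in> B" "\<tau> \<in> ?T"
    then obtain C where C: "C \<in> A" "\<tau> = C \<times> {0}" by blast
    have "card \<sigma> = Suc n" "card C = Suc k" using A B C(1) \<open>\<sigma> \<in> B\<close> by (auto simp: cube_complex_def)
    moreover have "colour_class \<tau> 0 = C" using C by (simp add: colour_class_def)
    ultimately show "(\<Prod>i<1. staircase_count (card (colour_class \<tau> i)) (card {u\<in>\<sigma>. 0 = i})) = (k + n) choose k"
      by (simp add: staircase_count_Suc_Suc del: staircase_count.simps)
  qed
  also have "\<dots> = card B * (card ?T * ((k + n) choose k))" by simp
  also have "card ?T = card A"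
    by (intro card_image inj_onI) blast
  finally show ?thesis
    using cube_complex_product[OF T B c] by (intro exI[of _ "product_cells k 1 ?T B (\<lambda>_. 0)"]) (simp add: mult_ac)
qed

lemma cube_complex_exists: "\<exists>F. cube_complex n F"
proof (induction n)
  case 0
  then show ?case using cube_complex_0 by blast
next
  case (Suc n)
  then show ?case using cube_complex_mult[OF cube_complex_1] by (metis plus_1_eq_Suc)
qed

lemma phi_le:
  assumes "cube_complex d F"
  shows "phi d \<le> card F"
proof -
  let ?T = "(\<lambda>C. convex hull (cube_vertex ` C)) ` F"
  have "phi d \<le> card ?T"
    unfolding phi_def using triangulation_of_cube_complex[OF assms] by (intro Least_le) blast
  also have "\<dots> \<le> card F" using assms by (simp add: card_image_le cube_complex_def)
  finally show ?thesis .
qed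

text \<open>The two translations show that combinatorial and geometric triangulations have the same
  minimal size; the existence of a complex ensures that the \<open>LEAST\<close> defining
  \<open>phi\<close> is attained.\<close>

lemma phi_attained: "\<exists>F. cube_complex d F \<and> card F = phi d"
proof -
  obtain F0 where F0: "cube_complex d F0" using cube_complex_exists by blast
  have "\<exists>T. triangulation_of d (unit_cube d) T \<and> card T = phi d"
    unfolding phi_def by (rule LeastI_ex) (use triangulation_of_cube_complex[OF F0] in blast)
  then obtain F where "cube_complex d F" "card F \<le> phi d"
    using cube_complex_of_triangulation[OF F0] by metis
  then show ?thesis using phi_le[of d F] by (auto intro: antisym)
qed

lemma phi_pos: "0 < phi d"
proof -
  obtain F where F: "cube_complex d F" "card F = phi d" using phi_attained by blast
  have "F \<noteq> {}" using cube_complex_cover[OF F(1), of "\<lambda>_. 0"] by auto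
  then show ?thesis using F by (auto simp: cube_complex_def card_gt_0_iff)
qed

lemma phi_add_le: "phi (k + n) \<le> phi k * phi n * ((k + n) choose k)"
proof -
  obtain A B where "cube_complex k A" "card A = phi k" "cube_complex n B" "card B = phi n"
    using phi_attained by metis
  then show ?thesis using cube_complex_mult[of k A n B] phi_le by (metis order_trans)
qed

text \<open>\<open>cubic_mean r x\<close> is the expectation of \<open>(x + X)\<^sup>3\<close> for \<open>X\<close> binomially
  distributed with parameters \<open>r\<close> and 1/3.\<close>

definition cubic_mean :: "real \<Rightarrow> real \<Rightarrow> real" where
  "cubic_mean r x = (x + r / 3) ^ 3 + 3 * (x + r / 3) * (2 * r / 9) + 2 * r / 27"

text \<open>Conditioning on one further trial of probability 1/3. The terms of
  \<open>cubic_mean\<close> are the cube of the mean \<open>x + r/3\<close>, three times the mean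
  times the variance \<open>2r/9\<close>, and the third central moment \<open>2r/27\<close>.\<close>

lemma cubic_mean_step: "cubic_mean r (x + 1) + 2 * cubic_mean r x = 3 * cubic_mean (r + 1) x"
  by (simp add: cubic_mean_def power3_eq_cube) (simp add: field_simps)

text \<open>The variance and skewness terms are of lower order than the cube, and the shift from 1
  to 2 absorbs them. Only the leading term \<open>(r/3)^3\<close> influences the limit.\<close>

lemma cubic_mean_le: "0 \<le> r \<Longrightarrow> cubic_mean r 1 \<le> (r / 3 + 2) ^ 3"
  by (simp add: cubic_mean_def power3_eq_cube) (simp add: field_simps)

text \<open>The vertices are coloured one after the other, by the method of conditional expectations.\<close>

lemma exists_balanced_colouring:
  fixes \<alpha> :: "nat \<Rightarrow> real" and k n :: nat
  assumes F: "finite F" "\<And>\<sigma>. \<sigma> \<in> F \<Longrightarrow> finite \<sigma> \<and> card \<sigma> = n"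
  shows "\<exists>c. (\<forall>u. c u < 3) \<and>
    (\<Sum>\<sigma>\<in>F. \<Sum>i<3. \<alpha> i * cubic_mean (card {u\<in>\<sigma>. k \<le> u}) (1 + card {u\<in>\<sigma>. u < k \<and> c u = i}))
      \<le> card F * (\<Sum>i<3. \<alpha> i) * cubic_mean n 1"
proof (induction k)
  case 0
  have "(\<Sum>\<sigma>\<in>F. \<Sum>i<3. \<alpha> i * cubic_mean (card {u\<in>\<sigma>. 0 \<le> u}) (1 + card {u\<in>\<sigma>. u < 0 \<and> 0 = i}))
      = (\<Sum>\<sigma>\<in>F. \<Sum>i<3. \<alpha> i * cubic_mean n 1)"
    by (intro sum.cong refl) (use F in auto)
  also have "\<dots> = card F * (\<Sum>i<3. \<alpha> i) * cubic_mean n 1"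
    by (simp add: sum_distrib_right)
  finally show ?case by (intro exI[of _ "\<lambda>_. 0"]) auto
next
  case (Suc k)
  \<comment> \<open>The expected total of the costs \<open>\<alpha> i * (1 + s)^3\<close>, with
    \<open>s\<close> the number of vertices of colour \<open>i\<close> in \<sigma>, when the
    vertices below \<open>k\<close> are coloured by \<open>c\<close> and the others uniformly at
    random.\<close>
  define tot where "tot k c = (\<Sum>\<sigma>\<in>F. \<Sum>i<3. \<alpha> i * cubic_mean (card {u\<in>\<sigma>. k \<le> u}) (1 + card {u\<in>\<sigma>. u < k \<and> c u = i}))"
    for k and c :: "nat \<Rightarrow> nat"
  from Suc obtain c where c: "\<And>u. c u < 3" and le: "tot k c \<le> card F * (\<Sum>i<3. \<alpha> i) * cubic_mean n 1"
    by (auto simp: tot_def)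
  let ?t = "\<lambda>\<sigma> i k c. \<alpha> i * cubic_mean (card {u\<in>\<sigma>. k \<le> u}) (1 + card {u\<in>\<sigma>. u < k \<and> c u = i})"
  \<comment> \<open>Averaging over the three colours of the vertex \<open>k\<close>. If
    \<open>k\<close> lies in \<sigma>, exactly one of them raises the count of colour
    \<open>i\<close>, which is one trial of the binomial variable; otherwise nothing
    changes.\<close>
  have step: "(\<Sum>j<3. ?t \<sigma> i (Suc k) (c(k := j))) = 3 * ?t \<sigma> i k c" if \<sigma>: "\<sigma> \<in> F" and i: "i < 3" for \<sigma> i
  proof (cases "k \<in> \<sigma>")
    case False
    have "{u\<in>\<sigma>. Suc k \<le> u} = {u\<in>\<sigma>. k \<le> u}" using False by (auto simp: Suc_le_eq order_less_le)
    moreover have "{u\<in>\<sigma>. u < Suc k \<and> (c(k := j)) u = i} = {u\<in>\<sigma>. u < k \<and> c u = i}" for j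
      using False by (auto simp: less_Suc_eq)
    ultimately show ?thesis by simp
  next
    case True
    have fin: "finite \<sigma>" using F \<sigma> by blast
    have "{u\<in>\<sigma>. k \<le> u} = insert k {u\<in>\<sigma>. Suc k \<le> u}" using True by auto
    then have r: "card {u\<in>\<sigma>. k \<le> u} = Suc (card {u\<in>\<sigma>. Suc k \<le> u})" using fin by simp
    have "{u\<in>\<sigma>. u < Suc k \<and> (c(k := j)) u = i} =
        (if j = i then insert k {u\<in>\<sigma>. u < k \<and> c u = i} else {u\<in>\<sigma>. u < k \<and> c u = i})" for j
      using True by (auto simp: less_Suc_eq)
    then have s: "card {u\<in>\<sigma>. u < Suc k \<and> (c(k := j)) u = i} = card {u\<in>\<sigma>. u < k \<and> c u = i} + of_bool (j = i)" for j
      using fin by simp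
    define R X where "R = real (card {u\<in>\<sigma>. Suc k \<le> u})" and "X = 1 + real (card {u\<in>\<sigma>. u < k \<and> c u = i})"
    have "(\<Sum>j<3. ?t \<sigma> i (Suc k) (c(k := j))) = (\<Sum>j<3. \<alpha> i * cubic_mean R (X + of_bool (j = i)))"
      unfolding s by (simp add: R_def X_def add_ac)
    also have "\<dots> = \<alpha> i * (cubic_mean R (X + 1) + 2 * cubic_mean R X)"
    proof -
      consider "i = 0" | "i = 1" | "i = 2" using i by linarith
      then show ?thesis by cases (simp_all add: eval_nat_numeral algebra_simps)
    qed
    also have "\<dots> = 3 * (\<alpha> i * cubic_mean (R + 1) X)"
      by (simp add: cubic_mean_step)
    finally show ?thesis unfolding r by (simp add: R_def X_def add_ac)
  qed
  have "(\<Sum>j<3. tot (Suc k) (c(k := j))) = (\<Sum>\<sigma>\<in>F. \<Sum>j<3. \<Sum>i<3. ?t \<sigma> i (Suc k) (c(k := j)))"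
    unfolding tot_def by (rule sum.swap)
  also have "\<dots> = (\<Sum>\<sigma>\<in>F. \<Sum>i<3. \<Sum>j<3. ?t \<sigma> i (Suc k) (c(k := j)))"
    by (rule sum.cong[OF refl], rule sum.swap)
  also have "\<dots> = (\<Sum>\<sigma>\<in>F. \<Sum>i<3. 3 * ?t \<sigma> i k c)"
    using step by (intro sum.cong refl) blast
  also have "\<dots> = 3 * tot k c" by (simp add: tot_def sum_distrib_left)
  finally have sum3: "(\<Sum>j<3. tot (Suc k) (c(k := j))) = 3 * tot k c" .
  \<comment> \<open>One of the three choices is no worse than their average.\<close>
  have "\<exists>j<3. tot (Suc k) (c(k := j)) \<le> tot k c"
  proof (rule ccontr)
    assume "\<not> ?thesis"
    then have "(\<Sum>j<(3::nat). tot k c) < (\<Sum>j<3. tot (Suc k) (c(k := j)))"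
      by (intro sum_strict_mono) (auto simp: not_le lessThan_empty_iff)
    then show False using sum3 by simp
  qed
  then obtain j where j: "j < 3" "tot (Suc k) (c(k := j)) \<le> tot k c" by blast
  show ?case
    using j c le by (intro exI[of _ "c(k := j)"]) (auto simp: tot_def)
qed

text \<open>For \<open>s > 0\<close> the count is \<open>s (s+1) ... (s+t-1) / t!\<close>. The mean
  of these \<open>t\<close> factors is \<open>s + (t-1)/2\<close>, which is at most
  \<open>s + 1\<close> for \<open>t \<le> 3\<close>.\<close>

lemma staircase_count_le:
  assumes "t \<le> 3"
  shows "real (staircase_count (Suc t) s) \<le> (real s + 1) ^ t / fact t"
proof (cases s)
  case 0
  then show ?thesis by (cases t) simp_all
next
  case (Suc s')
  have eq: "real (staircase_count (Suc t) s) = real ((t + s') choose t)"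
    using Suc by (simp add: staircase_count_Suc_Suc del: staircase_count.simps)
  consider "t = 0" | "t = 1" | "t = 2" | "t = 3" using assms by linarith
  then show ?thesis
  proof cases
    case 3
    have "real ((2 + s') choose 2) = (real s' + 2) * (real s' + 1) / 2"
      using binomial_gbinomial[of "2 + s'" 2, where 'a = real]
      by (simp add: gbinomial_prod_rev eval_nat_numeral algebra_simps)
    then show ?thesis using 3 Suc eq by (simp add: power2_eq_square) (simp add: field_simps)
  next
    case 4
    have "real ((3 + s') choose 3) = (real s' + 3) * (real s' + 2) * (real s' + 1) / 6"
      using binomial_gbinomial[of "3 + s'" 3, where 'a = real]
      by (simp add: gbinomial_prod_rev eval_nat_numeral algebra_simps)
    then show ?thesis using 4 Suc eq by (simp add: power3_eq_cube fact_numeral) (simp add: field_simps)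
  qed (use Suc eq in auto)
qed

lemma le_3_cases:
  fixes a :: nat
  assumes "a \<le> 3"
  obtains "a = 0" | "a = 1" | "a = 2" | "a = 3"
  using assms by linarith

text \<open>The weighted inequality of arithmetic and geometric means. It removes the products of
  counts of different colours, so that each colour can be averaged on its own.\<close>

lemma cubic_monomial_le:
  fixes x y z :: real
  assumes "0 \<le> x" "0 \<le> y" "0 \<le> z" "a + b + c = 3"
  shows "x ^ a * y ^ b * z ^ c \<le> (a * x ^ 3 + b * y ^ 3 + c * z ^ 3) / 3"
proof -
  have two: "u * u * v \<le> (2 * u ^ 3 + v ^ 3) / 3" if "0 \<le> u" "0 \<le> v" for u v :: real
  proof -
    have "0 \<le> (u - v)\<^sup>2 * (2 * u + v)" using that by simp
    then show ?thesis by (simp add: power2_eq_square power3_eq_cube algebra_simps)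
  qed
  have three: "x * y * z \<le> (x ^ 3 + y ^ 3 + z ^ 3) / 3"
  proof -
    have "0 \<le> (x + y + z) * ((x - y)\<^sup>2 + (y - z)\<^sup>2 + (z - x)\<^sup>2)" using assms by simp
    then show ?thesis by (simp add: power2_eq_square power3_eq_cube algebra_simps)
  qed
  have "a \<le> 3" "b \<le> 3" using assms(4) by auto
  then consider "a = 0 \<and> b = 0 \<and> c = 3" | "a = 0 \<and> b = 1 \<and> c = 2" | "a = 0 \<and> b = 2 \<and> c = 1"
    | "a = 0 \<and> b = 3 \<and> c = 0" | "a = 1 \<and> b = 0 \<and> c = 2" | "a = 1 \<and> b = 1 \<and> c = 1"
    | "a = 1 \<and> b = 2 \<and> c = 0" | "a = 2 \<and> b = 0 \<and> c = 1" | "a = 2 \<and> b = 1 \<and> c = 0"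
    | "a = 3 \<and> b = 0 \<and> c = 0" using assms(4) by (elim le_3_cases) auto
  then show ?thesis
    using two[OF assms(1,2)] two[OF assms(2,1)] two[OF assms(1,3)] two[OF assms(3,1)]
      two[OF assms(2,3)] two[OF assms(3,2)] three
    by cases (simp_all add: power2_eq_square mult_ac add_ac)
qed

text \<open>The leading coefficient of the number of product cells that \<tau> yields over a
  simplex, as a polynomial in the numbers of its vertices of each colour.\<close>

definition prism_weight :: "(nat \<times> nat) set \<Rightarrow> real" where
  "prism_weight \<tau> = (\<Prod>i<3. 1 / fact (card (colour_class \<tau> i) - 1))"

lemma phi_add_3_le:
  assumes T: "prism_complex 3 3 T"
  shows "real (phi (n + 3)) \<le> real (phi n) * (\<Sum>\<tau>\<in>T. prism_weight \<tau>) * ((real n + 1) / 3 + 2) ^ 3"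
proof -
  obtain F where F: "cube_complex n F" and cardF: "card F = phi n" using phi_attained by blast
  define a where "a \<tau> i = card (colour_class \<tau> i) - 1" for \<tau> :: "(nat \<times> nat) set" and i
  \<comment> \<open>The total coefficient of the cube of the count of colour \<open>i\<close>, after
    the mean inequality has been applied to every prism cell. As the degrees of a cell add up to 3,
    the three coefficients add up to the total weight of \<open>T\<close>.\<close>
  define \<alpha> where "\<alpha> i = (\<Sum>\<tau>\<in>T. prism_weight \<tau> * (real (a \<tau> i) / 3))" for i
  have finF: "finite F" and cell: "\<And>\<sigma>. \<sigma> \<in> F \<Longrightarrow> \<sigma> \<subseteq> {..<2 ^ n} \<and> finite \<sigma> \<and> card \<sigma> = n + 1"
    using F finite_subset by (auto simp: cube_complex_def)
  obtain c where c: "\<And>u. c u < 3" and bal: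
    "(\<Sum>\<sigma>\<in>F. \<Sum>i<3. \<alpha> i * cubic_mean (card {u\<in>\<sigma>. 2 ^ n \<le> u}) (1 + card {u\<in>\<sigma>. u < 2 ^ n \<and> c u = i}))
      \<le> card F * (\<Sum>i<3. \<alpha> i) * cubic_mean (n + 1) 1"
    using exists_balanced_colouring[OF finF, of "n + 1" \<alpha> "2 ^ n"] cell by auto
  have c3: "\<forall>u<2 ^ n. c u < 3" using c by simp
  define s where "s \<sigma> i = card {u\<in>\<sigma>. c u = i}" for \<sigma> i
  have w0: "0 \<le> prism_weight \<tau>" for \<tau> by (simp add: prism_weight_def prod_nonneg)
  have a3: "a \<tau> 0 + a \<tau> 1 + a \<tau> 2 = 3"
    and ac: "\<And>i. i < 3 \<Longrightarrow> card (colour_class \<tau> i) = Suc (a \<tau> i)" if \<tau>: "\<tau> \<in> T" for \<tau>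
  proof -
    obtain \<sigma> where \<sigma>: "\<sigma> \<in> F" using phi_pos[of n] cardF by (metis card.empty ex_in_conv less_irrefl)
    have "card (colour_class \<tau> i) > 0" if "i < 3" for i
      using T_cell(4,6)[OF T F c3 \<tau>] that by (simp add: card_gt_0_iff)
    then show ac: "\<And>i. i < 3 \<Longrightarrow> card (colour_class \<tau> i) = Suc (a \<tau> i)" by (simp add: a_def)
    have "(\<Sum>i<3. Suc (a \<tau> i)) = 6"
      using sum_card_colour(1)[OF T F c3 \<tau> \<sigma>] ac by simp
    then show "a \<tau> 0 + a \<tau> 1 + a \<tau> 2 = 3" by (simp add: eval_nat_numeral)
  qed
  have bound: "real (\<Prod>i<3. staircase_count (card (colour_class \<tau> i)) (s \<sigma> i))
      \<le> prism_weight \<tau> * (\<Sum>i<3. real (a \<tau> i) / 3 * (real (s \<sigma> i) + 1) ^ 3)" if \<tau>: "\<tau> \<in> T" for \<tau> \<sigma>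
  proof -
    have "real (\<Prod>i<3. staircase_count (card (colour_class \<tau> i)) (s \<sigma> i))
        = (\<Prod>i<3. real (staircase_count (Suc (a \<tau> i)) (s \<sigma> i)))"
      using ac[OF \<tau>] by simp
    also have "\<dots> \<le> (\<Prod>i<3. (real (s \<sigma> i) + 1) ^ a \<tau> i / fact (a \<tau> i))"
    proof (intro prod_mono conjI)
      fix i :: nat assume "i \<in> {..<3}"
      then have "i = 0 \<or> i = 1 \<or> i = 2" by auto
      then have "a \<tau> i \<le> 3" using a3[OF \<tau>] by auto
      then show "real (staircase_count (Suc (a \<tau> i)) (s \<sigma> i)) \<le> (real (s \<sigma> i) + 1) ^ a \<tau> i / fact (a \<tau> i)"
        by (rule staircase_count_le)
    qed simp
    also have "\<dots> = prism_weight \<tau> * (\<Prod>i<3. (real (s \<sigma> i) + 1) ^ a \<tau> i)"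
      unfolding prism_weight_def a_def[symmetric] prod.distrib[symmetric] by simp
    also have "(\<Prod>i<3. (real (s \<sigma> i) + 1) ^ a \<tau> i) \<le> (\<Sum>i<3. real (a \<tau> i) / 3 * (real (s \<sigma> i) + 1) ^ 3)"
      using cubic_monomial_le[OF _ _ _ a3[OF \<tau>], of "real (s \<sigma> 0) + 1" "real (s \<sigma> 1) + 1" "real (s \<sigma> 2) + 1"]
      by (simp add: eval_nat_numeral add_divide_distrib)
    finally show ?thesis using w0[of \<tau>] by (simp add: mult_left_mono)
  qed
  have "real (phi (n + 3)) \<le> card (product_cells 3 3 T F c)"
    using phi_le[OF cube_complex_product[OF T F c3]] by (simp add: add.commute)
  also have "\<dots> \<le> (\<Sum>\<sigma>\<in>F. \<Sum>\<tau>\<in>T. real (\<Prod>i<3. staircase_count (card (colour_class \<tau> i)) (s \<sigma> i)))"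
    using card_product_cells[OF T F c3] unfolding s_def by (simp flip: of_nat_sum of_nat_prod)
  also have "\<dots> \<le> (\<Sum>\<sigma>\<in>F. \<Sum>\<tau>\<in>T. prism_weight \<tau> * (\<Sum>i<3. real (a \<tau> i) / 3 * (real (s \<sigma> i) + 1) ^ 3))"
    by (intro sum_mono bound)
  also have "\<dots> = (\<Sum>\<sigma>\<in>F. \<Sum>i<3. \<alpha> i * (real (s \<sigma> i) + 1) ^ 3)"
    unfolding \<alpha>_def sum_distrib_left sum_distrib_right
    by (intro sum.cong refl, subst sum.swap) (simp add: mult_ac)
  also have "\<dots> = (\<Sum>\<sigma>\<in>F. \<Sum>i<3. \<alpha> i * cubic_mean (card {u\<in>\<sigma>. 2 ^ n \<le> u}) (1 + card {u\<in>\<sigma>. u < 2 ^ n \<and> c u = i}))"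
  proof (intro sum.cong refl)
    fix \<sigma> i assume \<sigma>: "\<sigma> \<in> F"
    \<comment> \<open>At stage \<open>2 ^ n\<close> no vertex is left to colour, and
      \<open>cubic_mean 0 x\<close> is just \<open>x^3\<close>.\<close>
    have "{u\<in>\<sigma>. 2 ^ n \<le> u} = {}" "{u\<in>\<sigma>. u < 2 ^ n \<and> c u = i} = {u\<in>\<sigma>. c u = i}"
      using cell[OF \<sigma>] by (auto simp: not_le[symmetric])
    then have "card {u\<in>\<sigma>. 2 ^ n \<le> u} = 0" "card {u\<in>\<sigma>. u < 2 ^ n \<and> c u = i} = s \<sigma> i"
      by (simp_all only: card.empty s_def)
    then show "\<alpha> i * (real (s \<sigma> i) + 1) ^ 3 =
      \<alpha> i * cubic_mean (card {u\<in>\<sigma>. 2 ^ n \<le> u}) (1 + card {u\<in>\<sigma>. u < 2 ^ n \<and> c u = i})"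
      by (simp add: cubic_mean_def add_ac)
  qed
  also note bal
  also have "(\<Sum>i<3. \<alpha> i) = (\<Sum>\<tau>\<in>T. prism_weight \<tau>)"
  proof -
    have "(\<Sum>i<3. \<alpha> i) = (\<Sum>\<tau>\<in>T. prism_weight \<tau> * (\<Sum>i<3. real (a \<tau> i) / 3))"
      unfolding \<alpha>_def by (subst sum.swap) (simp add: sum_distrib_left)
    also have "\<dots> = (\<Sum>\<tau>\<in>T. prism_weight \<tau>)"
    proof (intro sum.cong refl)
      fix \<tau> assume "\<tau> \<in> T"
      have "(\<Sum>i<3. real (a \<tau> i) / 3) = real (a \<tau> 0 + a \<tau> 1 + a \<tau> 2) / 3"
        by (simp add: eval_nat_numeral add_divide_distrib)
      then show "prism_weight \<tau> * (\<Sum>i<3. real (a \<tau> i) / 3) = prism_weight \<tau>"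
        using a3[OF \<open>\<tau> \<in> T\<close>] by simp
    qed
    finally show ?thesis .
  qed
  also have "card F * (\<Sum>\<tau>\<in>T. prism_weight \<tau>) * cubic_mean (n + 1) 1
      \<le> card F * (\<Sum>\<tau>\<in>T. prism_weight \<tau>) * ((real n + 1) / 3 + 2) ^ 3"
    using cubic_mean_le[of "real (n + 1)"] w0 by (intro mult_left_mono mult_nonneg_nonneg sum_nonneg) (auto simp: add_ac)
  finally show ?thesis by (simp add: cardF)
qed

section \<open>The limit of the efficiencies\<close>

text \<open>Fekete's lemma in multiplicative form, with the infimum of the roots as limit. For
  \<open>d\<close> with a nearly minimal root and \<open>n = q * d + s\<close>, the remainder
  contributes a bounded factor, whose n-th root tends to 1.\<close>

lemma submultiplicative_root_convergent:
  fixes f :: "nat \<Rightarrow> real"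
  assumes pos: "\<And>n. 0 < f n" and sub: "\<And>k n. f (k + n) \<le> f k * f n"
  shows "\<exists>L. (\<lambda>n. root n (f n)) \<longlonglongrightarrow> L \<and> 0 \<le> L \<and> (\<forall>n. L ^ n \<le> f n)"
proof -
  define L where "L = (INF n\<in>{1..}. root n (f n))"
  have bdd: "bdd_below ((\<lambda>n. root n (f n)) ` {1..})"
    using pos by (intro bdd_belowI[of _ 0]) (auto intro: less_imp_le)
  have le: "L \<le> root n (f n)" if "n \<ge> 1" for n
    unfolding L_def using that bdd by (intro cINF_lower) auto
  have L0: "0 \<le> L"
    unfolding L_def using pos by (intro cINF_greatest) (auto intro: less_imp_le)
  have lim: "(\<lambda>n. root n (f n)) \<longlonglongrightarrow> L"
  proof (rule LIMSEQ_I)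
    fix e :: real assume e: "0 < e"
    have "\<exists>d\<in>{1..}. root d (f d) < L + e / 2"
      using cINF_less_iff[OF _ bdd, of "L + e / 2"] e by (simp add: L_def)
    then obtain d where d: "d \<ge> 1" "root d (f d) < L + e / 2" by auto
    define r where "r = root d (f d)"
    have r: "0 < r" "r ^ d = f d" using d pos[of d] by (auto simp: r_def less_imp_le)
    \<comment> \<open>Finitely many remainders \<open>s < d\<close> occur, so one constant bounds
      \<open>f s\<close> relative to \<open>r ^ s\<close>.\<close>
    define K where "K = Max ((\<lambda>s. f s / r ^ s) ` {..<d})"
    have K: "f s / r ^ s \<le> K" if "s < d" for s
      unfolding K_def using that by (intro Max_ge) auto
    have "0 < f 0 / r ^ 0" using pos by simp
    also have "\<dots> \<le> K" using d by (intro K) auto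
    finally have K0: "0 < K" .
    have fq: "f (q * d + s) \<le> r ^ (q * d) * f s" for q s
    proof (induction q)
      case (Suc q)
      have "f (Suc q * d + s) \<le> f d * f (q * d + s)" using sub[of d "q * d + s"] by (simp add: add_ac)
      also have "\<dots> \<le> r ^ d * (r ^ (q * d) * f s)" using Suc r pos[of d] by simp
      finally show ?case by (simp add: power_add mult_ac)
    qed simp
    have bound: "f n \<le> K * r ^ n" for n
    proof -
      have "f n \<le> r ^ (n div d * d) * f (n mod d)" using fq[of "n div d" "n mod d"] by simp
      also have "f (n mod d) \<le> K * r ^ (n mod d)"
        using K[of "n mod d"] d r by (simp add: divide_le_eq)
      also have "r ^ (n div d * d) * (K * r ^ (n mod d)) = K * r ^ (n div d * d + n mod d)"
        by (simp only: power_add mult_ac)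
      finally show ?thesis using r by (simp add: mult_left_mono)
    qed
    have "(\<lambda>n. root n K * r) \<longlonglongrightarrow> 1 * r"
      using LIMSEQ_root_const[OF K0] by (intro tendsto_mult) auto
    moreover have "1 * r < L + e" using d(2) e by (simp add: r_def)
    ultimately have "eventually (\<lambda>n. root n K * r < L + e) sequentially"
      by (rule order_tendstoD)
    then obtain N where N: "\<And>n. n \<ge> N \<Longrightarrow> root n K * r < L + e"
      by (auto simp: eventually_sequentially)
    show "\<exists>N. \<forall>n\<ge>N. norm (root n (f n) - L) < e"
    proof (intro exI allI impI)
      fix n assume n: "max N 1 \<le> n"
      have "root n (f n) \<le> root n (K * r ^ n)" using n bound by simp
      also have "\<dots> = root n K * r" using n r by (simp add: real_root_mult real_root_power_cancel)
      also have "\<dots> < L + e" using N n by simp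
      finally show "norm (root n (f n) - L) < e" using le[of n] n by simp
    qed
  qed
  have "L ^ n \<le> f n" for n
  proof (cases "n = 0")
    case True
    \<comment> \<open>Exponent 0 is not covered by the infimum; submultiplicativity itself gives
      \<open>1 \<le> f 0\<close>.\<close>
    have "f 0 \<le> f 0 * f 0" using sub[of 0 0] by simp
    then show ?thesis using True pos[of 0] by simp
  next
    case False
    then have "L ^ n \<le> root n (f n) ^ n" using le[of n] L0 by (intro power_mono) auto
    then show ?thesis using False pos[of n] by (simp add: less_imp_le)
  qed
  then show ?thesis using lim L0 by blast
qed

text \<open>If \<open>L ^ b\<close> exceeded \<kappa>, a constant \<kappa>' strictly between them
  would bound the growth of \<open>f\<close> along the progression \<open>N + j * b\<close> by the
  factor \<kappa>' per step, while \<open>f\<close> stays above the powers of \<open>L\<close>,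
  which grow by \<open>L ^ b\<close>.\<close>

lemma growth_bound:
  fixes f :: "nat \<Rightarrow> real" and b :: nat
  assumes pos: "\<And>n. 0 < f n" and L: "0 \<le> L" "\<And>n. L ^ n \<le> f n"
    and \<kappa>: "0 < \<kappa>" and step: "\<And>n. f (n + b) \<le> f n * (\<kappa> * r n)" and r: "r \<longlonglongrightarrow> 1"
  shows "L ^ b \<le> \<kappa>"
proof (rule ccontr)
  assume "\<not> L ^ b \<le> \<kappa>"
  then have lt: "\<kappa> < L ^ b" by simp
  define \<kappa>' where "\<kappa>' = (\<kappa> + L ^ b) / 2"
  have \<kappa>': "\<kappa> < \<kappa>'" "\<kappa>' < L ^ b" "0 < \<kappa>'" using lt \<kappa> by (auto simp: \<kappa>'_def)
  have "(\<lambda>n. \<kappa> * r n) \<longlonglongrightarrow> \<kappa> * 1" using r by (intro tendsto_intros)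
  then have "eventually (\<lambda>n. \<kappa> * r n < \<kappa>') sequentially" using \<kappa>' by (intro order_tendstoD) auto
  then obtain N where N: "\<And>n. n \<ge> N \<Longrightarrow> \<kappa> * r n < \<kappa>'" by (auto simp: eventually_sequentially)
  have it: "f (N + j * b) \<le> f N * \<kappa>' ^ j" for j
  proof (induction j)
    case (Suc j)
    have "f (N + Suc j * b) \<le> f (N + j * b) * (\<kappa> * r (N + j * b))"
      using step[of "N + j * b"] by (simp add: add_ac)
    also have "\<dots> \<le> f (N + j * b) * \<kappa>'"
      using N[of "N + j * b"] pos[of "N + j * b"] by (intro mult_left_mono) auto
    also have "\<dots> \<le> (f N * \<kappa>' ^ j) * \<kappa>'" using Suc \<kappa>' by (intro mult_right_mono) auto
    finally show ?case by (simp add: mult_ac)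
  qed simp
  have Lb: "0 < L ^ b" using \<kappa>' by linarith
  have LN: "0 < L ^ N"
  proof (cases "L = 0")
    case True
    \<comment> \<open>For \<open>L = 0\<close> the power \<open>L ^ b\<close> is positive only as
      \<open>0 ^ 0 = 1\<close>. Then \<kappa>' < 1, and a step of length 0 yields
      \<open>f N < f N\<close>.\<close>
    have "b = 0" using Lb True by (cases b) auto
    then have "\<kappa>' < 1" using \<kappa>' by simp
    then have "f N * \<kappa>' < f N" using pos[of N] by simp
    then show ?thesis using it[of 1] \<open>b = 0\<close> by simp
  qed (use L in simp)
  have "1 < L ^ b / \<kappa>'" using \<kappa>' by simp
  then obtain j where j: "f N / L ^ N < (L ^ b / \<kappa>') ^ j" using real_arch_pow by blast
  have "L ^ N * (L ^ b) ^ j \<le> f N * \<kappa>' ^ j"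
    using L(2)[of "N + j * b"] it[of j] by (simp add: power_add power_mult[symmetric] mult.commute)
  then have "(L ^ b / \<kappa>') ^ j \<le> f N / L ^ N"
    using LN \<kappa>' by (simp add: power_divide field_simps)
  then show False using j by simp
qed

lemma rho_convergent_le:
  assumes T: "prism_complex 3 3 T" and W: "(\<Sum>\<tau>\<in>T. prism_weight \<tau>) \<le> W" "0 < W"
  shows "convergent rho \<and> lim rho \<le> root 3 (W / 27)"
proof -
  define f where "f d = real (phi d) / fact d" for d
  have f0: "0 < f d" for d using phi_pos[of d] by (simp add: f_def)
  have fsub: "f (k + n) \<le> f k * f n" for k n
  proof -
    have "real (phi (k + n)) \<le> real (phi k * phi n * ((k + n) choose k))"
      using phi_add_le by (simp only: of_nat_le_iff)
    also have "\<dots> = real (phi k) * real (phi n) * (fact (k + n) / (fact k * fact n))"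
      by (simp add: binomial_fact)
    finally show ?thesis by (simp add: f_def field_simps)
  qed
  have rho: "rho = (\<lambda>d. root d (f d))" by (simp add: rho_def f_def fun_eq_iff)
  obtain L where lim: "rho \<longlonglongrightarrow> L" and L: "0 \<le> L" "\<And>n. L ^ n \<le> f n"
    using submultiplicative_root_convergent[of f, OF f0 fsub] unfolding rho by blast
  \<comment> \<open>The cube \<open>((n+1)/3 + 2)^3\<close> equals \<open>(n+7)^3 / 27\<close>, and
    the denominator is \<open>fact (n + 3) / fact n\<close>. The quotient tends to 1 once the 27 is
    moved into the constant.\<close>
  define r where "r n = (real n + 7) ^ 3 / ((real n + 1) * (real n + 2) * (real n + 3))" for n
  have step: "f (n + 3) \<le> f n * (W / 27 * r n)" for n
  proof -
    have "real (phi (n + 3)) \<le> real (phi n) * (\<Sum>\<tau>\<in>T. prism_weight \<tau>) * ((real n + 1) / 3 + 2) ^ 3"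
      by (rule phi_add_3_le[OF T])
    also have "\<dots> \<le> real (phi n) * W * ((real n + 1) / 3 + 2) ^ 3"
      using W(1) by (intro mult_right_mono mult_left_mono) auto
    also have "\<dots> = real (phi n) * (W / 27 * (real n + 7) ^ 3)"
      by (simp add: power3_eq_cube field_simps)
    finally have "f (n + 3) \<le> real (phi n) * (W / 27 * (real n + 7) ^ 3) / fact (n + 3)"
      unfolding f_def by (intro divide_right_mono) auto
    also have "fact (n + 3) = fact n * ((real n + 1) * (real n + 2) * (real n + 3))"
      by (simp add: eval_nat_numeral algebra_simps)
    finally show ?thesis by (simp add: f_def r_def mult_ac)
  qed
  have "r \<longlonglongrightarrow> 1" unfolding r_def by real_asymp
  then have "L ^ 3 \<le> W / 27"
    using growth_bound[of f L "W / 27" 3 r] f0 L step W(2) by auto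
  then have "L \<le> root 3 (W / 27)"
    using L(1) by (metis real_root_le_iff real_root_pos2 zero_less_numeral)
  then show ?thesis using lim by (auto simp: convergent_def dest: limI)
qed

section \<open>Regular triangulations of prisms\<close>

text \<open>The vertices of the simplex are unit vectors, so the last \<open>m\<close> coordinates
  add up to 1 on the prism. Affine functions thus become linear forms without constant term. Integer
  values permit exact evaluation.\<close>

definition prism_coord :: "nat \<Rightarrow> nat \<times> nat \<Rightarrow> nat \<Rightarrow> int" where
  "prism_coord k a j = (if j < k then of_bool (bit (fst a) j) else of_bool (j = k + snd a))"

lemma finite_prism_vertices [simp]: "finite (prism_vertices k m)"
  by (simp add: prism_vertices_def)

lemma sum_snd_eq:
  fixes w :: "nat \<times> nat \<Rightarrow> real"
  assumes "i < m"
  shows "(\<Sum>a\<in>prism_vertices k m. w a * of_bool (i = snd a)) = (\<Sum>v<2^k. w (v, i))"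
proof -
  have "(\<Sum>a\<in>prism_vertices k m. w a * of_bool (i = snd a))
      = (\<Sum>v<2^k. \<Sum>i'<m. w (v, i') * of_bool (i = i'))"
    unfolding prism_vertices_def by (simp add: sum.cartesian_product split_def del: sum_mult_of_bool_eq)
  also have "\<dots> = (\<Sum>v<2^k. w (v, i))"
  proof (rule sum.cong[OF refl])
    fix v
    have "(\<Sum>i'<m. w (v, i') * of_bool (i = i')) = (\<Sum>i'<m. if i' = i then w (v, i) else 0)"
      by (rule sum.cong) auto
    then show "(\<Sum>i'<m. w (v, i') * of_bool (i = i')) = w (v, i)"
      using assms by simp
  qed
  finally show ?thesis .
qed

lemma prism_weights_coord:
  assumes "j < k + m"
    and "\<And>i. i < m \<Longrightarrow> (\<Sum>v<2^k. w (v, i)) = \<mu> i"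
    and "\<And>j. j < k \<Longrightarrow> (\<Sum>a\<in>prism_vertices k m. w a * of_bool (bit (fst a) j)) = p j"
  shows "(\<Sum>a\<in>prism_vertices k m. w a * real_of_int (prism_coord k a j)) =
      (if j < k then p j else \<mu> (j - k))"
proof (cases "j < k")
  case True
  then show ?thesis using assms(3) by (simp add: prism_coord_def)
next
  case False
  have "(\<Sum>a\<in>prism_vertices k m. w a * real_of_int (prism_coord k a j))
      = (\<Sum>a\<in>prism_vertices k m. w a * of_bool (j - k = snd a))"
    using False by (intro sum.cong) (auto simp: prism_coord_def)
  also have "\<dots> = \<mu> (j - k)"
    using False assms(1,2) by (subst sum_snd_eq) auto
  finally show ?thesis using False by simp
qed

text \<open>
  Here \<open>L x a\<close> is \<open>D x\<close> times the barycentric coordinate belonging to the vertex \<open>a\<close> of \<open>cell x\<close>, so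
  that \<open>\<Sum>a\<in>cell x. h a * L x a b\<close> is \<open>D x\<close> times the affine function that interpolates the heights \<open>h\<close> on
  \<open>cell x\<close>. A point of the prism lies in the cell whose interpolating function is largest there: if
  its barycentric coordinate at \<open>a\<close> were negative, the neighbour opposite to \<open>a\<close> would do better.
\<close>

lemma regular_prism_complex:
  fixes T :: "'x set" and cell :: "'x \<Rightarrow> (nat \<times> nat) set" and D :: "'x \<Rightarrow> int"
    and lam :: "'x \<Rightarrow> nat \<times> nat \<Rightarrow> nat \<Rightarrow> int" and h :: "nat \<times> nat \<Rightarrow> int"
    and k m :: nat
  defines "L \<equiv> \<lambda>x a b. \<Sum>j<k+m. lam x a j * prism_coord k b j"
    and "V \<equiv> prism_vertices k m"
    and "FJ \<equiv> \<lambda>J. {x\<in>T. \<forall>i<m. i \<notin> J \<longrightarrow> card (colour_class (cell x) i) = 1}"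
  assumes cube: "\<And>p. \<forall>j<k. 0 \<le> p j \<and> p j \<le> 1 \<Longrightarrow> \<exists>w. weights k p w"
    and finT: "finite T"
    and cell: "\<And>x. x \<in> T \<Longrightarrow> cell x \<subseteq> V \<and> card (cell x) = k + m \<and> (\<forall>i<m. colour_class (cell x) i \<noteq> {})"
    and D: "\<And>x. x \<in> T \<Longrightarrow> 0 < D x"
    and dual: "\<And>x a b. x \<in> T \<Longrightarrow> a \<in> cell x \<Longrightarrow> b \<in> cell x \<Longrightarrow> L x a b = (if a = b then D x else 0)"
    and span: "\<And>x j j'. x \<in> T \<Longrightarrow> j < k + m \<Longrightarrow> j' < k + m \<Longrightarrow>
      (\<Sum>a\<in>cell x. prism_coord k a j * lam x a j') = (if j = j' then D x else 0)"
    and height: "\<And>x b. x \<in> T \<Longrightarrow> b \<in> V - cell x \<Longrightarrow> (\<Sum>a\<in>cell x. h a * L x a b) < D x * h b"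
    and nonempty: "\<And>J. J \<subseteq> {..<m} \<Longrightarrow> J \<noteq> {} \<Longrightarrow> FJ J \<noteq> {}"
    and nbr: "\<And>J x a. J \<subseteq> {..<m} \<Longrightarrow> J \<noteq> {} \<Longrightarrow> x \<in> FJ J \<Longrightarrow> a \<in> cell x \<Longrightarrow> snd a \<in> J \<Longrightarrow>
      (\<forall>b\<in>V. snd b \<in> J \<longrightarrow> 0 \<le> L x a b) \<or>
      (\<exists>x'\<in>FJ J. {c\<in>cell x. snd c \<in> J} - {a} \<subseteq> cell x' \<and> a \<notin> cell x')"
  shows "prism_complex k m (cell ` T)"
proof -
  define lm where "lm x a j = real_of_int (lam x a j) / real_of_int (D x)" for x a j
  define co where "co a j = real_of_int (prism_coord k a j)" for a j
  define Lr where "Lr x a b = (\<Sum>j<k+m. lm x a j * co b j)" for x a b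
  define hr where "hr a = real_of_int (h a)" for a
  define Lx where "Lx x a X = (\<Sum>j<k+m. lm x a j * X j)" for x a and X :: "nat \<Rightarrow> real"
  have Lx_co: "Lx x a (co b) = Lr x a b" for x a b by (simp add: Lx_def Lr_def)
  have Lr: "Lr x a b = real_of_int (L x a b) / real_of_int (D x)" for x a b
    by (simp add: Lr_def L_def lm_def co_def sum_divide_distrib)
  have fincell: "finite (cell x)" if "x \<in> T" for x
    using cell[OF that] finite_subset unfolding V_def by (meson finite_prism_vertices)
  have dualr: "Lr x a b = of_bool (a = b)" if "x \<in> T" "a \<in> cell x" "b \<in> cell x" for x a b
    using dual[OF that] D[OF that(1)] by (simp add: Lr)
  have spanr: "(\<Sum>a\<in>cell x. co a j * lm x a j') = of_bool (j = j')"
    if "x \<in> T" "j < k + m" "j' < k + m" for x j j'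
  proof -
    have "(\<Sum>a\<in>cell x. co a j * lm x a j') = real_of_int (\<Sum>a\<in>cell x. prism_coord k a j * lam x a j') / real_of_int (D x)"
      by (simp add: co_def lm_def sum_divide_distrib)
    then show ?thesis using span[OF that] D[OF that(1)] by simp
  qed
  \<comment> \<open>Up to the factor \<open>D x\<close>, the coefficient rows and the vertices of a
    cell are inverse matrices, so every vector \<open>X\<close> is expanded in the vertices of the
    cell; the coefficients may be negative.\<close>
  have lam_expand: "(\<Sum>a\<in>cell x. Lx x a X * co a j) = X j" if "x \<in> T" "j < k + m" for x X j
  proof -
    have "(\<Sum>a\<in>cell x. Lx x a X * co a j) = (\<Sum>a\<in>cell x. \<Sum>j'<k+m. (co a j * lm x a j') * X j')"
      by (simp add: Lx_def sum_distrib_right sum_distrib_left mult_ac)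
    also have "\<dots> = (\<Sum>j'<k+m. (\<Sum>a\<in>cell x. co a j * lm x a j') * X j')"
      by (subst sum.swap) (simp add: sum_distrib_right)
    also have "\<dots> = (\<Sum>j'<k+m. if j' = j then X j else 0)"
      using that by (intro sum.cong) (auto simp: spanr)
    finally show ?thesis using that by simp
  qed
  define el where "el x X = (\<Sum>a\<in>cell x. hr a * Lx x a X)" for x X
  have el_cell: "el x (co b) = hr b" if "x \<in> T" "b \<in> cell x" for x b
  proof -
    have "el x (co b) = (\<Sum>a\<in>cell x. if a = b then hr b else 0)"
      unfolding el_def using that by (intro sum.cong) (auto simp: Lx_co dualr)
    then show ?thesis using that fincell by simp
  qed
  have el_less: "el x (co b) < hr b" if "x \<in> T" "b \<in> V" "b \<notin> cell x" for x b
  proof -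
    have "real_of_int (\<Sum>a\<in>cell x. h a * L x a b) < real_of_int (D x * h b)"
      using height[of x b] that by (subst of_int_less_iff) auto
    moreover have "el x (co b) = real_of_int (\<Sum>a\<in>cell x. h a * L x a b) / D x"
      by (simp add: el_def Lx_co Lr hr_def sum_divide_distrib)
    ultimately show ?thesis using D[OF that(1)]
      by (simp add: hr_def divide_less_eq mult.commute)
  qed
  have lin: "(\<Sum>b\<in>V. w b * Lx x a (co b)) = Lx x a X"
    if "\<And>j. j < k + m \<Longrightarrow> (\<Sum>b\<in>V. w b * co b j) = X j" for w x a X
  proof -
    have "(\<Sum>b\<in>V. w b * Lx x a (co b)) = (\<Sum>b\<in>V. \<Sum>j<k+m. lm x a j * (w b * co b j))"
      by (simp add: Lx_def sum_distrib_left mult_ac)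
    also have "\<dots> = (\<Sum>j<k+m. lm x a j * (\<Sum>b\<in>V. w b * co b j))"
      by (subst sum.swap) (simp add: sum_distrib_left)
    finally show ?thesis using that by (simp add: Lx_def)
  qed
  have linel: "(\<Sum>b\<in>V. w b * el x (co b)) = el x X"
    if "\<And>j. j < k + m \<Longrightarrow> (\<Sum>b\<in>V. w b * co b j) = X j" for w x X
  proof -
    have "(\<Sum>b\<in>V. w b * el x (co b)) = (\<Sum>b\<in>V. \<Sum>a\<in>cell x. hr a * (w b * Lx x a (co b)))"
      by (simp add: el_def sum_distrib_left mult_ac)
    also have "\<dots> = (\<Sum>a\<in>cell x. hr a * (\<Sum>b\<in>V. w b * Lx x a (co b)))"
      by (subst sum.swap) (simp add: sum_distrib_left)
    finally show ?thesis using lin[OF that] by (simp add: el_def)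
  qed
  have finV: "finite V" by (simp add: V_def)
  have coord: "(\<Sum>b\<in>V. w b * co b j) = (if j < k then p j else \<mu> (j - k))"
    if "prism_weights k m p \<mu> w" "j < k + m" for p \<mu> w j
    using prism_weights_coord[of j k m w \<mu> p] that unfolding prism_weights_def V_def co_def by auto
  \<comment> \<open>The interpolating function of a cell is at most the height at every vertex, with
    equality only on the cell. Weights supported on a cell thus have the least mean height among all
    weights of their point, and any others with the same mean are supported on that cell, where
    duality determines them.\<close>
  have uniq: "w = w'"
    if x: "x \<in> T" and y: "y \<in> T" and w: "prism_weights k m p \<mu> w" and w': "prism_weights k m p \<mu> w'"
      and sw: "{a. w a \<noteq> 0} \<subseteq> cell x" and sw': "{a. w' a \<noteq> 0} \<subseteq> cell y" for x y p \<mu> w w'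
  proof -
    define X where "X j = (if j < k then p j else \<mu> (j - k))" for j
    have cw: "(\<Sum>b\<in>V. w b * co b j) = X j" if "j < k + m" for j using coord[OF w that] by (simp add: X_def)
    have cw': "(\<Sum>b\<in>V. w' b * co b j) = X j" if "j < k + m" for j using coord[OF w' that] by (simp add: X_def)
    have nn: "0 \<le> w b" "0 \<le> w' b" for b using w w' unfolding prism_weights_def by blast+
    have le: "el z (co b) \<le> hr b" if "z \<in> T" "b \<in> V" for z b
      using el_cell[of z b] el_less[of z b] that by (cases "b \<in> cell z") auto
    have eqs: "el z X = (\<Sum>b\<in>V. u b * hr b)"
      if "z \<in> T" "{a. u a \<noteq> 0} \<subseteq> cell z" "\<And>j. j < k + m \<Longrightarrow> (\<Sum>b\<in>V. u b * co b j) = X j" for z u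
    proof -
      have "(\<Sum>b\<in>V. u b * el z (co b)) = (\<Sum>b\<in>V. u b * hr b)"
        using that(1,2) by (intro sum.cong) (auto simp: el_cell)
      then show ?thesis using linel[OF that(3)] by simp
    qed
    have "el y X = (\<Sum>b\<in>V. w b * el y (co b))" using linel[OF cw] by simp
    also have "\<dots> \<le> (\<Sum>b\<in>V. w b * hr b)" using le[OF y] nn by (intro sum_mono mult_left_mono) auto
    also have "\<dots> = el x X" using eqs[OF x sw cw] by simp
    finally have "el y X \<le> el x X" .
    have "(\<Sum>b\<in>V. w' b * (hr b - el x (co b))) = el y X - el x X"
      using eqs[OF y sw' cw'] linel[OF cw', of x] by (simp add: algebra_simps sum_subtractf)
    with \<open>el y X \<le> el x X\<close> have "(\<Sum>b\<in>V. w' b * (hr b - el x (co b))) \<le> 0" by simp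
    moreover have nnt: "0 \<le> w' b * (hr b - el x (co b))" if "b \<in> V" for b
      using nn le[OF x that] by simp
    ultimately have "(\<Sum>b\<in>V. w' b * (hr b - el x (co b))) = 0"
      by (meson order_antisym sum_nonneg)
    then have z: "w' b * (hr b - el x (co b)) = 0" if "b \<in> V" for b
      using nnt finV that by (simp add: sum_nonneg_eq_0_iff)
    have sw'': "{a. w' a \<noteq> 0} \<subseteq> cell x"
    proof
      fix a assume "a \<in> {a. w' a \<noteq> 0}"
      then have "w' a \<noteq> 0" by simp
      then have "a \<in> V" using sw' cell[OF y] by auto
      show "a \<in> cell x"
        using z[OF \<open>a \<in> V\<close>] el_less[OF x \<open>a \<in> V\<close>] \<open>w' a \<noteq> 0\<close> by auto
    qed
    have val: "u a = (if a \<in> cell x then Lx x a X else 0)"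
      if s: "{a. u a \<noteq> 0} \<subseteq> cell x" and c: "\<And>j. j < k + m \<Longrightarrow> (\<Sum>b\<in>V. u b * co b j) = X j" for u a
    proof (cases "a \<in> cell x")
      case True
      have "Lx x a X = (\<Sum>b\<in>V. u b * Lx x a (co b))" using lin[OF c] by simp
      also have "\<dots> = (\<Sum>b\<in>V. if b = a then u a else 0)"
        using True s x by (intro sum.cong) (auto simp: Lx_co dualr)
      also have "\<dots> = u a"
        using subsetD[OF conjunct1[OF cell[OF x]] True] finV by simp
      finally show ?thesis using True by simp
    next
      case False
      then show ?thesis using s by auto
    qed
    show ?thesis using val[OF sw cw] val[OF sw'' cw'] by (intro ext) simp
  qed
  have exist: "\<exists>C\<in>cell ` T. \<exists>w. prism_weights k m p \<mu> w \<and> {a. w a \<noteq> 0} \<subseteq> C \<and>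
           (\<forall>i<m. \<mu> i = 0 \<longrightarrow> card (colour_class C i) = 1)"
    if p: "\<forall>j<k. 0 \<le> p j \<and> p j \<le> 1" and mu: "\<forall>i<m. 0 \<le> \<mu> i" and mu1: "(\<Sum>i<m. \<mu> i) = 1" for p \<mu>
  proof -
    define X where "X j = (if j < k then p j else \<mu> (j - k))" for j
    \<comment> \<open>The point lies in the face of the prism over \<open>J\<close>. The maximum is
      taken over \<open>FJ J\<close> only, the cells with a single vertex in every other colour,
      which is what the clause about \<open>\<mu> i = 0\<close> demands.\<close>
    define J where "J = {i. i < m \<and> \<mu> i \<noteq> 0}"
    have J: "J \<subseteq> {..<m}" "J \<noteq> {}"
      using mu1 by (auto simp: J_def intro: ccontr)
    obtain c where c: "weights k p c" using cube[OF p] by blast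
    \<comment> \<open>Product weights, which need not be supported on one cell. They show that a
      linear form that is nonnegative at the vertices of the face over \<open>J\<close> is
      nonnegative at \<open>X\<close>.\<close>
    define w0 where "w0 = (\<lambda>a. c (fst a) * \<mu> (snd a))"
    have w0X: "(\<Sum>b\<in>V. w0 b * co b j) = X j" if "j < k + m" for j
      unfolding V_def co_def X_def
    proof (rule prism_weights_coord[OF that])
      fix i assume "i < m"
      show "(\<Sum>v<2^k. w0 (v, i)) = \<mu> i"
        using c by (simp add: w0_def weights_def flip: sum_distrib_right)
    next
      fix j assume "j < k"
      have "(\<Sum>a\<in>prism_vertices k m. w0 a * of_bool (bit (fst a) j))
          = (\<Sum>v<2^k. \<Sum>i<m. (c v * of_bool (bit v j)) * \<mu> i)"
        unfolding prism_vertices_def w0_def by (simp add: sum.cartesian_product split_def mult_ac)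
      also have "\<dots> = p j" using c \<open>j < k\<close> mu1 by (simp add: weights_def flip: sum_distrib_left)
      finally show "(\<Sum>a\<in>prism_vertices k m. w0 a * of_bool (bit (fst a) j)) = p j" .
    qed
    have w0n: "0 \<le> w0 b" if "b \<in> V" for b
      using c mu that by (auto simp: w0_def weights_def V_def prism_vertices_def)
    have w0J: "w0 b = 0" if "b \<in> V" "snd b \<notin> J" for b
      using that by (auto simp: w0_def V_def prism_vertices_def J_def)
    have finFJ: "finite (FJ J)" "FJ J \<noteq> {}"
      using finT nonempty[OF J] by (auto simp: FJ_def)
    obtain x where x: "x \<in> FJ J" and xmax: "\<And>y. y \<in> FJ J \<Longrightarrow> el y X \<le> el x X"
    proof -
      have "Max ((\<lambda>y. el y X) ` FJ J) \<in> (\<lambda>y. el y X) ` FJ J" using finFJ by (intro Max_in) auto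
      then obtain x where "x \<in> FJ J" "Max ((\<lambda>y. el y X) ` FJ J) = el x X" by auto
      then show ?thesis using that finFJ by (metis Max_ge finite_imageI imageI)
    qed
    have xT: "x \<in> T" using x by (simp add: FJ_def)
    define w where "w a = (if a \<in> cell x then Lx x a X else 0)" for a
    have sumw: "(\<Sum>b\<in>V. w b * g b) = (\<Sum>b\<in>cell x. Lx x b X * g b)" for g
      using cell[OF xT] finV by (intro sum.mono_neutral_cong_right) (auto simp: w_def)
    have wX: "(\<Sum>b\<in>V. w b * co b j) = X j" if "j < k + m" for j
      using lam_expand[OF xT that] sumw by simp
    have wcol: "(\<Sum>v<2^k. w (v, i)) = \<mu> i" if "i < m" for i
    proof -
      have "(\<Sum>v<2^k. w (v, i)) = (\<Sum>a\<in>prism_vertices k m. w a * of_bool (i = snd a))"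
        using sum_snd_eq[OF that] by simp
      also have "\<dots> = (\<Sum>b\<in>V. w b * co b (k + i))"
        unfolding V_def by (intro sum.cong) (auto simp: co_def prism_coord_def)
      also have "\<dots> = \<mu> i" using wX[of "k + i"] that by (simp add: X_def)
      finally show ?thesis .
    qed
    \<comment> \<open>The only vertex of a colour outside \<open>J\<close> carries the whole mass of
      that colour, which is 0.\<close>
    have off: "w a = 0" if "a \<in> cell x" "snd a \<notin> J" for a
    proof -
      obtain v i where a: "a = (v, i)" by fastforce
      have i: "i < m" using cell[OF xT] that a by (auto simp: V_def prism_vertices_def)
      have "card (colour_class (cell x) i) = 1" using x i that a by (simp add: FJ_def)
      then have s: "colour_class (cell x) i = {v}"
        using that(1) a unfolding colour_class_def by (metis card_1_singletonE mem_Collect_eq singletonD)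
      have "w (u, i) = 0" if "u \<noteq> v" for u
        using s that by (auto simp: w_def colour_class_def)
      then have "(\<Sum>u<2^k. w (u, i)) = (\<Sum>u<2^k. if u = v then w (v, i) else 0)"
        by (intro sum.cong) auto
      moreover have "v < 2^k" using cell[OF xT] that a by (auto simp: V_def prism_vertices_def)
      ultimately have "w a = \<mu> i" using wcol[OF i] a by simp
      then show ?thesis using that a i by (simp add: J_def)
    qed
    have nn: "0 \<le> w a" for a
    proof (rule ccontr)
      assume neg: "\<not> 0 \<le> w a"
      then have ac: "a \<in> cell x" by (auto simp: w_def split: if_splits)
      have aJ: "snd a \<in> J" using off[OF ac] neg by fastforce
      have La: "Lx x a X < 0" using neg ac by (simp add: w_def)
      from nbr[OF J x ac aJ] show False
      proof
        \<comment> \<open>The facet opposite to \<open>a\<close> lies on the boundary of the face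
          over \<open>J\<close>, so the coordinate at \<open>a\<close> cannot be negative in this
          face.\<close>
        assume pos: "\<forall>b\<in>V. snd b \<in> J \<longrightarrow> 0 \<le> L x a b"
        have "Lx x a X = (\<Sum>b\<in>V. w0 b * Lx x a (co b))" using lin[OF w0X] by simp
        also have "\<dots> \<ge> 0"
        proof (rule sum_nonneg)
          fix b assume b: "b \<in> V"
          show "0 \<le> w0 b * Lx x a (co b)"
            using w0J[OF b] w0n[OF b] pos b D[OF xT] by (cases "snd b \<in> J") (auto simp: Lx_co Lr)
        qed
        finally show False using La by simp
      next
        assume "\<exists>x'\<in>FJ J. {c \<in> cell x. snd c \<in> J} - {a} \<subseteq> cell x' \<and> a \<notin> cell x'"
        then obtain x' where x': "x' \<in> FJ J" "{c \<in> cell x. snd c \<in> J} - {a} \<subseteq> cell x'" "a \<notin> cell x'"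
          by blast
        then have x'T: "x' \<in> T" by (simp add: FJ_def)
        \<comment> \<open>All vertices of nonzero weight except \<open>a\<close> belong to both
          cells, where both functions take the height. At \<open>a\<close> the function of the
          neighbour is strictly below the height; the negative weight makes the difference
          positive.\<close>
        have "el x' X - el x X = (\<Sum>b\<in>V. w b * (el x' (co b) - el x (co b)))"
          using linel[OF wX] by (simp add: algebra_simps sum_subtractf)
        also have "\<dots> = (\<Sum>b\<in>V. if b = a then w a * (el x' (co a) - el x (co a)) else 0)"
        proof (rule sum.cong[OF refl])
          fix b assume "b \<in> V"
          show "w b * (el x' (co b) - el x (co b)) = (if b = a then w a * (el x' (co a) - el x (co a)) else 0)"
            using off[of b] el_cell[OF xT, of b] el_cell[OF x'T, of b] x'(2)
            by (cases "b \<in> cell x"; cases "snd b \<in> J"; cases "b = a") (auto simp: w_def)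
        qed
        also have "\<dots> = w a * (el x' (co a) - el x (co a))"
          using subsetD[OF conjunct1[OF cell[OF xT]] ac] finV by simp
        also have "\<dots> > 0"
          using el_less[OF x'T _ x'(3)] ac cell[OF xT] el_cell[OF xT ac] neg
          by (intro mult_neg_neg) auto
        finally show False using xmax[OF x'(1)] by simp
      qed
    qed
    have "prism_weights k m p \<mu> w"
      unfolding prism_weights_def
    proof (intro conjI allI impI)
      show "w a = 0" if "a \<notin> prism_vertices k m" for a
        using that cell[OF xT] by (auto simp: w_def V_def)
      show "(\<Sum>a\<in>prism_vertices k m. w a * of_bool (bit (fst a) j)) = p j" if "j < k" for j
        using wX[of j] that by (simp add: co_def prism_coord_def V_def X_def)
    qed (use nn wcol in auto)
    moreover have "{a. w a \<noteq> 0} \<subseteq> cell x" by (auto simp: w_def)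
    moreover have "\<forall>i<m. \<mu> i = 0 \<longrightarrow> card (colour_class (cell x) i) = 1"
      using x by (auto simp: FJ_def J_def)
    ultimately show ?thesis using xT by blast
  qed
  show ?thesis
    unfolding prism_complex_def using finT cell uniq exist
    by (intro conjI ballI allI impI) (auto simp: V_def)
qed

section \<open>A triangulation of the product of the 3-cube and a triangle\<close>

text \<open>
  An entry \<open>(D, rs)\<close> describes a cell. The element \<open>((v, i), l)\<close> of \<open>rs\<close> stands for a vertex together
  with \<open>D\<close> times the coefficients of its barycentric coordinate as a linear form in the three
  coordinates of the cube and the three of the triangle. The heights were found by a
  randomised search for regular triangulations of small weight.
\<close>

type_synonym lifted_cell = "int \<times> ((int \<times> int) \<times> int list) list"

definition lifted_cells :: "lifted_cell list" where
  "lifted_cells = [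
   (1, [((0,0),[-1,0,0,1,1,1]), ((1,0),[1,-1,-1,0,-1,-1]), ((3,0),[0,1,0,0,0,0]), ((5,0),[0,0,1,0,0,0]), ((1,1),[0,0,0,0,1,0]), ((1,2),[0,0,0,0,0,1])]),
   (1, [((0,0),[0,-1,0,1,0,1]), ((2,0),[-1,1,-1,0,0,-1]), ((3,0),[1,0,0,0,0,0]), ((6,0),[0,0,1,0,0,0]), ((0,1),[0,0,0,0,1,0]), ((2,2),[0,0,0,0,0,1])]),
   (2, [((0,0),[-1,-1,-1,2,0,1]), ((3,0),[1,1,-1,0,0,-1]), ((5,0),[1,-1,1,0,0,-1]), ((6,0),[-1,1,1,0,0,1]), ((0,1),[0,0,0,0,2,0]), ((1,2),[0,0,0,0,0,2])]),
   (1, [((0,0),[0,-1,-1,1,0,0]), ((3,0),[0,1,0,0,0,0]), ((5,0),[0,0,1,0,0,0]), ((0,1),[-1,1,1,0,1,1]), ((1,1),[1,-1,-1,0,0,-1]), ((1,2),[0,0,0,0,0,1])]),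
   (2, [((0,0),[-1,-1,-1,2,0,1]), ((3,0),[1,1,-1,0,0,-1]), ((6,0),[0,0,2,0,0,0]), ((0,1),[0,0,0,0,2,0]), ((1,2),[1,-1,1,0,0,1]), ((2,2),[-1,1,-1,0,0,1])]),
   (1, [((0,0),[0,0,-1,1,0,1]), ((4,0),[-1,-1,1,0,0,-1]), ((5,0),[1,0,0,0,0,0]), ((6,0),[0,1,0,0,0,0]), ((0,1),[0,0,0,0,1,0]), ((4,2),[0,0,0,0,0,1])]),
   (2, [((0,0),[-1,-1,-1,2,0,1]), ((5,0),[1,-1,1,0,0,-1]), ((6,0),[0,2,0,0,0,0]), ((0,1),[0,0,0,0,2,0]), ((1,2),[1,1,-1,0,0,1]), ((4,2),[-1,-1,1,0,0,1])]),
   (2, [((0,0),[-1,-1,-1,2,0,1]), ((6,0),[1,1,1,0,0,-1]), ((0,1),[0,0,0,0,2,0]), ((1,2),[2,0,0,0,0,0]), ((2,2),[-1,1,-1,0,0,1]), ((4,2),[-1,-1,1,0,0,1])]),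
   (1, [((0,0),[0,0,0,1,0,0]), ((0,1),[0,0,0,0,1,0]), ((0,2),[-1,-1,-1,0,0,1]), ((1,2),[1,0,0,0,0,0]), ((2,2),[0,1,0,0,0,0]), ((4,2),[0,0,1,0,0,0])]),
   (1, [((2,0),[-1,0,-1,1,0,0]), ((3,0),[1,0,0,0,0,0]), ((6,0),[0,0,1,0,0,0]), ((0,1),[0,-1,0,1,1,1]), ((2,1),[0,1,0,-1,0,-1]), ((2,2),[0,0,0,0,0,1])]),
   (1, [((3,0),[0,0,-1,1,1,1]), ((5,0),[0,-1,0,1,1,1]), ((6,0),[-1,0,0,1,1,1]), ((7,0),[1,1,1,-2,-3,-3]), ((7,1),[0,0,0,0,1,0]), ((7,2),[0,0,0,0,0,1])]),
   (3, [((3,0),[1,1,-2,1,0,-1]), ((5,0),[1,-2,1,1,0,-1]), ((6,0),[-2,1,1,1,0,2]), ((0,1),[-1,-1,-1,2,3,1]), ((7,1),[1,1,1,-2,0,-1]), ((1,2),[0,0,0,0,0,3])]),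
   (2, [((3,0),[1,1,-1,0,-1,-1]), ((5,0),[1,-1,1,0,-1,-1]), ((6,0),[-2,0,0,2,2,2]), ((7,1),[0,0,0,0,2,0]), ((1,2),[-1,-1,-1,2,3,3]), ((7,2),[1,1,1,-2,-3,-1])]),
   (2, [((3,0),[0,1,-1,1,0,0]), ((5,0),[0,-1,1,1,0,0]), ((0,1),[-2,0,0,2,2,2]), ((1,1),[2,-1,-1,-1,0,-2]), ((7,1),[0,1,1,-1,0,0]), ((1,2),[0,0,0,0,0,2])]),
   (2, [((3,0),[1,0,-1,1,0,0]), ((6,0),[-1,0,1,1,0,0]), ((0,1),[0,-2,0,2,2,2]), ((2,1),[-1,2,-1,-1,0,-2]), ((7,1),[1,0,1,-1,0,0]), ((2,2),[0,0,0,0,0,2])]),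
   (3, [((3,0),[1,1,-2,1,0,-1]), ((6,0),[-1,-1,2,2,0,1]), ((0,1),[-1,-1,-1,2,3,1]), ((7,1),[1,1,1,-2,0,-1]), ((1,2),[1,-2,1,1,0,2]), ((2,2),[-1,2,-1,-1,0,1])]),
   (2, [((3,0),[1,1,-1,0,-1,-1]), ((6,0),[-1,-1,1,2,1,1]), ((7,1),[0,0,0,0,2,0]), ((1,2),[0,-2,0,2,2,2]), ((2,2),[-1,1,-1,0,1,1]), ((7,2),[1,1,1,-2,-3,-1])]),
   (1, [((3,0),[0,0,0,1,0,0]), ((0,1),[-1,0,0,1,1,1]), ((1,1),[1,-1,0,0,0,-1]), ((3,1),[0,1,-1,-1,0,0]), ((7,1),[0,0,1,0,0,0]), ((1,2),[0,0,0,0,0,1])]),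
   (1, [((3,0),[0,0,0,1,0,0]), ((0,1),[0,-1,0,1,1,1]), ((2,1),[-1,1,0,0,0,-1]), ((3,1),[1,0,-1,-1,0,0]), ((7,1),[0,0,1,0,0,0]), ((2,2),[0,0,0,0,0,1])]),
   (2, [((3,0),[0,0,0,2,0,0]), ((0,1),[-1,-1,0,2,2,1]), ((3,1),[1,1,-2,-2,0,-1]), ((7,1),[0,0,2,0,0,0]), ((1,2),[1,-1,0,0,0,1]), ((2,2),[-1,1,0,0,0,1])]),
   (1, [((3,0),[0,0,0,1,0,0]), ((3,1),[0,0,-1,0,1,0]), ((7,1),[0,0,1,0,0,0]), ((1,2),[0,-1,0,1,1,1]), ((2,2),[-1,0,0,1,1,1]), ((3,2),[1,1,0,-2,-2,-1])]),
   (1, [((3,0),[0,0,0,1,0,0]), ((7,1),[0,0,0,0,1,0]), ((1,2),[0,-1,0,1,1,1]), ((2,2),[-1,0,0,1,1,1]), ((3,2),[1,1,-1,-2,-1,-1]), ((7,2),[0,0,1,0,-1,0])]),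
   (1, [((4,0),[-1,-1,0,1,0,0]), ((5,0),[1,0,0,0,0,0]), ((6,0),[0,1,0,0,0,0]), ((0,1),[0,0,-1,1,1,1]), ((4,1),[0,0,1,-1,0,-1]), ((4,2),[0,0,0,0,0,1])]),
   (2, [((5,0),[1,-1,0,1,0,0]), ((6,0),[-1,1,0,1,0,0]), ((0,1),[0,0,-2,2,2,2]), ((4,1),[-1,-1,2,-1,0,-2]), ((7,1),[1,1,0,-1,0,0]), ((4,2),[0,0,0,0,0,2])]),
   (3, [((5,0),[1,-2,1,1,0,-1]), ((6,0),[-1,2,-1,2,0,1]), ((0,1),[-1,-1,-1,2,3,1]), ((7,1),[1,1,1,-2,0,-1]), ((1,2),[1,1,-2,1,0,2]), ((4,2),[-1,-1,2,-1,0,1])]),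
   (2, [((5,0),[1,-1,1,0,-1,-1]), ((6,0),[-1,1,-1,2,1,1]), ((7,1),[0,0,0,0,2,0]), ((1,2),[0,0,-2,2,2,2]), ((4,2),[-1,-1,1,0,1,1]), ((7,2),[1,1,1,-2,-3,-1])]),
   (1, [((5,0),[0,0,0,1,0,0]), ((0,1),[-1,0,0,1,1,1]), ((1,1),[1,0,-1,0,0,-1]), ((5,1),[0,-1,1,-1,0,0]), ((7,1),[0,1,0,0,0,0]), ((1,2),[0,0,0,0,0,1])]),
   (1, [((5,0),[0,0,0,1,0,0]), ((0,1),[0,0,-1,1,1,1]), ((4,1),[-1,0,1,0,0,-1]), ((5,1),[1,-1,0,-1,0,0]), ((7,1),[0,1,0,0,0,0]), ((4,2),[0,0,0,0,0,1])]),
   (2, [((5,0),[0,0,0,2,0,0]), ((0,1),[-1,0,-1,2,2,1]), ((5,1),[1,-2,1,-2,0,-1]), ((7,1),[0,2,0,0,0,0]), ((1,2),[1,0,-1,0,0,1]), ((4,2),[-1,0,1,0,0,1])]),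
   (1, [((5,0),[0,0,0,1,0,0]), ((5,1),[0,-1,0,0,1,0]), ((7,1),[0,1,0,0,0,0]), ((1,2),[0,0,-1,1,1,1]), ((4,2),[-1,0,0,1,1,1]), ((5,2),[1,0,1,-2,-2,-1])]),
   (1, [((5,0),[0,0,0,1,0,0]), ((7,1),[0,0,0,0,1,0]), ((1,2),[0,0,-1,1,1,1]), ((4,2),[-1,0,0,1,1,1]), ((5,2),[1,-1,1,-2,-1,-1]), ((7,2),[0,1,0,0,-1,0])]),
   (1, [((6,0),[0,0,0,1,0,0]), ((0,1),[0,-1,0,1,1,1]), ((2,1),[0,1,-1,0,0,-1]), ((6,1),[-1,0,1,-1,0,0]), ((7,1),[1,0,0,0,0,0]), ((2,2),[0,0,0,0,0,1])]),
   (1, [((6,0),[0,0,0,1,0,0]), ((0,1),[0,0,-1,1,1,1]), ((4,1),[0,-1,1,0,0,-1]), ((6,1),[-1,1,0,-1,0,0]), ((7,1),[1,0,0,0,0,0]), ((4,2),[0,0,0,0,0,1])]),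
   (2, [((6,0),[0,0,0,2,0,0]), ((0,1),[0,-1,-1,2,2,1]), ((6,1),[-2,1,1,-2,0,-1]), ((7,1),[2,0,0,0,0,0]), ((2,2),[0,1,-1,0,0,1]), ((4,2),[0,-1,1,0,0,1])]),
   (3, [((6,0),[0,0,0,3,0,0]), ((0,1),[-1,-1,-1,2,3,1]), ((7,1),[1,1,1,-2,0,-1]), ((1,2),[2,-1,-1,2,0,1]), ((2,2),[-1,2,-1,-1,0,1]), ((4,2),[-1,-1,2,-1,0,1])]),
   (1, [((6,0),[0,0,0,1,0,0]), ((6,1),[-1,1,1,-2,-1,-1]), ((7,1),[1,-1,-1,2,2,1]), ((2,2),[0,0,-1,1,1,1]), ((4,2),[0,-1,0,1,1,1]), ((7,2),[0,1,1,-2,-2,-1])]),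
   (1, [((6,0),[0,0,0,1,0,0]), ((6,1),[0,0,0,0,1,0]), ((2,2),[0,0,-1,1,1,1]), ((4,2),[0,-1,0,1,1,1]), ((6,2),[-1,1,1,-2,-2,-1]), ((7,2),[1,0,0,0,0,0])]),
   (2, [((6,0),[0,0,0,2,0,0]), ((7,1),[0,0,0,0,2,0]), ((1,2),[1,-1,-1,2,1,1]), ((2,2),[-1,1,-1,0,1,1]), ((4,2),[-1,-1,1,0,1,1]), ((7,2),[1,1,1,-2,-3,-1])])]"

definition heights :: "int list" where
  "heights = [1,3,2,1,1,0,0,3,0,1,2,2,1,1,1,0,2,0,1,2,0,1,3,1]"

section \<open>Executable conditions on the list of cells\<close>

fun dot :: "int list \<Rightarrow> int list \<Rightarrow> int" where
  "dot (x # xs) (y # ys) = x * y + dot xs ys"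
| "dot _ _ = 0"

definition coords :: "int \<times> int \<Rightarrow> int list" where
  "coords = (\<lambda>(v, i). [v mod 2, (v div 2) mod 2, v div 4, of_bool (i = 0), of_bool (i = 1), of_bool (i = 2)])"

definition points :: "(int \<times> int) list" where
  "points = List.product [0,1,2,3,4,5,6,7] [0,1,2]"

definition height_at :: "int \<times> int \<Rightarrow> int" where
  "height_at = (\<lambda>(v, i). heights ! nat (8 * i + v))"

definition shape_ok :: "lifted_cell \<Rightarrow> bool" where
  "shape_ok = (\<lambda>(D, rs). 0 < D \<and> length rs = 6 \<and> distinct (map fst rs) \<and>
     list_all (\<lambda>(a, l). a \<in> set points \<and> length l = 6) rs \<and>
     list_all (\<lambda>i. list_ex (\<lambda>(a, l). snd a = i) rs) [0,1,2])"

definition dual_ok :: "lifted_cell \<Rightarrow> bool" where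
  "dual_ok = (\<lambda>(D, rs). list_all (\<lambda>(b, _). let c = coords b in
     list_all (\<lambda>(a, l). dot l c = (if a = b then D else 0)) rs) rs)"

definition span_ok :: "lifted_cell \<Rightarrow> bool" where
  "span_ok = (\<lambda>(D, rs). list_all (\<lambda>j. list_all (\<lambda>j'.
     (\<Sum>(a, l)\<leftarrow>rs. coords a ! j * l ! j') = (if j = j' then D else 0)) [0..<6]) [0..<6])"

definition height_ok :: "lifted_cell \<Rightarrow> bool" where
  "height_ok = (\<lambda>(D, rs). list_all (\<lambda>b. b \<in> set (map fst rs) \<or>
     (\<Sum>(a, l)\<leftarrow>rs. height_at a * dot l (coords b)) < D * height_at b) points)"

text \<open>The list form of \<open>FJ\<close>. With one vertex in each colour outside
  \<open>J\<close>, a cell keeps as many as 3 plus the number of colours in \<open>J\<close>, so it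
  meets the face of the prism over \<open>J\<close> in full dimension.\<close>

definition proper_on :: "int list \<Rightarrow> lifted_cell \<Rightarrow> bool" where
  "proper_on J = (\<lambda>(D, rs).
     list_all (\<lambda>i. i \<in> set J \<or> length (filter (\<lambda>(a, l). snd a = i) rs) = 1) [0,1,2])"

text \<open>
  Unlike with \<open>list_ex\<close> and \<open>list_all\<close>, evaluation by rewriting stops at the first witness, since the
  simplifier does not enter the branches of a conditional.
\<close>

primrec lazy_ex :: "('a \<Rightarrow> bool) \<Rightarrow> 'a list \<Rightarrow> bool" where
  "lazy_ex P [] = False"
| "lazy_ex P (x # xs) = (if P x then True else lazy_ex P xs)"

primrec lazy_all :: "('a \<Rightarrow> bool) \<Rightarrow> 'a list \<Rightarrow> bool" where
  "lazy_all P [] = True"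
| "lazy_all P (x # xs) = (if P x then lazy_all P xs else False)"

lemma lazy_ex_iff: "lazy_ex P xs \<longleftrightarrow> (\<exists>x\<in>set xs. P x)"
  by (induction xs) auto

lemma lazy_all_iff: "lazy_all P xs \<longleftrightarrow> (\<forall>x\<in>set xs. P x)"
  by (induction xs) auto

definition avoids :: "int \<times> int \<Rightarrow> lifted_cell \<Rightarrow> bool" where
  "avoids a x = lazy_all (\<lambda>(b, _). b \<noteq> a) (snd x)"

text \<open>The hypotheses \<open>nonempty\<close> and \<open>nbr\<close> of
  \<open>regular_prism_complex\<close> for one set of colours, with conditionals for connectives so
  that evaluation stops early.\<close>

definition facets_ok :: "int list \<Rightarrow> lifted_cell list \<Rightarrow> bool" where
  "facets_ok J F \<longleftrightarrow> F \<noteq> [] \<and> lazy_all (\<lambda>x. lazy_all (\<lambda>(a, l). if snd a \<in> set J then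
       if lazy_all (\<lambda>b. if snd b \<in> set J then 0 \<le> dot l (coords b) else True) points then True else
       lazy_ex (\<lambda>y. if lazy_all (\<lambda>(c, _). if snd c \<in> set J then if c = a then True else \<not> avoids c y else True) (snd x)
         then avoids a y else False) F else True) (snd x)) F"

text \<open>Six times \<open>prism_weight\<close>, kept in the natural numbers: three degrees adding
  up to 3 have factorials whose product is 1, 2 or 6.\<close>

definition weight6 :: "lifted_cell \<Rightarrow> nat" where
  "weight6 x = 6 div (\<Prod>i\<leftarrow>[0,1,2]. fact (length (filter (\<lambda>(a, _). snd a = i) (snd x)) - 1))"

text \<open>The first fact certifies that the division in \<open>weight6\<close> is exact; the
  second is the source of the constant, since 88/6 = 44/3.\<close>

lemma lifted_cells_weight: "list_all (\<lambda>x. weight6 x * (\<Prod>i\<leftarrow>[0,1,2]. fact (length (filter (\<lambda>(a, _). snd a = i) (snd x)) - 1)) = 6) lifted_cells"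
  "(\<Sum>x\<leftarrow>lifted_cells. weight6 x) = 88"
  by code_simp+

lemma lifted_cells_shape: "list_all shape_ok lifted_cells"
  by code_simp

section \<open>From lists of integers to sets of vertices\<close>

lemma coords_ok: "list_all (\<lambda>(v, i). coords (v, i) = map (prism_coord 3 (nat v, nat i)) [0..<6]) points"
  by (simp add: points_def coords_def prism_coord_def upt_rec bit_0)

lemma set_points: "set points = {0..7} \<times> {0..2}"
proof -
  have "{0..7::int} = {0,1,2,3,4,5,6,7}" "{0..2::int} = {0,1,2}" by auto
  then show ?thesis by (simp add: points_def)
qed

lemma dot_eq_sum: "length xs = length ys \<Longrightarrow> dot xs ys = (\<Sum>j<length xs. xs ! j * ys ! j)"
  by (induction xs ys rule: list_induct2) (simp_all add: sum.lessThan_Suc_shift del: sum.lessThan_Suc)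

definition vertex :: "int \<times> int \<Rightarrow> nat \<times> nat" where
  "vertex = map_prod nat nat"

definition cell :: "lifted_cell \<Rightarrow> (nat \<times> nat) set" where
  "cell x = vertex ` set (map fst (snd x))"

text \<open>Specified only at vertices of the cell, the only ones at which
  \<open>regular_prism_complex\<close> consults the coefficients.\<close>

definition barycentric :: "lifted_cell \<Rightarrow> nat \<times> nat \<Rightarrow> nat \<Rightarrow> int" where
  "barycentric x a j = the (map_of (snd x) (map_prod int int a)) ! j"

lemma inj_vertex: "inj_on vertex (set points)"
  by (rule inj_on_inverseI[of _ "map_prod int int"]) (auto simp: set_points vertex_def)

lemma vertex_points: "vertex ` set points = prism_vertices 3 3"
proof
  show "vertex ` set points \<subseteq> prism_vertices 3 3"
    by (auto simp: set_points vertex_def prism_vertices_def)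
  show "prism_vertices 3 3 \<subseteq> vertex ` set points"
  proof
    fix a assume "a \<in> prism_vertices 3 3"
    then obtain v i where a: "a = (v, i)" "v < 8" "i < 3" by (auto simp: prism_vertices_def)
    then have "(int v, int i) \<in> set points" by (simp add: set_points)
    moreover have "a = vertex (int v, int i)" using a by (simp add: vertex_def)
    ultimately show "a \<in> vertex ` set points" by blast
  qed
qed

lemma coords_nth:
  assumes "a \<in> set points"
  shows "coords a = map (prism_coord 3 (vertex a)) [0..<6]"
  using coords_ok assms by (auto simp: list_all_iff vertex_def)

context
  fixes x assumes x: "x \<in> set lifted_cells"
begin

lemma shape_facts:
  "0 < fst x" "length (snd x) = 6" "distinct (map fst (snd x))" "set (map fst (snd x)) \<subseteq> set points"
  "\<And>a l. (a, l) \<in> set (snd x) \<Longrightarrow> a \<in> set points \<and> length l = 6"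
  "\<And>i. i < 3 \<Longrightarrow> \<exists>(a, l)\<in>set (snd x). snd a = int i"
proof -
  have s: "shape_ok x" using lifted_cells_shape x by (simp add: list_all_iff)
  show "0 < fst x" "length (snd x) = 6" "distinct (map fst (snd x))"
    using s by (auto simp: shape_ok_def split_def)
  show 1: "\<And>a l. (a, l) \<in> set (snd x) \<Longrightarrow> a \<in> set points \<and> length l = 6"
    using s by (auto simp: shape_ok_def split_def list_all_iff)
  show "set (map fst (snd x)) \<subseteq> set points" using 1 by fastforce
  fix i :: nat assume "i < 3"
  then have "i = 0 \<or> i = 1 \<or> i = 2" by auto
  then show "\<exists>(a, l)\<in>set (snd x). snd a = int i"
    using s by (auto simp: shape_ok_def split_def list_all_iff list_ex_iff; force)
qed

lemma barycentric_eq: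
  assumes "(a, l) \<in> set (snd x)"
  shows "barycentric x (vertex a) j = l ! j"
proof -
  have "a \<in> set points" using shape_facts(5)[OF assms] by blast
  then have "map_prod int int (vertex a) = a" by (auto simp: set_points vertex_def)
  then show ?thesis
    using map_of_is_SomeI[OF shape_facts(3) assms] by (simp add: barycentric_def)
qed

lemma dot_coords:
  assumes "(a, l) \<in> set (snd x)" "b \<in> set points"
  shows "dot l (coords b) = (\<Sum>j<3+3. barycentric x (vertex a) j * prism_coord 3 (vertex b) j)"
  using shape_facts(5)[OF assms(1)] barycentric_eq[OF assms(1)] coords_nth[OF assms(2)]
  by (simp add: dot_eq_sum del: sum.lessThan_Suc)

lemma sum_cell: "(\<Sum>a\<in>cell x. g a) = (\<Sum>(a, l)\<leftarrow>snd x. g (vertex a))" for g :: "nat \<times> nat \<Rightarrow> int"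
proof -
  have "(\<Sum>a\<in>cell x. g a) = (\<Sum>a\<in>set (map fst (snd x)). g (vertex a))"
    unfolding cell_def using inj_vertex inj_on_subset shape_facts(4) by (subst sum.reindex) (blast, simp)
  also have "\<dots> = (\<Sum>a\<leftarrow>map fst (snd x). g (vertex a))"
    using shape_facts(3) by (rule sum_list_distinct_conv_sum_set[symmetric])
  finally show ?thesis by (simp add: comp_def split_def)
qed

lemma vertex_mem_cell:
  assumes "a \<in> set points"
  shows "vertex a \<in> cell x \<longleftrightarrow> a \<in> set (map fst (snd x))"
  unfolding cell_def using assms inj_vertex shape_facts(4) by (simp add: inj_on_image_mem_iff del: set_map)

lemma card_colour_class_cell:
  "card (colour_class (cell x) i) = length (filter (\<lambda>(a, _). snd a = int i) (snd x))"
proof -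
  let ?K = "map fst (filter (\<lambda>(a, _). snd a = int i) (snd x))"
  have K: "set ?K = {a\<in>set (map fst (snd x)). snd a = int i}" by force
  have "colour_class (cell x) i = (\<lambda>a. nat (fst a)) ` set ?K"
  proof (intro set_eqI iffI)
    fix v assume "v \<in> colour_class (cell x) i"
    then have "(v, i) \<in> vertex ` set (map fst (snd x))" by (simp only: colour_class_def cell_def mem_Collect_eq)
    then obtain a where a: "a \<in> set (map fst (snd x))" "vertex a = (v, i)" by (metis imageE)
    then have "a \<in> {0..7} \<times> {0..2}" using shape_facts(4) unfolding set_points by blast
    then have "snd a = int i" "v = nat (fst a)" using a(2) by (auto simp: vertex_def)
    then show "v \<in> (\<lambda>a. nat (fst a)) ` set ?K" unfolding K using a by blast
  next
    fix v assume "v \<in> (\<lambda>a. nat (fst a)) ` set ?K"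
    then obtain a where a: "a \<in> set (map fst (snd x))" "snd a = int i" "v = nat (fst a)" unfolding K by blast
    then have "vertex a = (v, i)" by (simp add: vertex_def prod_eq_iff)
    then show "v \<in> colour_class (cell x) i" using a(1) unfolding colour_class_def cell_def by force
  qed
  moreover have "inj_on (\<lambda>a. nat (fst a)) (set ?K)"
  proof (rule inj_onI)
    fix a b assume "a \<in> set ?K" "b \<in> set ?K" and eq: "nat (fst a) = nat (fst b)"
    then have "a \<in> {0..7} \<times> {0..2}" "b \<in> {0..7} \<times> {0..2}" "snd a = snd b"
      using shape_facts(4) unfolding K set_points by (blast, blast, simp)
    then show "a = b" using eq by (auto simp: prod_eq_iff)
  qed
  moreover have "distinct ?K" using shape_facts(3) by (rule distinct_map_filter)
  ultimately show ?thesis by (metis card_image distinct_card length_map)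
qed

lemma avoids_iff: "a \<in> set points \<Longrightarrow> avoids a x \<longleftrightarrow> vertex a \<notin> cell x"
  by (force simp: vertex_mem_cell avoids_def lazy_all_iff)

end

section \<open>The evaluated conditions and the resulting prism complex\<close>

lemma lifted_cells_dual: "list_all dual_ok lifted_cells"
  by code_simp

lemma lifted_cells_span: "list_all span_ok lifted_cells"
  by code_simp

lemma lifted_cells_height: "list_all height_ok lifted_cells"
  by code_simp

lemma lifted_cells_facets:
  assumes "J \<in> set [[0],[1],[2],[0,1],[0,2],[1,2],[0,1,2]]"
  shows "facets_ok J (filter (proper_on J) lifted_cells)"
proof -
  have 0: "facets_ok [0] (filter (proper_on [0]) lifted_cells)" by code_simp
  have 1: "facets_ok [1] (filter (proper_on [1]) lifted_cells)" by code_simp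
  have 2: "facets_ok [2] (filter (proper_on [2]) lifted_cells)" by code_simp
  have 3: "facets_ok [0,1] (filter (proper_on [0,1]) lifted_cells)" by code_simp
  have 4: "facets_ok [0,2] (filter (proper_on [0,2]) lifted_cells)" by code_simp
  have 5: "facets_ok [1,2] (filter (proper_on [1,2]) lifted_cells)" by code_simp
  have 6: "facets_ok [0,1,2] (filter (proper_on [0,1,2]) lifted_cells)" by code_simp
  show ?thesis using assms 0 1 2 3 4 5 6 by auto
qed

lemma colour_list:
  assumes "J \<subseteq> {..<3::nat}" "J \<noteq> {}"
  obtains Jl where "Jl \<in> set [[0],[1],[2],[0,1],[0,2],[1,2],[0,1,2::int]]" "set Jl = int ` J"
proof -
  have J: "J = (if 0 \<in> J then {0} else {}) \<union> (if 1 \<in> J then {1} else {}) \<union> (if 2 \<in> J then {2} else {})" (is "J = ?R")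
  proof
    show "J \<subseteq> ?R"
    proof
      fix i assume "i \<in> J"
      moreover from this have "i = 0 \<or> i = 1 \<or> i = 2" using assms(1) by fastforce
      ultimately show "i \<in> ?R" by auto
    qed
  qed auto
  then obtain p q r where J: "J = (if p then {0} else {}) \<union> (if q then {1} else {}) \<union> (if r then {2} else {})"
    by blast
  define Jl :: "int list" where "Jl = (if p then [0] else []) @ (if q then [1] else []) @ (if r then [2] else [])"
  have "set Jl = int ` J" unfolding Jl_def J by simp
  moreover have "p \<or> q \<or> r" using assms(2) unfolding J by (cases p; cases q; cases r; simp)
  then have "Jl \<in> set [[0],[1],[2],[0,1],[0,2],[1,2],[0,1,2]]"
    unfolding Jl_def by (cases p; cases q; cases r; simp)
  ultimately show ?thesis using that by blast
qed

lemma proper_on_iff: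
  assumes "x \<in> set lifted_cells" "set Jl = int ` J"
  shows "proper_on Jl x \<longleftrightarrow> (\<forall>i<3. i \<notin> J \<longrightarrow> card (colour_class (cell x) i) = 1)"
proof -
  have "proper_on Jl x \<longleftrightarrow> (\<forall>i\<in>{0,1,2}. int i \<in> set Jl \<or> length (filter (\<lambda>(a, _). snd a = int i) (snd x)) = 1)"
    by (simp add: proper_on_def split_def)
  also have "\<dots> \<longleftrightarrow> (\<forall>i\<in>{0,1,2}. i \<in> J \<or> card (colour_class (cell x) i) = 1)"
    unfolding assms(2) card_colour_class_cell[OF assms(1)] by (simp add: image_iff)
  also have "{0,1,2} = {..<3::nat}" by auto
  finally show ?thesis by auto
qed

lemma prism_complex_cells: "prism_complex 3 3 (cell ` set lifted_cells)"
proof (rule regular_prism_complex[where D = fst and lam = barycentric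
      and h = "\<lambda>a. height_at (map_prod int int a)"])
  show "\<exists>w. weights 3 p w" if "\<forall>j<3. 0 \<le> p j \<and> p j \<le> 1" for p
    using cube_complex_exists cube_complex_cover that by metis
  fix x assume x: "x \<in> set lifted_cells"
  have pts: "\<exists>b'\<in>set points. b = vertex b'" if "b \<in> prism_vertices 3 3" for b
    using that vertex_points by blast
  have row: "\<exists>a' l. (a', l) \<in> set (snd x) \<and> a = vertex a' \<and> a' \<in> set points" if "a \<in> cell x" for a
    using that shape_facts(4)[OF x] by (fastforce simp: cell_def)
  have cellV: "cell x \<subseteq> prism_vertices 3 3"
    unfolding cell_def vertex_points[symmetric] using shape_facts(4)[OF x] by (rule image_mono)
  show "cell x \<subseteq> prism_vertices 3 3 \<and> card (cell x) = 3 + 3 \<and> (\<forall>i<3. colour_class (cell x) i \<noteq> {})"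
  proof (intro conjI allI impI cellV)
    have "card (cell x) = card (set (map fst (snd x)))"
      unfolding cell_def using inj_vertex inj_on_subset shape_facts(4)[OF x] by (intro card_image) blast
    also have "\<dots> = 6" using distinct_card[OF shape_facts(3)[OF x]] shape_facts(2)[OF x] by simp
    finally show "card (cell x) = 3 + 3" by simp
    fix i :: nat assume "i < 3"
    then obtain a l where "(a, l) \<in> set (snd x)" "snd a = int i" using shape_facts(6)[OF x] by blast
    then have "vertex a \<in> cell x" "snd (vertex a) = i" by (force simp: cell_def vertex_def)+
    then show "colour_class (cell x) i \<noteq> {}" unfolding colour_class_def by (cases "vertex a") auto
  qed
  show "0 < fst x" by (rule shape_facts(1)[OF x])
  show "(\<Sum>j<3 + 3. barycentric x a j * prism_coord 3 b j) = (if a = b then fst x else 0)"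
    if ab: "a \<in> cell x" "b \<in> cell x" for a b
  proof -
    obtain a' l where a: "(a', l) \<in> set (snd x)" "a = vertex a'" "a' \<in> set points" using row[OF ab(1)] by blast
    obtain b' l' where b: "(b', l') \<in> set (snd x)" "b = vertex b'" "b' \<in> set points" using row[OF ab(2)] by blast
    have "dual_ok x" using lifted_cells_dual x by (simp add: list_all_iff)
    then have "dot l (coords b') = (if a' = b' then fst x else 0)"
      using a(1) b(1) by (fastforce simp: dual_ok_def split_def list_all_iff Let_def)
    moreover have "a' = b' \<longleftrightarrow> a = b" using inj_vertex a b by (auto dest: inj_onD)
    ultimately show ?thesis unfolding a(2) b(2) dot_coords[OF x a(1) b(3), symmetric] by simp
  qed
  show "(\<Sum>a\<in>cell x. prism_coord 3 a j * barycentric x a j') = (if j = j' then fst x else 0)"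
    if j: "j < 3 + 3" "j' < 3 + 3" for j j'
  proof -
    have "span_ok x" using lifted_cells_span x by (simp add: list_all_iff)
    then have "(\<Sum>(a, l)\<leftarrow>snd x. coords a ! j * l ! j') = (if j = j' then fst x else 0)"
      using j by (auto simp: span_ok_def split_def list_all_iff)
    moreover have "(\<Sum>(a, l)\<leftarrow>snd x. prism_coord 3 (vertex a) j * barycentric x (vertex a) j') =
        (\<Sum>(a, l)\<leftarrow>snd x. coords a ! j * l ! j')"
      using j shape_facts(5)[OF x] coords_nth barycentric_eq[OF x]
      by (intro arg_cong[of _ _ sum_list] map_cong refl) (auto simp: nth_append simp del: upt_Suc)
    ultimately show ?thesis unfolding sum_cell[OF x] by simp
  qed
  show "(\<Sum>a\<in>cell x. height_at (map_prod int int a) * (\<Sum>j<3 + 3. barycentric x a j * prism_coord 3 b j))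
      < fst x * height_at (map_prod int int b)" if b: "b \<in> prism_vertices 3 3 - cell x" for b
  proof -
    obtain b' where b': "b' \<in> set points" "b = vertex b'" using pts b by blast
    have id: "map_prod int int (vertex a) = a" if "a \<in> set points" for a
      using that by (auto simp: set_points vertex_def)
    have "height_ok x" using lifted_cells_height x by (simp add: list_all_iff)
    moreover have "b' \<notin> set (map fst (snd x))" using b vertex_mem_cell[OF x b'(1)] b'(2) by simp
    ultimately have "(\<Sum>(a, l)\<leftarrow>snd x. height_at a * dot l (coords b')) < fst x * height_at b'"
      using b'(1) by (auto simp: height_ok_def split_def list_all_iff)
    moreover have "(\<Sum>(a, l)\<leftarrow>snd x. height_at a * dot l (coords b')) =
       (\<Sum>(a, l)\<leftarrow>snd x. height_at (map_prod int int (vertex a)) *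
          (\<Sum>j<3 + 3. barycentric x (vertex a) j * prism_coord 3 b j))"
      using shape_facts(5)[OF x] dot_coords[OF x _ b'(1)] id b'(2)
      by (intro arg_cong[of _ _ sum_list] map_cong refl) auto
    ultimately show ?thesis unfolding sum_cell[OF x] using id b' by simp
  qed
next
  fix J :: "nat set" assume J: "J \<subseteq> {..<3}" "J \<noteq> {}"
  let ?FJ = "{x \<in> set lifted_cells. \<forall>i<3. i \<notin> J \<longrightarrow> card (colour_class (cell x) i) = 1}"
  obtain Jl where Jl: "Jl \<in> set [[0],[1],[2],[0,1],[0,2],[1,2],[0,1,2::int]]" "set Jl = int ` J"
    using colour_list[OF J] .
  note ok = lifted_cells_facets[OF Jl(1), unfolded facets_ok_def]
  have FJ: "set (filter (proper_on Jl) lifted_cells) = ?FJ"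
    using proper_on_iff[OF _ Jl(2)] by auto
  have "filter (proper_on Jl) lifted_cells \<noteq> []" using ok by (rule conjunct1)
  then show "?FJ \<noteq> {}" unfolding FJ[symmetric] by (simp only: set_empty not_False_eq_True)
  fix x a assume xF: "x \<in> ?FJ" and a: "a \<in> cell x" and aJ: "snd a \<in> J"
  then have x: "x \<in> set lifted_cells" by simp
  obtain a' l where a': "(a', l) \<in> set (snd x)" "a = vertex a'" "a' \<in> set points"
    using a shape_facts(5)[OF x] by (force simp: cell_def)
  have J_iff: "snd (vertex b) \<in> J \<longleftrightarrow> snd b \<in> set Jl" if "b \<in> set points" for b
    using that unfolding Jl(2) by (force simp: set_points vertex_def image_iff)
  have a'J: "snd a' \<in> set Jl" using aJ a' J_iff by simp
  have "lazy_all (\<lambda>b. if snd b \<in> set Jl then 0 \<le> dot l (coords b) else True) points \<or>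
     lazy_ex (\<lambda>y. if lazy_all (\<lambda>(c, _). if snd c \<in> set Jl then if c = a' then True else \<not> avoids c y else True) (snd x)
         then avoids a' y else False) (filter (proper_on Jl) lifted_cells)"
  proof -
    have imp: "E \<or> A" if "if E then True else A" for E A
      using that by (cases E) auto
    have "x \<in> set (filter (proper_on Jl) lifted_cells)" using xF FJ by blast
    note bspec[OF iffD1[OF lazy_all_iff conjunct2[OF ok]] this]
    note bspec[OF iffD1[OF lazy_all_iff this] a'(1)]
    then show ?thesis unfolding prod.case if_P[OF a'J] by (rule imp)
  qed
  then show "(\<forall>b\<in>prism_vertices 3 3. snd b \<in> J \<longrightarrow> 0 \<le> (\<Sum>j<3 + 3. barycentric x a j * prism_coord 3 b j)) \<or>
      (\<exists>x'\<in>?FJ. {c \<in> cell x. snd c \<in> J} - {a} \<subseteq> cell x' \<and> a \<notin> cell x')"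
  proof
    assume *: "lazy_all (\<lambda>b. if snd b \<in> set Jl then 0 \<le> dot l (coords b) else True) points"
    have "0 \<le> (\<Sum>j<3 + 3. barycentric x a j * prism_coord 3 b j)"
      if b: "b \<in> prism_vertices 3 3" "snd b \<in> J" for b
    proof -
      obtain b' where b': "b' \<in> set points" "b = vertex b'" using b(1) vertex_points by blast
      then show ?thesis
        using * J_iff[OF b'(1)] b(2) dot_coords[OF x a'(1) b'(1)] a'(2) by (auto simp: lazy_all_iff)
    qed
    then show ?thesis by blast
  next
    assume "lazy_ex (\<lambda>y. if lazy_all (\<lambda>(c, _). if snd c \<in> set Jl then if c = a' then True else \<not> avoids c y else True) (snd x)
         then avoids a' y else False) (filter (proper_on Jl) lifted_cells)"
    then obtain y where "y \<in> set (filter (proper_on Jl) lifted_cells)" and av: "avoids a' y"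
      and nav: "\<And>c l'. (c, l') \<in> set (snd x) \<Longrightarrow> snd c \<in> set Jl \<Longrightarrow> c \<noteq> a' \<Longrightarrow> \<not> avoids c y"
      by (fastforce simp: lazy_ex_iff lazy_all_iff split: if_splits)
    then have yF: "y \<in> ?FJ" using FJ by blast
    then have y: "y \<in> set lifted_cells" by simp
    have "c \<in> cell y" if c: "c \<in> cell x" "snd c \<in> J" "c \<noteq> a" for c
    proof -
      obtain c' l' where c': "(c', l') \<in> set (snd x)" "c = vertex c'" "c' \<in> set points"
        using c(1) shape_facts(5)[OF x] by (force simp: cell_def)
      then have "\<not> avoids c' y" using nav[OF c'(1)] c J_iff a' by auto
      then show ?thesis using avoids_iff[OF y c'(3)] c'(2) by simp
    qed
    moreover have "a \<notin> cell y" using avoids_iff[OF y a'(3)] av a'(2) by simp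
    ultimately show ?thesis using yF by blast
  qed
qed simp

section \<open>The total weight and the numerical bound\<close>

lemma sum_set_le_sum_list:
  fixes g :: "'a \<Rightarrow> real"
  assumes "\<And>x. 0 \<le> g x"
  shows "(\<Sum>x\<in>set xs. g x) \<le> (\<Sum>x\<leftarrow>xs. g x)"
proof (induction xs)
  case (Cons x xs)
  have "(\<Sum>x\<in>set (x # xs). g x) \<le> g x + (\<Sum>x\<in>set xs. g x)"
    using assms[of x] by (cases "x \<in> set xs") (auto simp: insert_absorb)
  with Cons show ?case by simp
qed simp

lemma sum_prism_weight_cells: "(\<Sum>\<tau>\<in>cell ` set lifted_cells. prism_weight \<tau>) \<le> 44 / 3"
proof -
  have nonneg: "0 \<le> prism_weight \<tau>" for \<tau> by (simp add: prism_weight_def prod_nonneg)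
  have w: "prism_weight (cell x) = weight6 x / 6" if x: "x \<in> set lifted_cells" for x
  proof -
    define q :: nat where "q = (\<Prod>i<3. fact (card (colour_class (cell x) i) - 1))"
    have "weight6 x * (\<Prod>i\<leftarrow>[0,1,2]. fact (length (filter (\<lambda>(a, _). snd a = i) (snd x)) - 1)) = 6"
      using lifted_cells_weight(1) x by (simp only: list_all_iff)
    then have "weight6 x * q = 6"
      by (simp add: q_def card_colour_class_cell[OF x] eval_nat_numeral mult_ac)
    then have "real (weight6 x) * real q = 6" by (metis of_nat_mult of_nat_numeral)
    moreover from this have "real q \<noteq> 0" by (metis mult_zero_right zero_neq_numeral)
    ultimately have "real (weight6 x) = 6 / real q" by (simp add: field_simps)
    moreover have "prism_weight (cell x) = 1 / real q"
      by (simp add: prism_weight_def q_def prod_dividef)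
    ultimately show ?thesis by simp
  qed
  have div6: "(\<Sum>x\<leftarrow>xs. weight6 x / 6) = real (\<Sum>x\<leftarrow>xs. weight6 x) / 6" for xs
    by (induction xs) (simp_all add: add_divide_distrib)
  \<comment> \<open>Entries with the same cell could only merge, and the weights are nonnegative, so
    the sum over the list bounds the sum over the set of cells.\<close>
  have "(\<Sum>\<tau>\<in>cell ` set lifted_cells. prism_weight \<tau>) \<le> (\<Sum>x\<in>set lifted_cells. prism_weight (cell x))"
    using sum_image_le[of "set lifted_cells" prism_weight cell] nonneg by (simp add: comp_def)
  also have "\<dots> = (\<Sum>x\<in>set lifted_cells. weight6 x / 6)" by (intro sum.cong refl w)
  also have "\<dots> \<le> (\<Sum>x\<leftarrow>lifted_cells. weight6 x / 6)"
    by (intro sum_set_le_sum_list) auto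
  also have "\<dots> = real (\<Sum>x\<leftarrow>lifted_cells. weight6 x) / 6"
    by (rule div6)
  finally show ?thesis unfolding lifted_cells_weight(2) by simp
qed

theorem mainTheorem1:
  shows "convergent rho \<and> lim rho \<le> root 3 ((44 / 3) / 27) \<and>
         \<bar>root 3 ((44 / 3) / 27) - 0.8159\<bar> \<le> 0.00005"
proof -
  let ?r = "root 3 ((44 / 3) / 27) :: real"
  \<comment> \<open>Cubing removes the root: 44/81 lies between the cubes of 0.81585 and
    0.81595.\<close>
  have "(0.81585 :: real) = root 3 (0.81585 ^ 3)" by (rule real_root_power_cancel[symmetric]) simp_all
  also have "\<dots> \<le> ?r" by (rule real_root_le_mono) (simp_all add: power3_eq_cube)
  finally have "0.81585 \<le> ?r" .
  moreover have "?r \<le> root 3 (0.81595 ^ 3)" by (rule real_root_le_mono) (simp_all add: power3_eq_cube)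
  then have "?r \<le> 0.81595" by (subst (asm) real_root_power_cancel) simp_all
  ultimately have "\<bar>?r - 0.8159\<bar> \<le> 0.00005" by (intro abs_leI) simp_all
  then show ?thesis
    using rho_convergent_le[OF prism_complex_cells sum_prism_weight_cells] by simp
qed

end
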